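(* Let $R$ be a discrete valuation domain of characteristic $0$ with maximal ideal $pR$ for some prime number $p$, let $G$ be a finite cyclic $p$-group, and let $M$ be an $R[G]$-lattice. Then there exist finite $G$-sets $\Omega_0$ and $\Omega_1$, and a short exact sequence $$0\longrightarrow R[\Omega_1]\longrightarrow R[\Omega_0]\longrightarrow M\longrightarrow 0$$ of $R[G]$-lattices.
   Context: An $R[G]$-lattice is a finitely generated left $R[G]$-module which is projective as an $R$-module. For a finite left $G$-set $\Omega$, $R[\Omega]$ denotes the associated permutation $R[G]$-module, i.e. the free $R$-module with basis $\Omega$ on which $G$ acts by permuting the basis. *)

theory Defs
  imports
    "HOL-Algebra.Elementary_Groups"
    "HOL-Algebra.Group_Action"
    "HOL-Algebra.Module"
    "HOL-Algebra.Ring_Divisibility"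
    "HOL-Computational_Algebra.Primes"
begin

section \<open>Discrete valuation domains\<close>

definition discrete_valuation_domain :: "('r, 'a) ring_scheme \<Rightarrow> bool" where
  "discrete_valuation_domain R \<longleftrightarrow>
     principal_domain R \<and> (\<exists>!P. primeideal P R \<and> P \<noteq> {\<zero>\<^bsub>R\<^esub>})"

definition ring_char_zero :: "('r, 'a) ring_scheme \<Rightarrow> bool" where
  "ring_char_zero R \<longleftrightarrow> (\<forall>n::nat. n > 0 \<longrightarrow> [n] \<cdot>\<^bsub>R\<^esub> \<one>\<^bsub>R\<^esub> \<noteq> \<zero>\<^bsub>R\<^esub>)"


section \<open>Modules\<close>

text \<open>Only the additive structure and the scalar multiplication of a module record are
  meaningful; its fields \<open>mult\<close> and \<open>one\<close> are irrelevant.\<close>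

definition module_homs ::
  "('r, 'a) ring_scheme \<Rightarrow> ('r, 'm, 'b) module_scheme \<Rightarrow> ('r, 'n, 'c) module_scheme
    \<Rightarrow> ('m \<Rightarrow> 'n) set" where
  "module_homs R M N =
     {h \<in> hom (add_monoid M) (add_monoid N).
        \<forall>r\<in>carrier R. \<forall>x\<in>carrier M. h (r \<odot>\<^bsub>M\<^esub> x) = r \<odot>\<^bsub>N\<^esub> h x}"

definition finitely_generated_module ::
  "('r, 'a) ring_scheme \<Rightarrow> ('r, 'm, 'b) module_scheme \<Rightarrow> bool" where
  "finitely_generated_module R M \<longleftrightarrow>
     (\<exists>S. finite S \<and> S \<subseteq> carrier M \<and>
       (\<forall>x\<in>carrier M. \<exists>c \<in> S \<rightarrow> carrier R. x = (\<Oplus>\<^bsub>M\<^esub>s\<in>S. c s \<odot>\<^bsub>M\<^esub> s)))"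

text \<open>The lifting property. A definition cannot quantify over types, so the modules \<open>U\<close> and
  \<open>V\<close> are taken in types which are large enough for the free module on \<open>carrier M\<close> and for
  \<open>M\<close> itself; lemma \<open>projective_module_lift\<close> below shows that the lifting property then
  holds for modules over arbitrary types.\<close>

definition projective_module ::
  "('r, 'a) ring_scheme \<Rightarrow> ('r, 'm, 'b) module_scheme \<Rightarrow> bool" where
  "projective_module R M \<longleftrightarrow>
     (\<forall>(U :: ('r, 'm \<Rightarrow> 'r) module) (V :: ('r, 'm) module).
        \<forall>g \<in> module_homs R U V. \<forall>f \<in> module_homs R M V.
          module R U \<longrightarrow> module R V \<longrightarrow> g ` carrier U = carrier V \<longrightarrow>
          (\<exists>h \<in> module_homs R M U. \<forall>x\<in>carrier M. g (h x) = f x))"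


section \<open>Group rings, lattices and permutation modules\<close>

text \<open>There is no finite-support condition: this is the group ring for finite \<open>G\<close> only.\<close>

definition group_ring ::
  "('r, 'a) ring_scheme \<Rightarrow> ('g, 'b) monoid_scheme \<Rightarrow> ('g \<Rightarrow> 'r) ring" where
  "group_ring R G =
     \<lparr>carrier = carrier G \<rightarrow>\<^sub>E carrier R,
      monoid.mult = (\<lambda>a b. \<lambda>x\<in>carrier G. \<Oplus>\<^bsub>R\<^esub>y\<in>carrier G. a y \<otimes>\<^bsub>R\<^esub> b (inv\<^bsub>G\<^esub> y \<otimes>\<^bsub>G\<^esub> x)),
      one = (\<lambda>x\<in>carrier G. if x = \<one>\<^bsub>G\<^esub> then \<one>\<^bsub>R\<^esub> else \<zero>\<^bsub>R\<^esub>),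
      zero = (\<lambda>x\<in>carrier G. \<zero>\<^bsub>R\<^esub>),
      add = (\<lambda>a b. \<lambda>x\<in>carrier G. a x \<oplus>\<^bsub>R\<^esub> b x)\<rparr>"

definition group_ring_scalar ::
  "('r, 'a) ring_scheme \<Rightarrow> ('g, 'b) monoid_scheme \<Rightarrow> 'r \<Rightarrow> 'g \<Rightarrow> 'r" where
  "group_ring_scalar R G r = (\<lambda>x\<in>carrier G. if x = \<one>\<^bsub>G\<^esub> then r else \<zero>\<^bsub>R\<^esub>)"

definition group_ring_elem ::
  "('r, 'a) ring_scheme \<Rightarrow> ('g, 'b) monoid_scheme \<Rightarrow> 'g \<Rightarrow> 'g \<Rightarrow> 'r" where
  "group_ring_elem R G g = (\<lambda>x\<in>carrier G. if x = g then \<one>\<^bsub>R\<^esub> else \<zero>\<^bsub>R\<^esub>)"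

definition restrict_scalars ::
  "('r, 'a) ring_scheme \<Rightarrow> ('g, 'b) monoid_scheme \<Rightarrow> ('g \<Rightarrow> 'r, 'm, 'c) module_scheme
    \<Rightarrow> ('r, 'm) module" where
  "restrict_scalars R G M =
     \<lparr>carrier = carrier M, monoid.mult = monoid.mult M, one = one M, zero = zero M, add = add M,
      smult = (\<lambda>r x. group_ring_scalar R G r \<odot>\<^bsub>M\<^esub> x)\<rparr>"

text \<open>The locale \<open>module\<close> requires the ring of scalars to be commutative, so \<open>G\<close> must be
  commutative here.\<close>

definition group_ring_lattice ::
  "('r, 'a) ring_scheme \<Rightarrow> ('g, 'b) monoid_scheme \<Rightarrow> ('g \<Rightarrow> 'r, 'm, 'c) module_scheme \<Rightarrow> bool" where
  "group_ring_lattice R G M \<longleftrightarrow>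
     module (group_ring R G) M \<and>
     finitely_generated_module (group_ring R G) M \<and>
     projective_module R (restrict_scalars R G M)"

text \<open>Elements are written as coefficient functions \<open>f\<close>, standing for the sum of the
  \<open>f w \<cdot> w\<close>; since \<open>g\<close> sends the basis element \<open>w\<close> to \<open>\<phi> g w\<close>, the coefficient of
  \<open>g \<cdot> f\<close> at \<open>w\<close> is \<open>f (\<phi> (g\<^sup>-\<^sup>1) w)\<close>
  (see \<open>permutation_module_basis_action\<close>). \<open>E\<close> is a finite \<open>G\<close>-set.\<close>

definition permutation_module ::
  "('r, 'a) ring_scheme \<Rightarrow> ('g, 'b) monoid_scheme \<Rightarrow> 'w set \<Rightarrow> ('g \<Rightarrow> 'w \<Rightarrow> 'w)
    \<Rightarrow> ('g \<Rightarrow> 'r, 'w \<Rightarrow> 'r) module" where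
  "permutation_module R G E \<phi> =
     \<lparr>carrier = E \<rightarrow>\<^sub>E carrier R, monoid.mult = undefined, one = undefined,
      zero = (\<lambda>w\<in>E. \<zero>\<^bsub>R\<^esub>),
      add = (\<lambda>f h. \<lambda>w\<in>E. f w \<oplus>\<^bsub>R\<^esub> h w),
      smult = (\<lambda>a f. \<lambda>w\<in>E. \<Oplus>\<^bsub>R\<^esub>g\<in>carrier G. a g \<otimes>\<^bsub>R\<^esub> f (\<phi> (inv\<^bsub>G\<^esub> g) w))\<rparr>"

definition permutation_basis ::
  "('r, 'a) ring_scheme \<Rightarrow> 'w set \<Rightarrow> 'w \<Rightarrow> 'w \<Rightarrow> 'r" where
  "permutation_basis R E v = (\<lambda>w\<in>E. if w = v then \<one>\<^bsub>R\<^esub> else \<zero>\<^bsub>R\<^esub>)"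

definition short_exact_lattices ::
  "('r, 'a) ring_scheme \<Rightarrow> ('g, 'b) monoid_scheme
    \<Rightarrow> ('g \<Rightarrow> 'r, 'l, 'c) module_scheme \<Rightarrow> ('l \<Rightarrow> 'm)
    \<Rightarrow> ('g \<Rightarrow> 'r, 'm, 'd) module_scheme \<Rightarrow> ('m \<Rightarrow> 'n)
    \<Rightarrow> ('g \<Rightarrow> 'r, 'n, 'e) module_scheme \<Rightarrow> bool" where
  "short_exact_lattices R G L i M q N \<longleftrightarrow>
     group_ring_lattice R G L \<and> group_ring_lattice R G M \<and> group_ring_lattice R G N \<and>
     i \<in> module_homs (group_ring R G) L M \<and> q \<in> module_homs (group_ring R G) M N \<and>
     inj_on i (carrier L) \<and>
     i ` carrier L = a_kernel M N q \<and>
     q ` carrier M = carrier N"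


section \<open>Projectivity does not depend on the types of the test modules\<close>

lemma module_homD:
  assumes "h \<in> module_homs R M N"
  shows "x \<in> carrier M \<Longrightarrow> h x \<in> carrier N"
    and "x \<in> carrier M \<Longrightarrow> y \<in> carrier M \<Longrightarrow> h (x \<oplus>\<^bsub>M\<^esub> y) = h x \<oplus>\<^bsub>N\<^esub> h y"
    and "r \<in> carrier R \<Longrightarrow> x \<in> carrier M \<Longrightarrow> h (r \<odot>\<^bsub>M\<^esub> x) = r \<odot>\<^bsub>N\<^esub> h x"
  using assms by (auto simp: module_homs_def hom_def)

lemma module_homI:
  assumes "\<And>x. x \<in> carrier M \<Longrightarrow> h x \<in> carrier N"
    and "\<And>x y. x \<in> carrier M \<Longrightarrow> y \<in> carrier M \<Longrightarrow> h (x \<oplus>\<^bsub>M\<^esub> y) = h x \<oplus>\<^bsub>N\<^esub> h y"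
    and "\<And>r x. r \<in> carrier R \<Longrightarrow> x \<in> carrier M \<Longrightarrow> h (r \<odot>\<^bsub>M\<^esub> x) = r \<odot>\<^bsub>N\<^esub> h x"
  shows "h \<in> module_homs R M N"
  using assms by (auto simp: module_homs_def hom_def)

lemma module_hom_finsum:
  assumes "module R M" "module R N" "h \<in> module_homs R M N" "finite A"
    and "\<And>a. a \<in> A \<Longrightarrow> x a \<in> carrier M"
  shows "h (\<Oplus>\<^bsub>M\<^esub>a\<in>A. x a) = (\<Oplus>\<^bsub>N\<^esub>a\<in>A. h (x a))"
proof -
  interpret M: module R M by fact
  interpret N: module R N by fact
  note h = module_homD[OF assms(3)]
  show ?thesis using assms(4,5)
  proof (induction A)
    case empty
    have "h \<zero>\<^bsub>M\<^esub> = h (\<zero>\<^bsub>R\<^esub> \<odot>\<^bsub>M\<^esub> \<zero>\<^bsub>M\<^esub>)" by simp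
    also have "\<dots> = \<zero>\<^bsub>N\<^esub>" by (subst h(3)) (auto simp: h(1))
    finally show ?case by simp
  next
    case (insert a A)
    then show ?case by (simp add: M.finsum_insert N.finsum_insert h Pi_def)
  qed
qed

lemma abelian_group_same_add:
  assumes "abelian_group M" "carrier N = carrier M" "zero N = zero M" "add N = add M"
  shows "abelian_group N"
proof -
  interpret M: abelian_group M by fact
  show ?thesis
  proof (rule abelian_groupI, unfold assms(2-))
    show "\<exists>y\<in>carrier M. y \<oplus>\<^bsub>M\<^esub> x = \<zero>\<^bsub>M\<^esub>" if "x \<in> carrier M" for x
      using that M.l_neg[of x] by blast
  qed (auto simp: M.a_assoc intro: M.a_comm)
qed

definition coefficient_support :: "('r, 'a) ring_scheme \<Rightarrow> 'm set \<Rightarrow> ('m \<Rightarrow> 'r) \<Rightarrow> 'm set" where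
  "coefficient_support R B c = {b \<in> B. c b \<noteq> \<zero>\<^bsub>R\<^esub>}"

definition free_module :: "('r, 'a) ring_scheme \<Rightarrow> 'm set \<Rightarrow> ('r, 'm \<Rightarrow> 'r) module" where
  "free_module R B =
     \<lparr>carrier = {c \<in> B \<rightarrow>\<^sub>E carrier R. finite (coefficient_support R B c)},
      monoid.mult = undefined, one = undefined, zero = (\<lambda>b\<in>B. \<zero>\<^bsub>R\<^esub>),
      add = (\<lambda>c d. \<lambda>b\<in>B. c b \<oplus>\<^bsub>R\<^esub> d b), smult = (\<lambda>r c. \<lambda>b\<in>B. r \<otimes>\<^bsub>R\<^esub> c b)\<rparr>"

definition linear_extension ::
  "('r, 'a) ring_scheme \<Rightarrow> 'm set \<Rightarrow> ('r, 'u, 'c) module_scheme \<Rightarrow> ('m \<Rightarrow> 'u) \<Rightarrow> ('m \<Rightarrow> 'r) \<Rightarrow> 'u" where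
  "linear_extension R B U t c = (\<Oplus>\<^bsub>U\<^esub>b\<in>coefficient_support R B c. c b \<odot>\<^bsub>U\<^esub> t b)"

lemma free_module_closed:
  assumes "cring R"
  shows "c \<in> carrier (free_module R B) \<Longrightarrow> d \<in> carrier (free_module R B) \<Longrightarrow>
           c \<oplus>\<^bsub>free_module R B\<^esub> d \<in> carrier (free_module R B)"
    and "r \<in> carrier R \<Longrightarrow> c \<in> carrier (free_module R B) \<Longrightarrow>
           r \<odot>\<^bsub>free_module R B\<^esub> c \<in> carrier (free_module R B)"
proof -
  interpret R: cring R by fact
  let ?S = "coefficient_support R B"
  { assume c: "c \<in> carrier (free_module R B)" and d: "d \<in> carrier (free_module R B)"
    have "?S (\<lambda>b\<in>B. c b \<oplus>\<^bsub>R\<^esub> d b) \<subseteq> ?S c \<union> ?S d" by (auto simp: coefficient_support_def)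
    moreover have "finite (?S c \<union> ?S d)" using c d by (simp add: free_module_def)
    ultimately have "finite (?S (\<lambda>b\<in>B. c b \<oplus>\<^bsub>R\<^esub> d b))" by (rule finite_subset)
    then show "c \<oplus>\<^bsub>free_module R B\<^esub> d \<in> carrier (free_module R B)"
      using c d by (auto simp: free_module_def PiE_iff) }
  { assume r: "r \<in> carrier R" and c: "c \<in> carrier (free_module R B)"
    have "?S (\<lambda>b\<in>B. r \<otimes>\<^bsub>R\<^esub> c b) \<subseteq> ?S c" using r by (auto simp: coefficient_support_def)
    moreover have "finite (?S c)" using c by (simp add: free_module_def)
    ultimately have "finite (?S (\<lambda>b\<in>B. r \<otimes>\<^bsub>R\<^esub> c b))" by (rule finite_subset)
    then show "r \<odot>\<^bsub>free_module R B\<^esub> c \<in> carrier (free_module R B)"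
      using r c by (auto simp: free_module_def PiE_iff) }
qed

lemma free_module_module:
  assumes "cring R"
  shows "module R (free_module R B)"
proof -
  interpret R: cring R by fact
  let ?F = "free_module R B"
  have abel: "abelian_group ?F"
  proof (rule abelian_groupI)
    show "\<zero>\<^bsub>?F\<^esub> \<in> carrier ?F"
      by (auto simp: free_module_def coefficient_support_def)
    show "\<exists>y\<in>carrier ?F. y \<oplus>\<^bsub>?F\<^esub> x = \<zero>\<^bsub>?F\<^esub>" if x: "x \<in> carrier ?F" for x
    proof (rule bexI)
      show "(\<ominus>\<^bsub>R\<^esub> \<one>\<^bsub>R\<^esub>) \<odot>\<^bsub>?F\<^esub> x \<in> carrier ?F"
        using x by (intro free_module_closed[OF assms]) auto
      show "((\<ominus>\<^bsub>R\<^esub> \<one>\<^bsub>R\<^esub>) \<odot>\<^bsub>?F\<^esub> x) \<oplus>\<^bsub>?F\<^esub> x = \<zero>\<^bsub>?F\<^esub>"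
        using x by (auto simp: free_module_def PiE_iff fun_eq_iff R.l_minus R.l_neg)
    qed
    show "c \<oplus>\<^bsub>?F\<^esub> d \<in> carrier ?F" if "c \<in> carrier ?F" "d \<in> carrier ?F" for c d
      using that by (rule free_module_closed(1)[OF assms])
  qed (auto simp: free_module_def PiE_iff fun_eq_iff extensional_def R.a_assoc intro: R.a_comm)
  show ?thesis
  proof (rule moduleI[OF assms abel])
    show "r \<odot>\<^bsub>?F\<^esub> c \<in> carrier ?F" if "r \<in> carrier R" "c \<in> carrier ?F" for r c
      using that by (rule free_module_closed(2)[OF assms])
  qed (auto simp: free_module_def PiE_iff fun_eq_iff extensional_def R.l_distr R.r_distr R.m_assoc)
qed

lemma linear_extension_eq:
  assumes "module R U" "finite S" "coefficient_support R B c \<subseteq> S" "S \<subseteq> B"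
    and "c \<in> B \<rightarrow> carrier R" "t \<in> B \<rightarrow> carrier U"
  shows "linear_extension R B U t c = (\<Oplus>\<^bsub>U\<^esub>b\<in>S. c b \<odot>\<^bsub>U\<^esub> t b)"
proof -
  interpret U: module R U by fact
  show ?thesis unfolding linear_extension_def
    using assms(2-)
    by (intro U.add.finprod_mono_neutral_cong_left)
      (auto simp: coefficient_support_def Pi_def subset_iff)
qed

lemma linear_extension_hom:
  assumes "module R U" "t \<in> B \<rightarrow> carrier U"
  shows "linear_extension R B U t \<in> module_homs R (free_module R B) U"
proof -
  interpret U: module R U by fact
  let ?F = "free_module R B" and ?S = "coefficient_support R B" and ?l = "linear_extension R B U t"
  note eq = linear_extension_eq[OF assms(1) _ _ _ _ assms(2)]
  have F: "c \<in> B \<rightarrow> carrier R" "finite (?S c)" "?S c \<subseteq> B" if "c \<in> carrier ?F" for c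
    using that by (auto simp: free_module_def coefficient_support_def)
  have val: "c b \<in> carrier R" "t b \<in> carrier U" if "c \<in> carrier ?F" "b \<in> B" for c b
    using F(1)[OF that(1)] assms(2) that(2) by auto
  show ?thesis
  proof (rule module_homI)
    show "?l c \<in> carrier U" if c: "c \<in> carrier ?F" for c
      unfolding linear_extension_def
      using F[OF c] val[OF c] by (intro U.finsum_closed) (auto simp: coefficient_support_def)
    show "?l (c \<oplus>\<^bsub>?F\<^esub> d) = ?l c \<oplus>\<^bsub>U\<^esub> ?l d" if c: "c \<in> carrier ?F" and d: "d \<in> carrier ?F" for c d
    proof -
      define S where "S = ?S c \<union> ?S d"
      have S: "finite S" "S \<subseteq> B" "?S c \<subseteq> S" "?S d \<subseteq> S"
        using F[OF c] F[OF d] by (auto simp: S_def)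
      have cd: "(c \<oplus>\<^bsub>?F\<^esub> d) b = c b \<oplus>\<^bsub>R\<^esub> d b" if "b \<in> B" for b
        using that by (simp add: free_module_def)
      have "?S (c \<oplus>\<^bsub>?F\<^esub> d) \<subseteq> S"
        using cd by (auto simp: S_def coefficient_support_def)
      moreover have "c \<oplus>\<^bsub>?F\<^esub> d \<in> B \<rightarrow> carrier R"
        using cd val c d by (auto simp: Pi_iff)
      ultimately have "?l (c \<oplus>\<^bsub>?F\<^esub> d) = (\<Oplus>\<^bsub>U\<^esub>b\<in>S. (c \<oplus>\<^bsub>?F\<^esub> d) b \<odot>\<^bsub>U\<^esub> t b)"
        using S by (intro eq) auto
      also have "\<dots> = (\<Oplus>\<^bsub>U\<^esub>b\<in>S. c b \<odot>\<^bsub>U\<^esub> t b \<oplus>\<^bsub>U\<^esub> d b \<odot>\<^bsub>U\<^esub> t b)"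
      proof (intro U.finsum_cong' refl)
        fix b assume "b \<in> S"
        then have "b \<in> B" using S by auto
        then show "(c \<oplus>\<^bsub>?F\<^esub> d) b \<odot>\<^bsub>U\<^esub> t b = c b \<odot>\<^bsub>U\<^esub> t b \<oplus>\<^bsub>U\<^esub> d b \<odot>\<^bsub>U\<^esub> t b"
          using val c d by (simp add: cd U.smult_l_distr)
      qed (use S val c d in \<open>auto simp: Pi_iff subset_iff\<close>)
      also have "\<dots> = (\<Oplus>\<^bsub>U\<^esub>b\<in>S. c b \<odot>\<^bsub>U\<^esub> t b) \<oplus>\<^bsub>U\<^esub> (\<Oplus>\<^bsub>U\<^esub>b\<in>S. d b \<odot>\<^bsub>U\<^esub> t b)"
        using S val c d by (intro U.finsum_addf) (auto simp: Pi_iff subset_iff)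
      also have "\<dots> = ?l c \<oplus>\<^bsub>U\<^esub> ?l d"
        using S F c d by (simp add: eq)
      finally show ?thesis .
    qed
    show "?l (r \<odot>\<^bsub>?F\<^esub> c) = r \<odot>\<^bsub>U\<^esub> ?l c" if r: "r \<in> carrier R" and c: "c \<in> carrier ?F" for r c
    proof -
      have rc: "(r \<odot>\<^bsub>?F\<^esub> c) b = r \<otimes>\<^bsub>R\<^esub> c b" if "b \<in> B" for b
        using that by (simp add: free_module_def)
      have "?l (r \<odot>\<^bsub>?F\<^esub> c) = (\<Oplus>\<^bsub>U\<^esub>b\<in>?S c. (r \<odot>\<^bsub>?F\<^esub> c) b \<odot>\<^bsub>U\<^esub> t b)"
        using F[OF c] val[OF c] r rc
        by (intro eq) (auto simp: coefficient_support_def Pi_iff)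
      also have "\<dots> = (\<Oplus>\<^bsub>U\<^esub>b\<in>?S c. r \<odot>\<^bsub>U\<^esub> (c b \<odot>\<^bsub>U\<^esub> t b))"
        using val[OF c] r rc
        by (intro U.finsum_cong') (auto simp: coefficient_support_def U.smult_assoc1)
      also have "\<dots> = r \<odot>\<^bsub>U\<^esub> ?l c"
        unfolding linear_extension_def using val[OF c] r F[OF c]
        by (intro U.finsum_smult_ldistr[symmetric]) (auto simp: coefficient_support_def)
      finally show ?thesis .
    qed
  qed
qed

lemma projective_module_lift:
  fixes M :: "('r, 'm, 'b) module_scheme" and U :: "('r, 'u, 'c) module_scheme"
    and V :: "('r, 'v, 'd) module_scheme"
  assumes "module R M" "projective_module R M" "module R U" "module R V"
    and g: "g \<in> module_homs R U V" and f: "f \<in> module_homs R M V"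
    and surj: "g ` carrier U = carrier V"
  shows "\<exists>h \<in> module_homs R M U. \<forall>x\<in>carrier M. g (h x) = f x"
proof -
  interpret M: module R M by fact
  interpret U: module R U by fact
  interpret V: module R V by fact
  let ?B = "carrier M"
  let ?F = "free_module R ?B" and ?S = "coefficient_support R ?B"
  define N :: "('r, 'm) module" where
    "N = \<lparr>carrier = carrier M, monoid.mult = monoid.mult M, one = one M, zero = zero M,
          add = add M, smult = smult M\<rparr>"
  have NM: "carrier N = carrier M" by (simp add: N_def)
  have finsum_N: "finsum N k A = finsum M k A" for k :: "'m \<Rightarrow> 'm" and A
    by (simp add: finsum_def finprod_def N_def)
  have "abelian_group N"
    by (rule abelian_group_same_add[OF M.abelian_group_axioms]) (simp_all add: N_def)
  then have N: "module R N"
    by (rule moduleI[OF M.is_cring], unfold N_def module.simps ring.simps partial_object.simps)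
       (rule M.smult_closed M.smult_l_distr M.smult_r_distr M.smult_assoc1 M.smult_one; assumption)+
  interpret N: module R N by fact
  interpret F: module R ?F by (rule free_module_module[OF M.is_cring])
  have F: "c \<in> ?B \<rightarrow> carrier R" "finite (?S c)" "?S c \<subseteq> ?B" if "c \<in> carrier ?F" for c
    using that by (auto simp: free_module_def coefficient_support_def)
  let ?\<pi> = "linear_extension R ?B N (\<lambda>x. x)"
  have \<pi>: "?\<pi> \<in> module_homs R ?F N"
    by (rule linear_extension_hom[OF N]) (auto simp: N_def)
  have "x \<in> ?\<pi> ` carrier ?F" if x: "x \<in> carrier M" for x
  proof (rule image_eqI)
    let ?e = "\<lambda>b\<in>?B. if b = x then \<one>\<^bsub>R\<^esub> else \<zero>\<^bsub>R\<^esub>"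
    have sub: "?S ?e \<subseteq> {x}" by (auto simp: coefficient_support_def)
    then have "finite (?S ?e)" by (rule finite_subset) simp
    then show "?e \<in> carrier ?F" by (auto simp: free_module_def)
    have "?\<pi> ?e = (\<Oplus>\<^bsub>N\<^esub>b\<in>{x}. ?e b \<odot>\<^bsub>N\<^esub> b)"
      using x sub by (intro linear_extension_eq[OF N]) (auto simp: N_def)
    also have "\<dots> = \<one>\<^bsub>R\<^esub> \<odot>\<^bsub>N\<^esub> x"
      using x N.smult_closed[of "\<one>\<^bsub>R\<^esub>" x] by (simp add: N.finsum_insert N.finsum_empty NM)
    also have "\<dots> = x" using x by (intro N.smult_one) (simp add: NM)
    finally show "x = ?\<pi> ?e" ..
  qed
  then have \<pi>_surj: "?\<pi> ` carrier ?F = carrier N"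
    using module_homD(1)[OF \<pi>] NM by (intro equalityI subsetI) (erule imageE, simp_all only:)
  have "(\<lambda>x. x) \<in> module_homs R M N" by (rule module_homI) (auto simp: N_def)
  from assms(2)[unfolded projective_module_def, rule_format, OF \<pi> this F.module_axioms N \<pi>_surj]
  obtain s where s: "s \<in> module_homs R M ?F" and s_eq: "\<And>x. x \<in> ?B \<Longrightarrow> ?\<pi> (s x) = x"
    by blast
  have "\<forall>m\<in>?B. \<exists>u\<in>carrier U. g u = f m"
  proof
    fix m assume "m \<in> ?B"
    then have "f m \<in> g ` carrier U" unfolding surj by (rule module_homD(1)[OF f])
    then show "\<exists>u\<in>carrier U. g u = f m" by auto
  qed
  then have "\<forall>m\<in>?B. \<exists>u. u \<in> carrier U \<and> g u = f m" by blast
  from bchoice[OF this] obtain t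
    where t: "\<And>m. m \<in> ?B \<Longrightarrow> t m \<in> carrier U \<and> g (t m) = f m" by blast
  let ?\<tau> = "linear_extension R ?B U t"
  have \<tau>: "?\<tau> \<in> module_homs R ?F U" by (rule linear_extension_hom[OF assms(3)]) (use t in auto)
  have "g (?\<tau> (s x)) = f x" if x: "x \<in> ?B" for x
  proof -
    define c where "c = s x"
    have c: "c \<in> carrier ?F" using module_homD(1)[OF s x] by (simp add: c_def)
    note Fc = F[OF c]
    have cb [simp]: "c b \<in> carrier R" if "b \<in> carrier M" for b using Fc(1) that by auto
    have "g (?\<tau> c) = (\<Oplus>\<^bsub>V\<^esub>b\<in>?S c. g (c b \<odot>\<^bsub>U\<^esub> t b))"
      unfolding linear_extension_def using Fc t
      by (intro module_hom_finsum[OF assms(3,4) g]) (auto simp: coefficient_support_def)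
    also have "\<dots> = (\<Oplus>\<^bsub>V\<^esub>b\<in>?S c. f (c b \<odot>\<^bsub>M\<^esub> b))"
    proof (intro V.finsum_cong' refl)
      fix b assume "b \<in> ?S c"
      then have b: "b \<in> carrier M" using Fc by auto
      have "g (c b \<odot>\<^bsub>U\<^esub> t b) = c b \<odot>\<^bsub>V\<^esub> f b"
        using t[OF b] cb[OF b] module_homD(3)[OF g] by simp
      also have "\<dots> = f (c b \<odot>\<^bsub>M\<^esub> b)"
        using b cb[OF b] module_homD(3)[OF f] by simp
      finally show "g (c b \<odot>\<^bsub>U\<^esub> t b) = f (c b \<odot>\<^bsub>M\<^esub> b)" .
    next
      have "f (c b \<odot>\<^bsub>M\<^esub> b) \<in> carrier V" if "b \<in> carrier M" for b
        using that by (intro module_homD(1)[OF f]) simp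
      then show "(\<lambda>b. f (c b \<odot>\<^bsub>M\<^esub> b)) \<in> ?S c \<rightarrow> carrier V" using Fc(3) by auto
    qed
    also have "\<dots> = f (\<Oplus>\<^bsub>M\<^esub>b\<in>?S c. c b \<odot>\<^bsub>M\<^esub> b)"
      using Fc by (intro module_hom_finsum[OF assms(1,4) f, symmetric]) (auto simp: coefficient_support_def)
    also have "(\<Oplus>\<^bsub>M\<^esub>b\<in>?S c. c b \<odot>\<^bsub>M\<^esub> b) = ?\<pi> c"
      unfolding linear_extension_def finsum_N by (simp only: N_def module.simps)
    also have "\<dots> = x" using s_eq[OF x] by (simp add: c_def)
    finally show ?thesis by (simp add: c_def)
  qed
  then have "\<forall>x\<in>?B. g (?\<tau> (s x)) = f x" ..
  moreover have "(\<lambda>x. ?\<tau> (s x)) \<in> module_homs R M U"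
  proof (rule module_homI)
    fix x y r
    assume x: "x \<in> carrier M"
    note sx = module_homD(1)[OF s x]
    show "?\<tau> (s x) \<in> carrier U" by (rule module_homD(1)[OF \<tau> sx])
    { assume y: "y \<in> carrier M"
      show "?\<tau> (s (x \<oplus>\<^bsub>M\<^esub> y)) = ?\<tau> (s x) \<oplus>\<^bsub>U\<^esub> ?\<tau> (s y)"
        unfolding module_homD(2)[OF s x y]
        by (rule module_homD(2)[OF \<tau> sx module_homD(1)[OF s y]]) }
    assume r: "r \<in> carrier R"
    show "?\<tau> (s (r \<odot>\<^bsub>M\<^esub> x)) = r \<odot>\<^bsub>U\<^esub> ?\<tau> (s x)"
      unfolding module_homD(3)[OF s r x] by (rule module_homD(3)[OF \<tau> r sx])
  qed
  ultimately show ?thesis by (rule bexI)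
qed


section \<open>Group rings and permutation modules are rings and modules\<close>

lemma (in abelian_monoid) finsum_swap:
  assumes "finite A" "finite B" "\<And>a b. a \<in> A \<Longrightarrow> b \<in> B \<Longrightarrow> f a b \<in> carrier G"
  shows "(\<Oplus>a\<in>A. \<Oplus>b\<in>B. f a b) = (\<Oplus>b\<in>B. \<Oplus>a\<in>A. f a b)"
  using assms(1,3)
proof (induction A)
  case empty
  then show ?case by simp
next
  case (insert x A)
  have "(\<Oplus>b\<in>B. \<Oplus>a\<in>insert x A. f a b) = (\<Oplus>b\<in>B. f x b \<oplus> (\<Oplus>a\<in>A. f a b))"
    using insert by (intro finsum_cong') (auto simp: finsum_insert)
  also have "\<dots> = (\<Oplus>b\<in>B. f x b) \<oplus> (\<Oplus>b\<in>B. \<Oplus>a\<in>A. f a b)"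
    using insert by (intro finsum_addf) auto
  finally show ?case using insert by (simp add: finsum_insert)
qed

lemma finsum_group_translate:
  assumes "group G" "cring R" "z \<in> carrier G" "\<And>x. x \<in> carrier G \<Longrightarrow> f x \<in> carrier R"
  shows "(\<Oplus>\<^bsub>R\<^esub>y\<in>carrier G. f y) = (\<Oplus>\<^bsub>R\<^esub>y\<in>carrier G. f (z \<otimes>\<^bsub>G\<^esub> y))"
proof -
  interpret G: group G by fact
  interpret R: cring R by fact
  have "inj_on (\<lambda>y. z \<otimes>\<^bsub>G\<^esub> y) (carrier G)" using assms(3) by (auto intro: inj_onI)
  moreover have "(\<lambda>y. z \<otimes>\<^bsub>G\<^esub> y) ` carrier G = carrier G"
    using G.surj_const_mult[OF assms(3)] .
  ultimately show ?thesis
    using R.add.finprod_reindex[of f "\<lambda>y. z \<otimes>\<^bsub>G\<^esub> y" "carrier G"] assms(4) by (simp add: Pi_def)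
qed

lemma finsum_group_delta:
  assumes "cring R" "finite A" "z \<in> A" "\<And>x. x \<in> A \<Longrightarrow> f x \<in> carrier R"
  shows "(\<Oplus>\<^bsub>R\<^esub>y\<in>A. (if y = z then \<one>\<^bsub>R\<^esub> else \<zero>\<^bsub>R\<^esub>) \<otimes>\<^bsub>R\<^esub> f y) = f z"
proof -
  interpret R: cring R by fact
  have "(\<Oplus>\<^bsub>R\<^esub>y\<in>A. (if y = z then \<one>\<^bsub>R\<^esub> else \<zero>\<^bsub>R\<^esub>) \<otimes>\<^bsub>R\<^esub> f y)
      = (\<Oplus>\<^bsub>R\<^esub>y\<in>A. (if z = y then f y else \<zero>\<^bsub>R\<^esub>))"
    using assms by (intro R.finsum_cong') auto
  also have "\<dots> = f z" using assms by (intro R.finsum_singleton) auto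
  finally show ?thesis .
qed

lemma group_ring_smult_assoc:
  fixes R (structure) and G (structure)
  assumes "cring R" "group G" "finite (carrier G)"
    and a: "a \<in> carrier G \<rightarrow> carrier R" and b: "b \<in> carrier G \<rightarrow> carrier R"
    and F: "\<And>g. g \<in> carrier G \<Longrightarrow> F g \<in> carrier R"
  shows "(\<Oplus>\<^bsub>R\<^esub>x\<in>carrier G. (\<Oplus>\<^bsub>R\<^esub>y\<in>carrier G. a y \<otimes>\<^bsub>R\<^esub> b (inv\<^bsub>G\<^esub> y \<otimes>\<^bsub>G\<^esub> x)) \<otimes>\<^bsub>R\<^esub> F x)
       = (\<Oplus>\<^bsub>R\<^esub>y\<in>carrier G. a y \<otimes>\<^bsub>R\<^esub> (\<Oplus>\<^bsub>R\<^esub>x\<in>carrier G. b x \<otimes>\<^bsub>R\<^esub> F (y \<otimes>\<^bsub>G\<^esub> x)))"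
proof -
  interpret G: group G by fact
  interpret R: cring R by fact
  have [simp, intro]: "a g \<in> carrier R" "b g \<in> carrier R" if "g \<in> carrier G" for g
    using a b that by auto
  have "(\<Oplus>\<^bsub>R\<^esub>x\<in>carrier G. (\<Oplus>\<^bsub>R\<^esub>y\<in>carrier G. a y \<otimes>\<^bsub>R\<^esub> b (inv\<^bsub>G\<^esub> y \<otimes>\<^bsub>G\<^esub> x)) \<otimes>\<^bsub>R\<^esub> F x)
     = (\<Oplus>\<^bsub>R\<^esub>x\<in>carrier G. \<Oplus>\<^bsub>R\<^esub>y\<in>carrier G. a y \<otimes>\<^bsub>R\<^esub> b (inv\<^bsub>G\<^esub> y \<otimes>\<^bsub>G\<^esub> x) \<otimes>\<^bsub>R\<^esub> F x)"
    using assms by (intro R.finsum_cong') (auto simp: R.finsum_ldistr)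
  also have "\<dots> = (\<Oplus>\<^bsub>R\<^esub>y\<in>carrier G. \<Oplus>\<^bsub>R\<^esub>x\<in>carrier G. a y \<otimes>\<^bsub>R\<^esub> b (inv\<^bsub>G\<^esub> y \<otimes>\<^bsub>G\<^esub> x) \<otimes>\<^bsub>R\<^esub> F x)"
    using assms by (intro R.finsum_swap) auto
  also have "\<dots> = (\<Oplus>\<^bsub>R\<^esub>y\<in>carrier G. a y \<otimes>\<^bsub>R\<^esub> (\<Oplus>\<^bsub>R\<^esub>x\<in>carrier G. b x \<otimes>\<^bsub>R\<^esub> F (y \<otimes>\<^bsub>G\<^esub> x)))"
  proof (intro R.finsum_cong' refl)
    fix y assume y: "y \<in> carrier G"
    have "(\<Oplus>\<^bsub>R\<^esub>x\<in>carrier G. a y \<otimes>\<^bsub>R\<^esub> b (inv\<^bsub>G\<^esub> y \<otimes>\<^bsub>G\<^esub> x) \<otimes>\<^bsub>R\<^esub> F x)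
      = (\<Oplus>\<^bsub>R\<^esub>x\<in>carrier G. a y \<otimes>\<^bsub>R\<^esub> b (inv\<^bsub>G\<^esub> y \<otimes>\<^bsub>G\<^esub> (y \<otimes>\<^bsub>G\<^esub> x)) \<otimes>\<^bsub>R\<^esub> F (y \<otimes>\<^bsub>G\<^esub> x))"
      using assms y by (intro finsum_group_translate) auto
    also have "\<dots> = (\<Oplus>\<^bsub>R\<^esub>x\<in>carrier G. a y \<otimes>\<^bsub>R\<^esub> (b x \<otimes>\<^bsub>R\<^esub> F (y \<otimes>\<^bsub>G\<^esub> x)))"
      using assms(4-) y by (intro R.finsum_cong') (auto simp: G.m_assoc[symmetric] R.m_assoc)
    also have "\<dots> = a y \<otimes>\<^bsub>R\<^esub> (\<Oplus>\<^bsub>R\<^esub>x\<in>carrier G. b x \<otimes>\<^bsub>R\<^esub> F (y \<otimes>\<^bsub>G\<^esub> x))"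
      using assms y by (intro R.finsum_rdistr[symmetric]) auto
    finally show "(\<Oplus>\<^bsub>R\<^esub>x\<in>carrier G. a y \<otimes>\<^bsub>R\<^esub> b (inv\<^bsub>G\<^esub> y \<otimes>\<^bsub>G\<^esub> x) \<otimes>\<^bsub>R\<^esub> F x)
      = a y \<otimes>\<^bsub>R\<^esub> (\<Oplus>\<^bsub>R\<^esub>x\<in>carrier G. b x \<otimes>\<^bsub>R\<^esub> F (y \<otimes>\<^bsub>G\<^esub> x))" .
  qed (use assms in auto)
  finally show ?thesis .
qed

lemma coefficient_abelian_group:
  assumes "cring R"
    and "carrier M = A \<rightarrow>\<^sub>E carrier R" "zero M = (\<lambda>x\<in>A. \<zero>\<^bsub>R\<^esub>)"
    and "add M = (\<lambda>a b. \<lambda>x\<in>A. a x \<oplus>\<^bsub>R\<^esub> b x)"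
  shows "abelian_group M"
proof -
  interpret R: cring R by fact
  show ?thesis
  proof (rule abelian_groupI)
    show "\<exists>y\<in>carrier M. y \<oplus>\<^bsub>M\<^esub> x = \<zero>\<^bsub>M\<^esub>" if "x \<in> carrier M" for x
      using that assms(2-)
      by (intro bexI[of _ "\<lambda>w\<in>A. \<ominus>\<^bsub>R\<^esub> x w"]) (auto simp: PiE_iff fun_eq_iff R.l_neg)
  qed (use assms(2-) in \<open>auto simp: PiE_iff fun_eq_iff extensional_def R.a_ac\<close>)
qed

lemma group_ring_cring:
  assumes "cring R" "comm_group G" "finite (carrier G)"
  shows "cring (group_ring R G)"
proof -
  interpret G: comm_group G by fact
  interpret R: cring R by fact
  let ?S = "group_ring R G"
  note d = group_ring_def
  have cl: "a \<otimes>\<^bsub>?S\<^esub> b \<in> carrier ?S" if "a \<in> carrier ?S" "b \<in> carrier ?S" for a b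
    using that by (auto simp: d PiE_iff intro!: R.finsum_closed)
  have comm: "a \<otimes>\<^bsub>?S\<^esub> b = b \<otimes>\<^bsub>?S\<^esub> a" if ab: "a \<in> carrier ?S" "b \<in> carrier ?S" for a b
  proof -
    have "(\<Oplus>\<^bsub>R\<^esub>y\<in>carrier G. a y \<otimes>\<^bsub>R\<^esub> b (inv\<^bsub>G\<^esub> y \<otimes>\<^bsub>G\<^esub> x))
        = (\<Oplus>\<^bsub>R\<^esub>y\<in>carrier G. b y \<otimes>\<^bsub>R\<^esub> a (inv\<^bsub>G\<^esub> y \<otimes>\<^bsub>G\<^esub> x))" if x: "x \<in> carrier G" for x
    proof -
      let ?h = "\<lambda>y. inv\<^bsub>G\<^esub> y \<otimes>\<^bsub>G\<^esub> x"
      let ?f = "\<lambda>y. a y \<otimes>\<^bsub>R\<^esub> b (?h y)"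
      have hh: "?h (?h y) = y" if "y \<in> carrier G" for y
      proof -
        have "?h (?h y) = (y \<otimes>\<^bsub>G\<^esub> inv\<^bsub>G\<^esub> x) \<otimes>\<^bsub>G\<^esub> x"
          using that x by (simp add: G.inv_mult)
        also have "\<dots> = y" using that x by (subst G.m_assoc) auto
        finally show ?thesis .
      qed
      have inj: "inj_on ?h (carrier G)" by (rule inj_on_inverseI[where g = ?h]) (rule hh)
      have im: "?h ` carrier G = carrier G"
      proof
        show "?h ` carrier G \<subseteq> carrier G" using x by auto
        show "carrier G \<subseteq> ?h ` carrier G"
        proof
          fix y assume "y \<in> carrier G"
          then show "y \<in> ?h ` carrier G"
            using hh[of y] x by (intro image_eqI[of _ _ "?h y"]) auto
        qed
      qed
      have [simp]: "a g \<in> carrier R" "b g \<in> carrier R" if "g \<in> carrier G" for g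
        using ab that by (auto simp: d PiE_iff)
      have "(\<Oplus>\<^bsub>R\<^esub>y\<in>?h ` carrier G. ?f y) = (\<Oplus>\<^bsub>R\<^esub>y\<in>carrier G. ?f (?h y))"
        unfolding im using x inj R.add.finprod_reindex[of ?f ?h "carrier G", unfolded im] by simp
      then have "(\<Oplus>\<^bsub>R\<^esub>y\<in>carrier G. ?f y) = (\<Oplus>\<^bsub>R\<^esub>y\<in>carrier G. ?f (?h y))"
        unfolding im .
      also have "\<dots> = (\<Oplus>\<^bsub>R\<^esub>y\<in>carrier G. b y \<otimes>\<^bsub>R\<^esub> a (?h y))"
      proof (intro R.finsum_cong' refl)
        fix y assume y: "y \<in> carrier G"
        then show "?f (?h y) = b y \<otimes>\<^bsub>R\<^esub> a (?h y)"
          unfolding hh[OF y] using x by (intro R.m_comm) auto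
      qed (use x in auto)
      finally show ?thesis .
    qed
    then show ?thesis by (auto simp: d fun_eq_iff)
  qed
  show ?thesis
  proof (rule cringI)
    show "abelian_group ?S"
      by (rule coefficient_abelian_group[OF assms(1), where A = "carrier G"]) (auto simp: d)
    show "comm_monoid ?S"
    proof (rule comm_monoidI)
      show one: "\<one>\<^bsub>?S\<^esub> \<in> carrier ?S" by (auto simp: d)
      show "\<one>\<^bsub>?S\<^esub> \<otimes>\<^bsub>?S\<^esub> a = a" if a: "a \<in> carrier ?S" for a
      proof -
        have "(\<Oplus>\<^bsub>R\<^esub>y\<in>carrier G. \<one>\<^bsub>?S\<^esub> y \<otimes>\<^bsub>R\<^esub> a (inv\<^bsub>G\<^esub> y \<otimes>\<^bsub>G\<^esub> x)) = a x" if x: "x \<in> carrier G" for x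
        proof -
          have "(\<Oplus>\<^bsub>R\<^esub>y\<in>carrier G. \<one>\<^bsub>?S\<^esub> y \<otimes>\<^bsub>R\<^esub> a (inv\<^bsub>G\<^esub> y \<otimes>\<^bsub>G\<^esub> x))
            = (\<Oplus>\<^bsub>R\<^esub>y\<in>carrier G. (if y = \<one>\<^bsub>G\<^esub> then \<one>\<^bsub>R\<^esub> else \<zero>\<^bsub>R\<^esub>) \<otimes>\<^bsub>R\<^esub> a (inv\<^bsub>G\<^esub> y \<otimes>\<^bsub>G\<^esub> x))"
            using a x by (intro R.finsum_cong') (auto simp: d PiE_iff)
          also have "\<dots> = a (inv\<^bsub>G\<^esub> \<one>\<^bsub>G\<^esub> \<otimes>\<^bsub>G\<^esub> x)"
            using a x assms by (intro finsum_group_delta) (auto simp: d PiE_iff)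
          finally show ?thesis using x by simp
        qed
        then show ?thesis using a by (auto simp: d fun_eq_iff PiE_iff extensional_def)
      qed
      show "(a \<otimes>\<^bsub>?S\<^esub> b) \<otimes>\<^bsub>?S\<^esub> c = a \<otimes>\<^bsub>?S\<^esub> (b \<otimes>\<^bsub>?S\<^esub> c)"
        if a: "a \<in> carrier ?S" "b \<in> carrier ?S" "c \<in> carrier ?S" for a b c
      proof -
        have "(\<Oplus>\<^bsub>R\<^esub>x\<in>carrier G. (a \<otimes>\<^bsub>?S\<^esub> b) x \<otimes>\<^bsub>R\<^esub> c (inv\<^bsub>G\<^esub> x \<otimes>\<^bsub>G\<^esub> u))
          = (\<Oplus>\<^bsub>R\<^esub>y\<in>carrier G. a y \<otimes>\<^bsub>R\<^esub> (b \<otimes>\<^bsub>?S\<^esub> c) (inv\<^bsub>G\<^esub> y \<otimes>\<^bsub>G\<^esub> u))"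
          if u: "u \<in> carrier G" for u
        proof -
          have "(\<Oplus>\<^bsub>R\<^esub>x\<in>carrier G. (a \<otimes>\<^bsub>?S\<^esub> b) x \<otimes>\<^bsub>R\<^esub> c (inv\<^bsub>G\<^esub> x \<otimes>\<^bsub>G\<^esub> u))
             = (\<Oplus>\<^bsub>R\<^esub>x\<in>carrier G. (\<Oplus>\<^bsub>R\<^esub>y\<in>carrier G. a y \<otimes>\<^bsub>R\<^esub> b (inv\<^bsub>G\<^esub> y \<otimes>\<^bsub>G\<^esub> x)) \<otimes>\<^bsub>R\<^esub> c (inv\<^bsub>G\<^esub> x \<otimes>\<^bsub>G\<^esub> u))"
            using a u by (intro R.finsum_cong') (auto simp: d PiE_iff intro!: R.finsum_closed R.m_closed)
          also have "\<dots> = (\<Oplus>\<^bsub>R\<^esub>y\<in>carrier G. a y \<otimes>\<^bsub>R\<^esub>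
             (\<Oplus>\<^bsub>R\<^esub>x\<in>carrier G. b x \<otimes>\<^bsub>R\<^esub> c (inv\<^bsub>G\<^esub> (y \<otimes>\<^bsub>G\<^esub> x) \<otimes>\<^bsub>G\<^esub> u)))"
            using a u assms
            by (intro group_ring_smult_assoc[where F = "\<lambda>x. c (inv\<^bsub>G\<^esub> x \<otimes>\<^bsub>G\<^esub> u)"])
               (auto simp: d PiE_iff G.is_group)
          also have "\<dots> = (\<Oplus>\<^bsub>R\<^esub>y\<in>carrier G. a y \<otimes>\<^bsub>R\<^esub> (b \<otimes>\<^bsub>?S\<^esub> c) (inv\<^bsub>G\<^esub> y \<otimes>\<^bsub>G\<^esub> u))"
            using a u by (intro R.finsum_cong' refl)
              (auto simp: d PiE_iff G.inv_mult_group G.m_assoc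
                intro!: R.finsum_closed R.m_closed arg_cong2[where f = "monoid.mult R"] R.finsum_cong')
          finally show ?thesis .
        qed
        then show ?thesis by (auto simp: d fun_eq_iff)
      qed
    qed (use cl comm in auto)
    show "(a \<oplus>\<^bsub>?S\<^esub> b) \<otimes>\<^bsub>?S\<^esub> c = a \<otimes>\<^bsub>?S\<^esub> c \<oplus>\<^bsub>?S\<^esub> b \<otimes>\<^bsub>?S\<^esub> c"
      if a: "a \<in> carrier ?S" "b \<in> carrier ?S" "c \<in> carrier ?S" for a b c
    proof -
      have "(\<Oplus>\<^bsub>R\<^esub>y\<in>carrier G. (a \<oplus>\<^bsub>?S\<^esub> b) y \<otimes>\<^bsub>R\<^esub> c (inv\<^bsub>G\<^esub> y \<otimes>\<^bsub>G\<^esub> x))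
         = (\<Oplus>\<^bsub>R\<^esub>y\<in>carrier G. a y \<otimes>\<^bsub>R\<^esub> c (inv\<^bsub>G\<^esub> y \<otimes>\<^bsub>G\<^esub> x)) \<oplus>\<^bsub>R\<^esub>
           (\<Oplus>\<^bsub>R\<^esub>y\<in>carrier G. b y \<otimes>\<^bsub>R\<^esub> c (inv\<^bsub>G\<^esub> y \<otimes>\<^bsub>G\<^esub> x))" if x: "x \<in> carrier G" for x
      proof -
        have "(\<Oplus>\<^bsub>R\<^esub>y\<in>carrier G. (a \<oplus>\<^bsub>?S\<^esub> b) y \<otimes>\<^bsub>R\<^esub> c (inv\<^bsub>G\<^esub> y \<otimes>\<^bsub>G\<^esub> x))
          = (\<Oplus>\<^bsub>R\<^esub>y\<in>carrier G. a y \<otimes>\<^bsub>R\<^esub> c (inv\<^bsub>G\<^esub> y \<otimes>\<^bsub>G\<^esub> x) \<oplus>\<^bsub>R\<^esub> b y \<otimes>\<^bsub>R\<^esub> c (inv\<^bsub>G\<^esub> y \<otimes>\<^bsub>G\<^esub> x))"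
          using a x by (intro R.finsum_cong') (auto simp: d PiE_iff R.l_distr)
        also have "\<dots> = (\<Oplus>\<^bsub>R\<^esub>y\<in>carrier G. a y \<otimes>\<^bsub>R\<^esub> c (inv\<^bsub>G\<^esub> y \<otimes>\<^bsub>G\<^esub> x)) \<oplus>\<^bsub>R\<^esub>
           (\<Oplus>\<^bsub>R\<^esub>y\<in>carrier G. b y \<otimes>\<^bsub>R\<^esub> c (inv\<^bsub>G\<^esub> y \<otimes>\<^bsub>G\<^esub> x))"
          using a x by (intro R.finsum_addf) (auto simp: d PiE_iff)
        finally show ?thesis .
      qed
      then show ?thesis by (auto simp: d fun_eq_iff)
    qed
  qed
qed

lemma permutation_module_module:
  assumes "cring R" "comm_group G" "finite (carrier G)" "group_action G E \<phi>"
  shows "module (group_ring R G) (permutation_module R G E \<phi>)"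
proof -
  interpret G: comm_group G by fact
  interpret R: cring R by fact
  interpret A: group_action G E \<phi> by fact
  note d = group_ring_def permutation_module_def
  have act [simp]: "\<phi> g w \<in> E" if "g \<in> carrier G" "w \<in> E" for g w
    using A.element_image that by blast
  have one: "\<phi> \<one>\<^bsub>G\<^esub> w = w" if "w \<in> E" for w
    using that by (simp flip: A.id_eq_one)
  let ?S = "group_ring R G" and ?P = "permutation_module R G E \<phi>"
  show ?thesis
  proof (rule moduleI)
    show "cring ?S" by (rule group_ring_cring[OF assms(1-3)])
    show "abelian_group ?P"
      by (rule coefficient_abelian_group[OF assms(1), where A = E]) (auto simp: d)
    show "a \<odot>\<^bsub>?P\<^esub> f \<in> carrier ?P" if "a \<in> carrier ?S" "f \<in> carrier ?P" for a f
      using that by (auto simp: d PiE_iff intro!: R.finsum_closed)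
    show "(a \<oplus>\<^bsub>?S\<^esub> b) \<odot>\<^bsub>?P\<^esub> f = a \<odot>\<^bsub>?P\<^esub> f \<oplus>\<^bsub>?P\<^esub> b \<odot>\<^bsub>?P\<^esub> f"
      if "a \<in> carrier ?S" "b \<in> carrier ?S" "f \<in> carrier ?P" for a b f
    proof -
      have "(\<Oplus>\<^bsub>R\<^esub>g\<in>carrier G. (a \<oplus>\<^bsub>?S\<^esub> b) g \<otimes>\<^bsub>R\<^esub> f (\<phi> (inv\<^bsub>G\<^esub> g) w))
        = (\<Oplus>\<^bsub>R\<^esub>g\<in>carrier G. a g \<otimes>\<^bsub>R\<^esub> f (\<phi> (inv\<^bsub>G\<^esub> g) w)) \<oplus>\<^bsub>R\<^esub>
          (\<Oplus>\<^bsub>R\<^esub>g\<in>carrier G. b g \<otimes>\<^bsub>R\<^esub> f (\<phi> (inv\<^bsub>G\<^esub> g) w))" if w: "w \<in> E" for w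
      proof -
        have "(\<Oplus>\<^bsub>R\<^esub>g\<in>carrier G. (a \<oplus>\<^bsub>?S\<^esub> b) g \<otimes>\<^bsub>R\<^esub> f (\<phi> (inv\<^bsub>G\<^esub> g) w))
          = (\<Oplus>\<^bsub>R\<^esub>g\<in>carrier G. a g \<otimes>\<^bsub>R\<^esub> f (\<phi> (inv\<^bsub>G\<^esub> g) w) \<oplus>\<^bsub>R\<^esub> b g \<otimes>\<^bsub>R\<^esub> f (\<phi> (inv\<^bsub>G\<^esub> g) w))"
          using that \<open>a \<in> _\<close> \<open>b \<in> _\<close> \<open>f \<in> _\<close>
          by (intro R.finsum_cong') (auto simp: d PiE_iff R.l_distr)
        also have "\<dots> = (\<Oplus>\<^bsub>R\<^esub>g\<in>carrier G. a g \<otimes>\<^bsub>R\<^esub> f (\<phi> (inv\<^bsub>G\<^esub> g) w)) \<oplus>\<^bsub>R\<^esub>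
          (\<Oplus>\<^bsub>R\<^esub>g\<in>carrier G. b g \<otimes>\<^bsub>R\<^esub> f (\<phi> (inv\<^bsub>G\<^esub> g) w))"
          using that \<open>a \<in> _\<close> \<open>b \<in> _\<close> \<open>f \<in> _\<close>
          by (intro R.finsum_addf) (auto simp: d PiE_iff)
        finally show ?thesis .
      qed
      then show ?thesis by (auto simp: d fun_eq_iff)
    qed
    show "a \<odot>\<^bsub>?P\<^esub> (f \<oplus>\<^bsub>?P\<^esub> h) = a \<odot>\<^bsub>?P\<^esub> f \<oplus>\<^bsub>?P\<^esub> a \<odot>\<^bsub>?P\<^esub> h"
      if "a \<in> carrier ?S" "f \<in> carrier ?P" "h \<in> carrier ?P" for a f h
    proof -
      have "(\<Oplus>\<^bsub>R\<^esub>g\<in>carrier G. a g \<otimes>\<^bsub>R\<^esub> (f \<oplus>\<^bsub>?P\<^esub> h) (\<phi> (inv\<^bsub>G\<^esub> g) w))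
        = (\<Oplus>\<^bsub>R\<^esub>g\<in>carrier G. a g \<otimes>\<^bsub>R\<^esub> f (\<phi> (inv\<^bsub>G\<^esub> g) w)) \<oplus>\<^bsub>R\<^esub>
          (\<Oplus>\<^bsub>R\<^esub>g\<in>carrier G. a g \<otimes>\<^bsub>R\<^esub> h (\<phi> (inv\<^bsub>G\<^esub> g) w))" if w: "w \<in> E" for w
      proof -
        have "(\<Oplus>\<^bsub>R\<^esub>g\<in>carrier G. a g \<otimes>\<^bsub>R\<^esub> (f \<oplus>\<^bsub>?P\<^esub> h) (\<phi> (inv\<^bsub>G\<^esub> g) w))
          = (\<Oplus>\<^bsub>R\<^esub>g\<in>carrier G. a g \<otimes>\<^bsub>R\<^esub> f (\<phi> (inv\<^bsub>G\<^esub> g) w) \<oplus>\<^bsub>R\<^esub> a g \<otimes>\<^bsub>R\<^esub> h (\<phi> (inv\<^bsub>G\<^esub> g) w))"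
          using that \<open>a \<in> _\<close> \<open>h \<in> _\<close> \<open>f \<in> _\<close>
          by (intro R.finsum_cong') (auto simp: d PiE_iff R.r_distr)
        also have "\<dots> = (\<Oplus>\<^bsub>R\<^esub>g\<in>carrier G. a g \<otimes>\<^bsub>R\<^esub> f (\<phi> (inv\<^bsub>G\<^esub> g) w)) \<oplus>\<^bsub>R\<^esub>
          (\<Oplus>\<^bsub>R\<^esub>g\<in>carrier G. a g \<otimes>\<^bsub>R\<^esub> h (\<phi> (inv\<^bsub>G\<^esub> g) w))"
          using that \<open>a \<in> _\<close> \<open>h \<in> _\<close> \<open>f \<in> _\<close>
          by (intro R.finsum_addf) (auto simp: d PiE_iff)
        finally show ?thesis .
      qed
      then show ?thesis by (auto simp: d fun_eq_iff)
    qed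
    show "(a \<otimes>\<^bsub>?S\<^esub> b) \<odot>\<^bsub>?P\<^esub> f = a \<odot>\<^bsub>?P\<^esub> (b \<odot>\<^bsub>?P\<^esub> f)"
      if a: "a \<in> carrier ?S" "b \<in> carrier ?S" "f \<in> carrier ?P" for a b f
    proof -
      have "(\<Oplus>\<^bsub>R\<^esub>x\<in>carrier G. (a \<otimes>\<^bsub>?S\<^esub> b) x \<otimes>\<^bsub>R\<^esub> f (\<phi> (inv\<^bsub>G\<^esub> x) w))
        = (\<Oplus>\<^bsub>R\<^esub>y\<in>carrier G. a y \<otimes>\<^bsub>R\<^esub> (b \<odot>\<^bsub>?P\<^esub> f) (\<phi> (inv\<^bsub>G\<^esub> y) w))" if w: "w \<in> E" for w
      proof -
        have "(\<Oplus>\<^bsub>R\<^esub>x\<in>carrier G. (a \<otimes>\<^bsub>?S\<^esub> b) x \<otimes>\<^bsub>R\<^esub> f (\<phi> (inv\<^bsub>G\<^esub> x) w))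
          = (\<Oplus>\<^bsub>R\<^esub>x\<in>carrier G. (\<Oplus>\<^bsub>R\<^esub>y\<in>carrier G. a y \<otimes>\<^bsub>R\<^esub> b (inv\<^bsub>G\<^esub> y \<otimes>\<^bsub>G\<^esub> x)) \<otimes>\<^bsub>R\<^esub> f (\<phi> (inv\<^bsub>G\<^esub> x) w))"
          using a w by (intro R.finsum_cong') (auto simp: d PiE_iff intro!: R.finsum_closed R.m_closed)
        also have "\<dots> = (\<Oplus>\<^bsub>R\<^esub>y\<in>carrier G. a y \<otimes>\<^bsub>R\<^esub>
            (\<Oplus>\<^bsub>R\<^esub>x\<in>carrier G. b x \<otimes>\<^bsub>R\<^esub> f (\<phi> (inv\<^bsub>G\<^esub> (y \<otimes>\<^bsub>G\<^esub> x)) w)))"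
          using a w assms
          by (intro group_ring_smult_assoc[where F = "\<lambda>x. f (\<phi> (inv\<^bsub>G\<^esub> x) w)"])
             (auto simp: d PiE_iff G.is_group)
        also have "\<dots> = (\<Oplus>\<^bsub>R\<^esub>y\<in>carrier G. a y \<otimes>\<^bsub>R\<^esub> (b \<odot>\<^bsub>?P\<^esub> f) (\<phi> (inv\<^bsub>G\<^esub> y) w))"
          using a w by (intro R.finsum_cong' refl)
            (auto simp: d PiE_iff G.inv_mult_group A.composition_rule simp del: G.inv_mult
              intro!: R.finsum_closed R.m_closed arg_cong2[where f = "monoid.mult R"] R.finsum_cong')
        finally show ?thesis .
      qed
      then show ?thesis by (auto simp: d fun_eq_iff)
    qed
    show "\<one>\<^bsub>?S\<^esub> \<odot>\<^bsub>?P\<^esub> f = f" if f: "f \<in> carrier ?P" for f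
    proof -
      have "(\<Oplus>\<^bsub>R\<^esub>g\<in>carrier G. \<one>\<^bsub>?S\<^esub> g \<otimes>\<^bsub>R\<^esub> f (\<phi> (inv\<^bsub>G\<^esub> g) w)) = f w" if w: "w \<in> E" for w
      proof -
        have "(\<Oplus>\<^bsub>R\<^esub>g\<in>carrier G. \<one>\<^bsub>?S\<^esub> g \<otimes>\<^bsub>R\<^esub> f (\<phi> (inv\<^bsub>G\<^esub> g) w))
          = (\<Oplus>\<^bsub>R\<^esub>g\<in>carrier G. (if g = \<one>\<^bsub>G\<^esub> then \<one>\<^bsub>R\<^esub> else \<zero>\<^bsub>R\<^esub>) \<otimes>\<^bsub>R\<^esub> f (\<phi> (inv\<^bsub>G\<^esub> g) w))"
          using f w by (intro R.finsum_cong') (auto simp: d PiE_iff)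
        also have "\<dots> = f (\<phi> (inv\<^bsub>G\<^esub> \<one>\<^bsub>G\<^esub>) w)"
          using f w assms by (intro finsum_group_delta) (auto simp: d PiE_iff)
        finally show ?thesis using w by (simp add: one)
      qed
      then show ?thesis using f by (auto simp: d fun_eq_iff PiE_iff extensional_def)
    qed
  qed
qed

lemma permutation_module_basis_action:
  assumes "cring R" "group G" "finite (carrier G)" "group_action G E \<phi>"
    and g: "g \<in> carrier G" and v: "v \<in> E"
  shows "group_ring_elem R G g \<odot>\<^bsub>permutation_module R G E \<phi>\<^esub> permutation_basis R E v
       = permutation_basis R E (\<phi> g v)"
proof -
  interpret G: group G by fact
  interpret R: cring R by fact
  interpret A: group_action G E \<phi> by fact
  have act [simp]: "\<phi> g w \<in> E" if "g \<in> carrier G" "w \<in> E" for g w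
    using A.element_image that by blast
  let ?b = "permutation_basis R E v"
  have "(\<Oplus>\<^bsub>R\<^esub>h\<in>carrier G. group_ring_elem R G g h \<otimes>\<^bsub>R\<^esub> ?b (\<phi> (inv\<^bsub>G\<^esub> h) w))
      = (if w = \<phi> g v then \<one>\<^bsub>R\<^esub> else \<zero>\<^bsub>R\<^esub>)" if w: "w \<in> E" for w
  proof -
    have "(\<Oplus>\<^bsub>R\<^esub>h\<in>carrier G. group_ring_elem R G g h \<otimes>\<^bsub>R\<^esub> ?b (\<phi> (inv\<^bsub>G\<^esub> h) w))
      = (\<Oplus>\<^bsub>R\<^esub>h\<in>carrier G. (if h = g then \<one>\<^bsub>R\<^esub> else \<zero>\<^bsub>R\<^esub>) \<otimes>\<^bsub>R\<^esub> ?b (\<phi> (inv\<^bsub>G\<^esub> h) w))"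
      using w by (intro R.finsum_cong') (auto simp: group_ring_elem_def permutation_basis_def)
    also have "\<dots> = ?b (\<phi> (inv\<^bsub>G\<^esub> g) w)"
      using w assms by (intro finsum_group_delta) (auto simp: permutation_basis_def)
    also have "\<phi> (inv\<^bsub>G\<^esub> g) w = v \<longleftrightarrow> w = \<phi> g v"
      using A.orbit_sym_aux[OF g] A.orbit_sym_aux[OF G.inv_closed[OF g]] w v g
      by (metis G.inv_inv)
    then have "?b (\<phi> (inv\<^bsub>G\<^esub> g) w) = (if w = \<phi> g v then \<one>\<^bsub>R\<^esub> else \<zero>\<^bsub>R\<^esub>)"
      using w g by (simp add: permutation_basis_def)
    finally show ?thesis .
  qed
  then show ?thesis by (auto simp: permutation_module_def permutation_basis_def fun_eq_iff)
qed

lemma group_ring_scalar_simps: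
  assumes "cring R" "group G" "finite (carrier G)" "r \<in> carrier R" "s \<in> carrier R"
  shows "group_ring_scalar R G r \<in> carrier (group_ring R G)"
    and "group_ring_scalar R G (r \<oplus>\<^bsub>R\<^esub> s)
         = group_ring_scalar R G r \<oplus>\<^bsub>group_ring R G\<^esub> group_ring_scalar R G s"
    and "group_ring_scalar R G (r \<otimes>\<^bsub>R\<^esub> s)
         = group_ring_scalar R G r \<otimes>\<^bsub>group_ring R G\<^esub> group_ring_scalar R G s"
    and "group_ring_scalar R G \<one>\<^bsub>R\<^esub> = \<one>\<^bsub>group_ring R G\<^esub>"
proof -
  interpret G: group G by fact
  interpret R: cring R by fact
  show "group_ring_scalar R G r \<in> carrier (group_ring R G)"
    using assms by (auto simp: group_ring_scalar_def group_ring_def)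
  show "group_ring_scalar R G (r \<oplus>\<^bsub>R\<^esub> s)
         = group_ring_scalar R G r \<oplus>\<^bsub>group_ring R G\<^esub> group_ring_scalar R G s"
    using assms by (auto simp: group_ring_scalar_def group_ring_def fun_eq_iff)
  show "group_ring_scalar R G \<one>\<^bsub>R\<^esub> = \<one>\<^bsub>group_ring R G\<^esub>"
    by (auto simp: group_ring_scalar_def group_ring_def)
  have "(\<Oplus>\<^bsub>R\<^esub>y\<in>carrier G. group_ring_scalar R G r y \<otimes>\<^bsub>R\<^esub> group_ring_scalar R G s (inv\<^bsub>G\<^esub> y \<otimes>\<^bsub>G\<^esub> x))
      = group_ring_scalar R G (r \<otimes>\<^bsub>R\<^esub> s) x" if x: "x \<in> carrier G" for x
  proof -
    have "(\<Oplus>\<^bsub>R\<^esub>y\<in>carrier G. group_ring_scalar R G r y \<otimes>\<^bsub>R\<^esub> group_ring_scalar R G s (inv\<^bsub>G\<^esub> y \<otimes>\<^bsub>G\<^esub> x))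
       = (\<Oplus>\<^bsub>R\<^esub>y\<in>carrier G. if \<one>\<^bsub>G\<^esub> = y then group_ring_scalar R G (r \<otimes>\<^bsub>R\<^esub> s) x else \<zero>\<^bsub>R\<^esub>)"
      using assms x by (intro R.finsum_cong') (auto simp: group_ring_scalar_def)
    also have "\<dots> = group_ring_scalar R G (r \<otimes>\<^bsub>R\<^esub> s) x"
      using assms x by (intro R.finsum_singleton) (auto simp: group_ring_scalar_def)
    finally show ?thesis .
  qed
  then show "group_ring_scalar R G (r \<otimes>\<^bsub>R\<^esub> s)
         = group_ring_scalar R G r \<otimes>\<^bsub>group_ring R G\<^esub> group_ring_scalar R G s"
    by (auto simp: group_ring_def fun_eq_iff group_ring_scalar_def)
qed

lemma restrict_scalars_module:
  assumes "cring R" "group G" "finite (carrier G)" "module (group_ring R G) M"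
  shows "module R (restrict_scalars R G M)"
proof -
  interpret M: module "group_ring R G" M by fact
  note s = group_ring_scalar_simps[OF assms(1-3)]
  have abel: "abelian_group (restrict_scalars R G M)"
    by (rule abelian_group_same_add[OF M.abelian_group_axioms]) (simp_all add: restrict_scalars_def)
  have one: "\<one>\<^bsub>R\<^esub> \<in> carrier R"
    by (rule monoid.one_closed[OF comm_monoid.axioms(1)[OF cring.axioms(2)[OF assms(1)]]])
  have sc: "group_ring_scalar R G r \<in> carrier (group_ring R G)" if "r \<in> carrier R" for r
    by (rule s(1)[OF that that])
  show ?thesis
  proof (rule moduleI[OF assms(1) abel], unfold restrict_scalars_def module.simps ring.simps partial_object.simps)
    fix a b x y
    assume x: "x \<in> carrier M"
    show "group_ring_scalar R G \<one>\<^bsub>R\<^esub> \<odot>\<^bsub>M\<^esub> x = x"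
      unfolding s(4)[OF one one] using x by (rule M.smult_one)
    assume a: "a \<in> carrier R"
    show "group_ring_scalar R G a \<odot>\<^bsub>M\<^esub> x \<in> carrier M"
      using sc[OF a] x by (rule M.smult_closed)
    { assume y: "y \<in> carrier M"
      show "group_ring_scalar R G a \<odot>\<^bsub>M\<^esub> (x \<oplus>\<^bsub>M\<^esub> y)
        = group_ring_scalar R G a \<odot>\<^bsub>M\<^esub> x \<oplus>\<^bsub>M\<^esub> group_ring_scalar R G a \<odot>\<^bsub>M\<^esub> y"
        using sc[OF a] x y by (rule M.smult_r_distr) }
    assume b: "b \<in> carrier R"
    show "group_ring_scalar R G (a \<oplus>\<^bsub>R\<^esub> b) \<odot>\<^bsub>M\<^esub> x
      = group_ring_scalar R G a \<odot>\<^bsub>M\<^esub> x \<oplus>\<^bsub>M\<^esub> group_ring_scalar R G b \<odot>\<^bsub>M\<^esub> x"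
      unfolding s(2)[OF a b] using sc[OF a] sc[OF b] x by (rule M.smult_l_distr)
    show "group_ring_scalar R G (a \<otimes>\<^bsub>R\<^esub> b) \<odot>\<^bsub>M\<^esub> x
      = group_ring_scalar R G a \<odot>\<^bsub>M\<^esub> (group_ring_scalar R G b \<odot>\<^bsub>M\<^esub> x)"
      unfolding s(3)[OF a b] using sc[OF a] sc[OF b] x by (rule M.smult_assoc1)
  qed
qed

end

theory Submission
  imports Defs "HOL-Computational_Algebra.Polynomial" "HOL-Library.Nat_Bijection"
    "HOL-Algebra.Multiplicative_Group"
begin

text \<open>
  Let \<open>g\<close> generate \<open>G\<close>, let \<open>p ^ n\<close> be its order and put \<open>x = g - 1\<close>. Every statement about
  \<open>R[G]\<close>-modules is reduced to one about an \<open>R\<close>-module together with the endomorphism by which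
  \<open>g\<close> acts; the subgroups of \<open>G\<close> are generated by the powers \<open>g ^ (p ^ m)\<close> with \<open>m \<le> n\<close>.

  The map \<open>q\<close> is a coflasque resolution. For each \<open>m \<le> n\<close> choose finitely many generators over \<open>R\<close>
  of the vectors of \<open>M\<close> that are fixed by \<open>g ^ (p ^ m)\<close>, and let each of them be hit by a basis
  vector of a copy of \<open>R[G/H]\<close>, where \<open>H\<close> is generated by \<open>g ^ (p ^ m)\<close>. The resulting map \<open>q\<close>
  from a permutation module \<open>P\<close> onto \<open>M\<close> is surjective on the fixed vectors of every subgroup. In a
  permutation module a vector that is fixed modulo \<open>p\<close> is congruent to a fixed vector
  (\<open>P_fixed_lift\<close>), and surjectivity on fixed vectors passes this property on to the kernel \<open>L\<close>
  of \<open>q\<close> (\<open>kernel_coflasque\<close>).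

  The heart of the proof is that a lattice \<open>L\<close> with this lifting property is a permutation module.
  Modulo \<open>p\<close> the element \<open>g ^ (p ^ m) - 1\<close> is \<open>x ^ (p ^ m)\<close>, so that the lifting property says that
  the kernel \<open>K\<^sub>m\<close> of \<open>x ^ (p ^ m)\<close> on \<open>L / pL\<close> is the image of the fixed vectors \<open>F\<^sub>m\<close> of
  \<open>g ^ (p ^ m)\<close>. The quotient \<open>F\<^sub>m\<^sub>+\<^sub>1 / F\<^sub>m\<close> is torsion-free and is annihilated by the cyclotomic
  polynomial of order \<open>p ^ (m + 1)\<close>, which in terms of \<open>x\<close> has the Eisenstein shape
  \<open>x ^ d + p (1 + x c)\<close>, where \<open>d = p ^ (m + 1) - p ^ m\<close> (\<open>cyclotomic_prime_power\<close>). Hence its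
  reduction \<open>K\<^sub>m\<^sub>+\<^sub>1 / K\<^sub>m\<close> is free over \<open>k[x] / x ^ d\<close>, where \<open>k = R / pR\<close>
  (\<open>cyclotomic_quotient\<close>). A Jordan block of \<open>x\<close> on \<open>L / pL\<close> of size greater than \<open>p ^ m\<close> therefore
  has size at least \<open>p ^ (m + 1)\<close>: all sizes are powers of \<open>p\<close>. A generator of a block of
  size \<open>p ^ m\<close> lies in \<open>K\<^sub>m\<close>, so it lifts to a vector fixed by \<open>g ^ (p ^ m)\<close>, and the orbits of these
  lifts form a basis of \<open>L\<close> modulo \<open>p\<close> that \<open>G\<close> permutes.

  Instead of quoting the Jordan normal form, one takes a basis of the kernel of \<open>x\<close> on \<open>L / pL\<close>
  that is adapted to the subspaces \<open>x ^ (p ^ m - 1) K\<^sub>m\<close> (\<open>socle_basis\<close>). The induced map from a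
  permutation module to \<open>L\<close> is surjective by Nakayama's lemma. It is injective modulo \<open>p\<close>, since a
  nonzero kernel would contain a nonzero vector annihilated by \<open>x\<close>, and such vectors are
  combinations of orbit sums, which map to combinations of the chosen basis
  (\<open>cycle_map_p_injective\<close>); Nakayama's lemma, applied to its kernel, then gives injectivity
  (\<open>cycle_map_bij\<close>).
\<close>

text \<open>From here on \<open>order\<close> denotes the order of a group, not that of a root of a polynomial.\<close>

hide_const (open) Polynomial.order

section \<open>Powers of 1 + x modulo p\<close>

lemma one_plus_power:
  fixes y :: "'a::comm_ring_1"
  shows "(1 + y) ^ k = 1 + y * (\<Sum>i<k. (1 + y) ^ i)"
  by (induction k) (auto simp: algebra_simps)

lemma geometric_sum_shifted:
  fixes y :: "'a::comm_ring_1"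
  shows "(\<Sum>i<k. (1 + y) ^ i) = (\<Sum>j<k. of_nat (k choose Suc j) * y ^ j)"
proof (induction k)
  case (Suc k)
  have shift: "1 + (\<Sum>j<k. of_nat (k choose Suc j) * y ^ Suc j)
      = (\<Sum>j<Suc k. of_nat (k choose j) * y ^ j)"
    by (simp only: sum.lessThan_Suc_shift) simp
  have last: "(\<Sum>j<Suc k. of_nat (k choose Suc j) * y ^ j) = (\<Sum>j<k. of_nat (k choose Suc j) * y ^ j)"
    by (simp add: binomial_eq_0)
  have "(\<Sum>i<Suc k. (1 + y) ^ i) = 1 + (1 + y) * (\<Sum>i<k. (1 + y) ^ i)"
    using one_plus_power[of y k] by (simp add: algebra_simps)
  also have "\<dots> = 1 + (\<Sum>j<k. of_nat (k choose Suc j) * y ^ j)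
      + (\<Sum>j<k. of_nat (k choose Suc j) * y ^ Suc j)"
    unfolding Suc.IH by (simp add: algebra_simps sum_distrib_left sum.distrib)
  also have "1 + (\<Sum>j<k. of_nat (k choose Suc j) * y ^ j) + (\<Sum>j<k. of_nat (k choose Suc j) * y ^ Suc j)
      = (\<Sum>j<Suc k. of_nat (k choose Suc j) * y ^ j) + (\<Sum>j<Suc k. of_nat (k choose j) * y ^ j)"
    unfolding last shift[symmetric] by (simp only: ac_simps)
  also have "\<dots> = (\<Sum>j<Suc k. of_nat (Suc k choose Suc j) * y ^ j)"
    by (simp add: sum.distrib algebra_simps)
  finally show ?case .
qed simp

text \<open>The sum is \<open>((1 + y) ^ p - 1) / y\<close>. All its binomial coefficients but the leading one are
  divisible by \<open>p\<close>. Writing the part divisible by \<open>p\<close> as \<open>p (1 + y c)\<close> also records that the constant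
  coefficient is \<open>p\<close> itself; this is what makes \<open>x\<close> act injectively in \<open>cyclotomic_quotient\<close>.\<close>

lemma geometric_sum_prime:
  fixes y :: "'a::comm_ring_1"
  assumes p: "normalization_semidom_class.prime p"
  shows "\<exists>c. (\<Sum>i<p. (1 + y) ^ i) = y ^ (p - 1) + of_nat p * (1 + y * c)"
proof -
  have p2: "p \<ge> 2" using p by (rule prime_ge_2_nat)
  have split: "{..<p} = insert 0 (insert (p - 1) {1..<p - 1})" using p2 by auto
  have mid: "of_nat (p choose Suc j) * y ^ j
      = of_nat p * (y * (of_nat ((p choose Suc j) div p) * y ^ (j - 1)))" if "j \<in> {1..<p - 1}" for j
  proof -
    have "p dvd (p choose Suc j)" using that p by (intro dvd_choose_prime) auto
    then have "of_nat (p choose Suc j) = (of_nat p * of_nat ((p choose Suc j) div p) :: 'a)"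
      by (metis dvd_mult_div_cancel of_nat_mult)
    moreover have "y ^ j = y * y ^ (j - 1)" using that by (cases j) auto
    ultimately show ?thesis by (simp add: algebra_simps)
  qed
  have "(\<Sum>i<p. (1 + y) ^ i) = (\<Sum>j<p. of_nat (p choose Suc j) * y ^ j)"
    by (rule geometric_sum_shifted)
  also have "\<dots> = of_nat p + (y ^ (p - 1) + (\<Sum>j\<in>{1..<p - 1}. of_nat (p choose Suc j) * y ^ j))"
    unfolding split using p2 by (subst sum.insert; simp)+
  also have "(\<Sum>j\<in>{1..<p - 1}. of_nat (p choose Suc j) * y ^ j)
      = of_nat p * (y * (\<Sum>j\<in>{1..<p - 1}. of_nat ((p choose Suc j) div p) * y ^ (j - 1)))"
    unfolding sum_distrib_left by (rule sum.cong[OF refl mid])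
  finally show ?thesis by (auto simp: distrib_left add_ac)
qed

lemma power_add_multiple:
  fixes a b :: "'a::comm_ring_1"
  shows "\<exists>c. (a + b) ^ k = a ^ k + b * c"
proof (induction k)
  case (Suc k)
  then obtain c where "(a + b) ^ k = a ^ k + b * c" by blast
  then have "(a + b) ^ Suc k = a ^ Suc k + b * (a * c + a ^ k + b * c)"
    by (simp add: algebra_simps)
  then show ?case by blast
qed (auto intro: exI[of _ 0])

text \<open>The congruence \<open>(1 + x) ^ (p ^ m) = 1 + x ^ (p ^ m)\<close> modulo \<open>p\<close>. The induction on \<open>m\<close> also
  yields a factor \<open>x\<close> in the error term, because the element \<open>y\<close> with \<open>(1 + x) ^ (p ^ m) = 1 + y\<close> is a
  multiple of \<open>x\<close>.\<close>

lemma prime_power_of_one_plus: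
  fixes x :: "'a::comm_ring_1"
  assumes p: "normalization_semidom_class.prime p"
  shows "\<exists>a. (1 + x) ^ (p ^ m) = 1 + x ^ (p ^ m) + of_nat p * (x * a)"
proof (induction m)
  case 0
  show ?case by (auto intro: exI[of _ 0])
next
  case (Suc m)
  then obtain a where a: "(1 + x) ^ (p ^ m) = 1 + x ^ (p ^ m) + of_nat p * (x * a)" by blast
  define y where "y = x ^ (p ^ m) + of_nat p * (x * a)"
  obtain c where c: "(\<Sum>i<p. (1 + y) ^ i) = y ^ (p - 1) + of_nat p * (1 + y * c)"
    using geometric_sum_prime[OF p] by blast
  obtain d where d: "y ^ p = (x ^ (p ^ m)) ^ p + of_nat p * (x * a) * d"
    unfolding y_def using power_add_multiple by blast
  have yp: "y * y ^ (p - 1) = y ^ p"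
    using prime_gt_0_nat[OF p] by (simp flip: power_Suc)
  have "x * x ^ (p ^ m - 1) = x ^ (p ^ m)"
    using prime_gt_0_nat[OF p] by (subst power_Suc[symmetric]) simp
  then have y: "y = x * (x ^ (p ^ m - 1) + of_nat p * a)"
    unfolding y_def by (simp add: algebra_simps)
  have y1: "y * (1 + y * c) = x * (x ^ (p ^ m - 1) + of_nat p * a) * (1 + y * c)"
    by (rule arg_cong[OF y])
  have "(1 + x) ^ (p ^ Suc m) = ((1 + x) ^ (p ^ m)) ^ p"
    by (simp add: power_mult[symmetric] mult.commute)
  also have "\<dots> = (1 + y) ^ p"
    unfolding a y_def by (simp add: add.assoc)
  also have "\<dots> = 1 + y * y ^ (p - 1) + of_nat p * (y * (1 + y * c))"
    by (subst one_plus_power, subst c) (simp only: algebra_simps)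
  also have "\<dots> = 1 + y ^ p + of_nat p * (y * (1 + y * c))"
    unfolding yp ..
  also have "\<dots> = 1 + x ^ (p ^ Suc m) + of_nat p * (x * (a * d + (x ^ (p ^ m - 1) + of_nat p * a) * (1 + y * c)))"
    unfolding d y1 by (simp add: algebra_simps flip: power_mult)
  finally show ?case by blast
qed

text \<open>The left-hand side is the cyclotomic polynomial of order \<open>p ^ (m + 1)\<close> at \<open>1 + x\<close>.\<close>

lemma cyclotomic_prime_power:
  fixes x :: "'a::comm_ring_1"
  assumes p: "normalization_semidom_class.prime p"
  shows "\<exists>c. (\<Sum>i<p. ((1 + x) ^ (p ^ m)) ^ i) = x ^ (p ^ Suc m - p ^ m) + of_nat p * (1 + x * c)"
proof -
  obtain a where a: "(1 + x) ^ (p ^ m) = 1 + x ^ (p ^ m) + of_nat p * (x * a)"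
    using prime_power_of_one_plus[OF p] by blast
  define y where "y = x ^ (p ^ m) + of_nat p * (x * a)"
  obtain c where c: "(\<Sum>i<p. (1 + y) ^ i) = y ^ (p - 1) + of_nat p * (1 + y * c)"
    using geometric_sum_prime[OF p] by blast
  obtain d where d: "y ^ (p - 1) = (x ^ (p ^ m)) ^ (p - 1) + of_nat p * (x * a) * d"
    unfolding y_def using power_add_multiple by blast
  have "x * x ^ (p ^ m - 1) = x ^ (p ^ m)"
    using prime_gt_0_nat[OF p] by (subst power_Suc[symmetric]) simp
  then have y: "y = x * (x ^ (p ^ m - 1) + of_nat p * a)"
    unfolding y_def by (simp add: algebra_simps)
  have e: "p ^ m * (p - 1) = p ^ Suc m - p ^ m" by (simp add: algebra_simps)
  have "(\<Sum>i<p. ((1 + x) ^ (p ^ m)) ^ i) = (\<Sum>i<p. (1 + y) ^ i)"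
    unfolding a y_def by (simp add: add.assoc)
  also have "\<dots> = x ^ (p ^ Suc m - p ^ m)
      + of_nat p * (1 + x * (a * d + (x ^ (p ^ m - 1) + of_nat p * a) * c))"
    unfolding c d e[symmetric] power_mult by (subst y) (simp add: algebra_simps)
  finally show ?thesis by blast
qed

text \<open>Modulo \<open>p\<close> the norm element of a cyclic group of order \<open>p ^ m\<close> is the highest nonzero power of
  \<open>x = g - 1\<close>. The proof cancels a factor \<open>x\<close>, hence the polynomial ring.\<close>

lemma norm_prime_power:
  assumes p: "normalization_semidom_class.prime p"
  shows "\<exists>d :: int poly. (\<Sum>i<p ^ m. (1 + [:0, 1:]) ^ i) = [:0, 1:] ^ (p ^ m - 1) + of_nat p * d"
proof -
  let ?X = "[:0, 1:] :: int poly"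
  obtain a where a: "(1 + ?X) ^ (p ^ m) = 1 + ?X ^ (p ^ m) + of_nat p * (?X * a)"
    using prime_power_of_one_plus[OF p] by blast
  have "?X * ?X ^ (p ^ m - 1) = ?X ^ (p ^ m)"
    using prime_gt_0_nat[OF p] by (subst power_Suc[symmetric]) simp
  then have "?X * (\<Sum>i<p ^ m. (1 + ?X) ^ i) = ?X * (?X ^ (p ^ m - 1) + of_nat p * a)"
    using one_plus_power[of ?X "p ^ m"] a by (simp only: distrib_left) (simp only: algebra_simps)
  then show ?thesis by (auto simp only: mult_cancel_left) auto
qed

section \<open>Finitely generated modules over a principal ideal domain\<close>

text \<open>The rules do not mention the carrier of \<open>M\<close>, so the span of a subset of a submodule is the same
  whether it is formed there or in the ambient module (\<open>module_span_carrier_update\<close>).\<close>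

inductive_set module_span ::
  "('r, 'a) ring_scheme \<Rightarrow> ('r, 'm, 'b) module_scheme \<Rightarrow> 'm set \<Rightarrow> 'm set"
  for R and M and A where
  zero: "\<zero>\<^bsub>M\<^esub> \<in> module_span R M A"
| base: "a \<in> A \<Longrightarrow> a \<in> module_span R M A"
| add: "u \<in> module_span R M A \<Longrightarrow> v \<in> module_span R M A \<Longrightarrow> u \<oplus>\<^bsub>M\<^esub> v \<in> module_span R M A"
| smult: "r \<in> carrier R \<Longrightarrow> u \<in> module_span R M A \<Longrightarrow> r \<odot>\<^bsub>M\<^esub> u \<in> module_span R M A"

lemma module_span_mono: "A \<subseteq> B \<Longrightarrow> module_span R M A \<subseteq> module_span R M B"
proof
  fix v assume "A \<subseteq> B" "v \<in> module_span R M A"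
  show "v \<in> module_span R M B"
    using \<open>v \<in> _\<close> by induction (use \<open>A \<subseteq> B\<close> in \<open>auto intro: module_span.intros\<close>)
qed

lemma module_span_carrier_update:
  "module_span R (M\<lparr>carrier := L\<rparr>) A = module_span R M A"
proof (intro equalityI subsetI)
  show "v \<in> module_span R M A" if "v \<in> module_span R (M\<lparr>carrier := L\<rparr>) A" for v
    using that by induction (auto intro: module_span.intros)
  show "v \<in> module_span R (M\<lparr>carrier := L\<rparr>) A" if "v \<in> module_span R M A" for v
    using that
  proof induction
    case zero show ?case using module_span.zero[of "M\<lparr>carrier := L\<rparr>"] by simp
  next
    case (base a) then show ?case by (rule module_span.base)
  next
    case (add u v) then show ?case using module_span.add[of u R "M\<lparr>carrier := L\<rparr>" A v] by simp
  next
    case (smult r u) then show ?case using module_span.smult[of r R u "M\<lparr>carrier := L\<rparr>" A] by simp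
  qed
qed

context abelian_group
begin

lemma uminus_zero [simp]: "\<ominus> \<zero> = \<zero>"
  using add.inv_one by (simp add: a_inv_def)

lemma add_diff_cancel_left1: "a \<in> carrier G \<Longrightarrow> b \<in> carrier G \<Longrightarrow> (a \<oplus> b) \<ominus> a = b"
  by (simp add: a_minus_def a_comm[of a b] a_assoc r_neg)

lemma add_diff_cancel_right1: "a \<in> carrier G \<Longrightarrow> b \<in> carrier G \<Longrightarrow> (a \<oplus> b) \<ominus> b = a"
  by (simp add: a_minus_def a_assoc r_neg)

lemma diff_add_cancel1: "a \<in> carrier G \<Longrightarrow> b \<in> carrier G \<Longrightarrow> (a \<ominus> b) \<oplus> b = a"
  by (simp add: a_minus_def a_assoc l_neg)

lemma add_diff_add_cancel_left:
  assumes "x \<in> carrier G" "a \<in> carrier G" "b \<in> carrier G"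
  shows "(x \<oplus> a) \<ominus> (x \<oplus> b) = a \<ominus> b"
proof -
  have "(x \<oplus> a) \<ominus> (x \<oplus> b) = ((x \<oplus> a) \<ominus> x) \<ominus> b"
    using assms by (simp add: a_minus_def minus_add a_assoc)
  then show ?thesis using assms by (simp add: add_diff_cancel_left1)
qed

end

context module
begin

lemma submodule_intro:
  assumes "H \<subseteq> carrier M" "\<zero>\<^bsub>M\<^esub> \<in> H"
    and "\<And>a b. a \<in> H \<Longrightarrow> b \<in> H \<Longrightarrow> a \<oplus>\<^bsub>M\<^esub> b \<in> H"
    and "\<And>a x. a \<in> carrier R \<Longrightarrow> x \<in> H \<Longrightarrow> a \<odot>\<^bsub>M\<^esub> x \<in> H"
  shows "submodule H R M"
proof (rule submoduleI)
  fix a assume "a \<in> H"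
  then have "\<ominus>\<^bsub>M\<^esub> a = (\<ominus> \<one>) \<odot>\<^bsub>M\<^esub> a" using assms(1) by (subst smult_l_minus) auto
  then show "\<ominus>\<^bsub>M\<^esub> a \<in> H" using assms(4)[of "\<ominus> \<one>" a] \<open>a \<in> H\<close> by auto
qed (use assms in auto)

lemma submoduleD:
  assumes "submodule H R M"
  shows "a \<in> H \<Longrightarrow> a \<in> carrier M" "\<zero>\<^bsub>M\<^esub> \<in> H"
    and "a \<in> H \<Longrightarrow> b \<in> H \<Longrightarrow> a \<oplus>\<^bsub>M\<^esub> b \<in> H"
    and "a \<in> H \<Longrightarrow> b \<in> H \<Longrightarrow> a \<ominus>\<^bsub>M\<^esub> b \<in> H"
    and "r \<in> carrier R \<Longrightarrow> a \<in> H \<Longrightarrow> r \<odot>\<^bsub>M\<^esub> a \<in> H"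
  using submoduleE[OF assms] subgroup.one_closed[OF submodule.axioms(1)[OF assms]]
  by (auto simp: a_minus_def)

lemma submodule_finsum:
  assumes H: "submodule H R M" and "finite I" "\<And>i. i \<in> I \<Longrightarrow> z i \<in> H"
  shows "(\<Oplus>\<^bsub>M\<^esub>i\<in>I. z i) \<in> H"
  using assms(2,3)
proof (induction I)
  case (insert i I)
  then show ?case using submoduleD[OF H] by (subst M.finsum_insert) (auto simp: Pi_def)
qed (use submoduleD[OF H] in auto)

lemma span_closed: "A \<subseteq> carrier M \<Longrightarrow> v \<in> module_span R M A \<Longrightarrow> v \<in> carrier M"
  by (rotate_tac, induction rule: module_span.induct) auto

lemma span_submodule: "A \<subseteq> carrier M \<Longrightarrow> submodule (module_span R M A) R M"
  by (rule submodule_intro) (auto intro: module_span.intros span_closed)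

lemma span_least:
  assumes "submodule H R M" "A \<subseteq> H" "v \<in> module_span R M A"
  shows "v \<in> H"
  using assms(3) by induction (use submoduleD[OF assms(1)] assms(2) in auto)

text \<open>This normal form drives the inductions on the number of generators below.\<close>

lemma span_insert:
  assumes "t \<in> carrier M" "A \<subseteq> carrier M" "v \<in> module_span R M (insert t A)"
  shows "\<exists>r\<in>carrier R. \<exists>u\<in>module_span R M A. v = r \<odot>\<^bsub>M\<^esub> t \<oplus>\<^bsub>M\<^esub> u"
  using assms(3)
proof induction
  case zero
  have "\<zero>\<^bsub>M\<^esub> = \<zero> \<odot>\<^bsub>M\<^esub> t \<oplus>\<^bsub>M\<^esub> \<zero>\<^bsub>M\<^esub>" using assms by simp
  then show ?case by (blast intro: module_span.zero)
next
  case (base a)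
  show ?case
  proof (cases "a = t")
    case True
    have "a = \<one> \<odot>\<^bsub>M\<^esub> t \<oplus>\<^bsub>M\<^esub> \<zero>\<^bsub>M\<^esub>" using assms True by simp
    then show ?thesis by (blast intro: module_span.zero)
  next
    case False
    then have "a \<in> A" using base by auto
    moreover have "a = \<zero> \<odot>\<^bsub>M\<^esub> t \<oplus>\<^bsub>M\<^esub> a" using assms(1,2) \<open>a \<in> A\<close> by (simp add: subset_iff)
    ultimately show ?thesis by (blast intro: module_span.base)
  qed
next
  case (add u v)
  then obtain r u' s v' where *: "r \<in> carrier R" "u' \<in> module_span R M A" "u = r \<odot>\<^bsub>M\<^esub> t \<oplus>\<^bsub>M\<^esub> u'"
    "s \<in> carrier R" "v' \<in> module_span R M A" "v = s \<odot>\<^bsub>M\<^esub> t \<oplus>\<^bsub>M\<^esub> v'" by blast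
  have "u \<oplus>\<^bsub>M\<^esub> v = (r \<oplus> s) \<odot>\<^bsub>M\<^esub> t \<oplus>\<^bsub>M\<^esub> (u' \<oplus>\<^bsub>M\<^esub> v')"
    using * assms(1) span_closed[OF assms(2)] by (simp add: smult_l_distr M.a_ac)
  then show ?case using * by (blast intro: module_span.add)
next
  case (smult s u)
  then obtain r u' where *: "r \<in> carrier R" "u' \<in> module_span R M A" "u = r \<odot>\<^bsub>M\<^esub> t \<oplus>\<^bsub>M\<^esub> u'" by blast
  have "s \<odot>\<^bsub>M\<^esub> u = (s \<otimes> r) \<odot>\<^bsub>M\<^esub> t \<oplus>\<^bsub>M\<^esub> s \<odot>\<^bsub>M\<^esub> u'"
    using * smult assms(1) span_closed[OF assms(2)] by (simp add: smult_r_distr smult_assoc1)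
  then show ?case using * smult by (blast intro: module_span.smult)
qed

text \<open>Principal ideal domains are Noetherian. In the induction step the coefficients at the new
  generator \<open>t\<close> of the elements of \<open>A\<close> form an ideal; one element of \<open>A\<close> realising a generator of that
  ideal, together with generators of the part of \<open>A\<close> without \<open>t\<close>, generates \<open>A\<close>.\<close>

lemma finitely_generated_submodule:
  assumes pid: "principal_domain R"
    and "finite F" "F \<subseteq> carrier M" "submodule A R M" "A \<subseteq> module_span R M F"
  shows "\<exists>F'. finite F' \<and> F' \<subseteq> A \<and> A = module_span R M F'"
  using assms(2-)
proof (induction F arbitrary: A)
  case empty
  have "submodule {\<zero>\<^bsub>M\<^esub>} R M" by (rule submodule_intro) auto
  then have "v = \<zero>\<^bsub>M\<^esub>" if "v \<in> module_span R M {}" for v using span_least that by blast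
  then have "A = module_span R M {}"
    using empty submoduleD(2)[of A] by (auto intro: module_span.zero)
  then show ?case by blast
next
  case (insert t F)
  interpret R: principal_domain R by fact
  note A = submoduleD[OF insert.prems(2)]
  have t: "t \<in> carrier M" and F: "F \<subseteq> carrier M" using insert by auto
  note S = submoduleD[OF span_submodule[OF F]]
  define I where "I = {r \<in> carrier R. \<exists>u\<in>module_span R M F. r \<odot>\<^bsub>M\<^esub> t \<oplus>\<^bsub>M\<^esub> u \<in> A}"
  have "ideal I R"
  proof (rule idealI)
    show "subgroup I (add_monoid R)"
    proof (rule subgroup.intro)
      show "I \<subseteq> carrier (add_monoid R)" by (auto simp: I_def)
      have "\<zero> \<odot>\<^bsub>M\<^esub> t \<oplus>\<^bsub>M\<^esub> \<zero>\<^bsub>M\<^esub> \<in> A" using A(2) t by simp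
      then show "\<one>\<^bsub>add_monoid R\<^esub> \<in> I" using S(2) by (auto simp: I_def)
    next
      fix r s assume "r \<in> I" "s \<in> I"
      then obtain u v where *: "r \<in> carrier R" "s \<in> carrier R" "u \<in> module_span R M F"
        "v \<in> module_span R M F" "r \<odot>\<^bsub>M\<^esub> t \<oplus>\<^bsub>M\<^esub> u \<in> A" "s \<odot>\<^bsub>M\<^esub> t \<oplus>\<^bsub>M\<^esub> v \<in> A" by (auto simp: I_def)
      have "(r \<odot>\<^bsub>M\<^esub> t \<oplus>\<^bsub>M\<^esub> u) \<oplus>\<^bsub>M\<^esub> (s \<odot>\<^bsub>M\<^esub> t \<oplus>\<^bsub>M\<^esub> v) = (r \<oplus> s) \<odot>\<^bsub>M\<^esub> t \<oplus>\<^bsub>M\<^esub> (u \<oplus>\<^bsub>M\<^esub> v)"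
        using * t S(1) by (simp add: smult_l_distr M.a_ac)
      then show "r \<otimes>\<^bsub>add_monoid R\<^esub> s \<in> I" using A(3)[OF *(5,6)] S(3)[OF *(3,4)] *(1,2)
        by (auto simp: I_def)
    next
      fix r assume "r \<in> I"
      then obtain u where *: "r \<in> carrier R" "u \<in> module_span R M F" "r \<odot>\<^bsub>M\<^esub> t \<oplus>\<^bsub>M\<^esub> u \<in> A"
        by (auto simp: I_def)
      have "(\<ominus> \<one>) \<odot>\<^bsub>M\<^esub> (r \<odot>\<^bsub>M\<^esub> t \<oplus>\<^bsub>M\<^esub> u) = (\<ominus> r) \<odot>\<^bsub>M\<^esub> t \<oplus>\<^bsub>M\<^esub> (\<ominus> \<one>) \<odot>\<^bsub>M\<^esub> u"
        using * t S(1) by (simp add: smult_r_distr smult_l_minus)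
      then have "(\<ominus> r) \<odot>\<^bsub>M\<^esub> t \<oplus>\<^bsub>M\<^esub> (\<ominus> \<one>) \<odot>\<^bsub>M\<^esub> u \<in> A" using A(5)[OF _ *(3), of "\<ominus> \<one>"] by simp
      then have "\<ominus> r \<in> I" using S(5)[OF _ *(2), of "\<ominus> \<one>"] *(1) by (auto simp: I_def)
      then show "inv\<^bsub>add_monoid R\<^esub> r \<in> I" by (simp add: a_inv_def)
    qed
    have mul: "x \<otimes> r \<in> I" if "r \<in> I" "x \<in> carrier R" for r x
    proof -
      obtain u where *: "r \<in> carrier R" "u \<in> module_span R M F" "r \<odot>\<^bsub>M\<^esub> t \<oplus>\<^bsub>M\<^esub> u \<in> A"
        using \<open>r \<in> I\<close> by (auto simp: I_def)
      have "x \<odot>\<^bsub>M\<^esub> (r \<odot>\<^bsub>M\<^esub> t \<oplus>\<^bsub>M\<^esub> u) = (x \<otimes> r) \<odot>\<^bsub>M\<^esub> t \<oplus>\<^bsub>M\<^esub> x \<odot>\<^bsub>M\<^esub> u"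
        using * t S(1) that by (simp add: smult_r_distr smult_assoc1)
      then show ?thesis using A(5)[OF that(2) *(3)] S(5)[OF that(2) *(2)] *(1) that(2)
        by (auto simp: I_def)
    qed
    show "x \<otimes> r \<in> I" if "r \<in> I" "x \<in> carrier R" for r x using mul that .
    show "r \<otimes> x \<in> I" if "r \<in> I" "x \<in> carrier R" for r x
      using mul[OF that] that R.m_comm[of r x] by (auto simp: I_def)
  qed (rule R.ring_axioms)
  from R.exists_gen[OF this] obtain d where d: "d \<in> carrier R" "I = PIdl d" by blast
  then have "d \<in> I" using R.cgenideal_self by auto
  then obtain u0 where u0: "u0 \<in> module_span R M F" "d \<odot>\<^bsub>M\<^esub> t \<oplus>\<^bsub>M\<^esub> u0 \<in> A" by (auto simp: I_def)
  define a0 where "a0 = d \<odot>\<^bsub>M\<^esub> t \<oplus>\<^bsub>M\<^esub> u0"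
  let ?A = "A \<inter> module_span R M F"
  have "submodule ?A R M" by (rule submodule_intro) (use A S in auto)
  from insert.IH[OF F this] obtain F' where F': "finite F'" "F' \<subseteq> ?A" "?A = module_span R M F'" by auto
  have sub: "insert a0 F' \<subseteq> A" using F' u0 by (auto simp: a0_def)
  have "a \<in> module_span R M (insert a0 F')" if a: "a \<in> A" for a
  proof -
    obtain r u where ru: "r \<in> carrier R" "u \<in> module_span R M F" "a = r \<odot>\<^bsub>M\<^esub> t \<oplus>\<^bsub>M\<^esub> u"
      using span_insert[OF t F] insert.prems(3) a by blast
    then have "r \<in> I" using a by (auto simp: I_def)
    then obtain s where s: "s \<in> carrier R" "r = s \<otimes> d" using d by (auto simp: cgenideal_def)
    have sa: "s \<odot>\<^bsub>M\<^esub> a0 \<in> A" using sub s A(5) by auto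
    have "s \<odot>\<^bsub>M\<^esub> a0 = r \<odot>\<^bsub>M\<^esub> t \<oplus>\<^bsub>M\<^esub> s \<odot>\<^bsub>M\<^esub> u0"
      using s d t u0 S(1) unfolding a0_def by (simp add: smult_r_distr smult_assoc1)
    then have "a \<ominus>\<^bsub>M\<^esub> s \<odot>\<^bsub>M\<^esub> a0 = u \<ominus>\<^bsub>M\<^esub> s \<odot>\<^bsub>M\<^esub> u0"
      using ru s t u0 S(1) by (simp add: M.add_diff_add_cancel_left)
    also have "\<dots> \<in> module_span R M F" using S(4)[OF ru(2) S(5)[OF s(1) u0(1)]] .
    finally have "a \<ominus>\<^bsub>M\<^esub> s \<odot>\<^bsub>M\<^esub> a0 \<in> ?A" using A(4)[OF a sa] by auto
    then have "a \<ominus>\<^bsub>M\<^esub> s \<odot>\<^bsub>M\<^esub> a0 \<in> module_span R M (insert a0 F')"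
      using F'(3) module_span_mono[of F' "insert a0 F'"] by auto
    moreover have "s \<odot>\<^bsub>M\<^esub> a0 \<in> module_span R M (insert a0 F')"
      using s by (auto intro: module_span.intros)
    moreover have "a = (a \<ominus>\<^bsub>M\<^esub> s \<odot>\<^bsub>M\<^esub> a0) \<oplus>\<^bsub>M\<^esub> s \<odot>\<^bsub>M\<^esub> a0"
      using A(1)[OF a] A(1)[OF sa] by (simp add: M.diff_add_cancel1)
    ultimately show ?thesis by (metis module_span.add)
  qed
  moreover have "module_span R M (insert a0 F') \<subseteq> A" using span_least[OF insert.prems(2) sub] by blast
  ultimately show ?case using F' sub by (intro exI[of _ "insert a0 F'"]) auto
qed

end

section \<open>Reduction modulo p\<close>

text \<open>What is used of a discrete valuation domain with maximal ideal \<open>pR\<close>: it is a principal ideal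
  domain in which the nonunits are the multiples of \<open>\<pi> = p \<cdot> 1\<close>. Consequently
  ``zero in the residue field'' can be expressed as ``not a unit''.\<close>

locale p_local_pid = principal_domain R for R (structure) +
  fixes p :: nat and \<pi>
  assumes prime_p: "normalization_semidom_class.prime p"
    and pi_def: "\<pi> = [int p] \<cdot> \<one>"
    and pi_nonzero: "\<pi> \<noteq> \<zero>"
    and pi_nonunit: "\<pi> \<notin> Units R"
    and nonunit_dvd: "a \<in> carrier R \<Longrightarrow> a \<notin> Units R \<Longrightarrow> \<exists>b\<in>carrier R. a = \<pi> \<otimes> b"
begin

lemma pi_closed [simp, intro]: "\<pi> \<in> carrier R"
  unfolding pi_def by simp

lemma one_minus_pi_mult_unit:
  assumes "a \<in> carrier R" shows "\<one> \<ominus> \<pi> \<otimes> a \<in> Units R"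
proof (rule ccontr)
  assume "\<one> \<ominus> \<pi> \<otimes> a \<notin> Units R"
  moreover have "\<one> \<ominus> \<pi> \<otimes> a \<in> carrier R" using assms by simp
  ultimately obtain b where b: "b \<in> carrier R" "\<one> \<ominus> \<pi> \<otimes> a = \<pi> \<otimes> b"
    using nonunit_dvd[of "\<one> \<ominus> \<pi> \<otimes> a"] by auto
  have "\<one> = (\<one> \<ominus> \<pi> \<otimes> a) \<oplus> \<pi> \<otimes> a" using assms by (simp add: a_minus_def a_assoc l_neg)
  also have "\<dots> = \<pi> \<otimes> (b \<oplus> a)" using assms b by (simp add: r_distr)
  finally have *: "\<one> = \<pi> \<otimes> (b \<oplus> a)" .
  have "b \<oplus> a \<in> carrier R" using assms b by simp
  then have "\<pi> \<in> Units R"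
    unfolding Units_def using * m_comm[of \<pi> "b \<oplus> a"] by auto
  then show False using pi_nonunit by simp
qed

end

locale p_local_module = R?: p_local_pid R p \<pi> + module R M for R (structure) and p \<pi> and M (structure)
begin

definition "pM = (\<lambda>v. \<pi> \<odot>\<^bsub>M\<^esub> v) ` carrier M"

lemma pM_submodule: "submodule pM R M"
proof (rule submodule_intro)
  show "a \<oplus>\<^bsub>M\<^esub> b \<in> pM" if ab: "a \<in> pM" "b \<in> pM" for a b
  proof -
    obtain v w where "v \<in> carrier M" "w \<in> carrier M" "a = \<pi> \<odot>\<^bsub>M\<^esub> v" "b = \<pi> \<odot>\<^bsub>M\<^esub> w"
      using ab by (auto simp: pM_def)
    then show ?thesis unfolding pM_def
      by (intro image_eqI[of _ _ "v \<oplus>\<^bsub>M\<^esub> w"]) (auto simp: smult_r_distr)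
  qed
  show "r \<odot>\<^bsub>M\<^esub> a \<in> pM" if ra: "r \<in> carrier R" "a \<in> pM" for r a
  proof -
    obtain v where "v \<in> carrier M" "a = \<pi> \<odot>\<^bsub>M\<^esub> v" using ra by (auto simp: pM_def)
    then show ?thesis unfolding pM_def using ra
      by (intro image_eqI[of _ _ "r \<odot>\<^bsub>M\<^esub> v"]) (auto simp: smult_assoc1[symmetric] m_comm)
  qed
qed (auto simp: pM_def intro: image_eqI[of _ _ "\<zero>\<^bsub>M\<^esub>"])

text \<open>Nakayama's lemma for a submodule \<open>A\<close> of \<open>M\<close>. Generators of \<open>A\<close> modulo \<open>H\<close> are discarded one at
  a time: if \<open>t = h + \<pi> w\<close> and \<open>w\<close> involves \<open>t\<close> with coefficient \<open>r\<close>, then \<open>1 - \<pi> r\<close> is a unit, so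
  \<open>t\<close> is a combination of \<open>H\<close> and of the other generators.\<close>

lemma nakayama:
  assumes A: "submodule A R M" and H: "submodule H R M" "H \<subseteq> A"
    and F: "finite F" "A = module_span R M F"
    and step: "\<And>v. v \<in> A \<Longrightarrow> \<exists>h\<in>H. \<exists>w\<in>A. v = h \<oplus>\<^bsub>M\<^esub> \<pi> \<odot>\<^bsub>M\<^esub> w"
  shows "H = A"
proof -
  have main: "H = A" if "finite F" "F \<subseteq> A" "A \<subseteq> module_span R M (H \<union> F)" for F
    using that
  proof (induction F)
    case empty
    then show ?case using span_least[OF H(1), of H] H(2) by auto
  next
    case (insert t F)
    note AD = submoduleD[OF A]
    have sub: "H \<union> F \<subseteq> carrier M" and t: "t \<in> carrier M" "t \<in> A"
      using insert H AD(1) by auto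
    note S = submoduleD[OF span_submodule[OF sub]]
    obtain h w where hw: "h \<in> H" "w \<in> A" "t = h \<oplus>\<^bsub>M\<^esub> \<pi> \<odot>\<^bsub>M\<^esub> w" using step[OF t(2)] by blast
    obtain r u where ru: "r \<in> carrier R" "u \<in> module_span R M (H \<union> F)" "w = r \<odot>\<^bsub>M\<^esub> t \<oplus>\<^bsub>M\<^esub> u"
      using span_insert[OF t(1) sub, of w] insert.prems(2) hw(2) by auto
    define k where "k = \<one> \<ominus> \<pi> \<otimes> r"
    have k: "k \<in> Units R" unfolding k_def using one_minus_pi_mult_unit[OF ru(1)] .
    have hM: "h \<in> carrier M" using hw H AD by auto
    have uM: "u \<in> carrier M" using S(1) ru by auto
    have z: "h \<oplus>\<^bsub>M\<^esub> \<pi> \<odot>\<^bsub>M\<^esub> u \<in> module_span R M (H \<union> F)"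
      using hw(1) by (intro S(3)[OF module_span.base S(5)[OF pi_closed ru(2)]]) auto
    have "t = h \<oplus>\<^bsub>M\<^esub> ((\<pi> \<otimes> r) \<odot>\<^bsub>M\<^esub> t \<oplus>\<^bsub>M\<^esub> \<pi> \<odot>\<^bsub>M\<^esub> u)"
      using hw(3) ru(1) uM t(1) unfolding ru(3) by (simp add: smult_r_distr smult_assoc1)
    then have "t \<ominus>\<^bsub>M\<^esub> (\<pi> \<otimes> r) \<odot>\<^bsub>M\<^esub> t = (h \<oplus>\<^bsub>M\<^esub> ((\<pi> \<otimes> r) \<odot>\<^bsub>M\<^esub> t \<oplus>\<^bsub>M\<^esub> \<pi> \<odot>\<^bsub>M\<^esub> u)) \<ominus>\<^bsub>M\<^esub> (\<pi> \<otimes> r) \<odot>\<^bsub>M\<^esub> t"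
      by simp
    also have "\<dots> = h \<oplus>\<^bsub>M\<^esub> \<pi> \<odot>\<^bsub>M\<^esub> u"
      using hM uM t(1) ru(1) M.add_diff_cancel_left1[of "(\<pi> \<otimes> r) \<odot>\<^bsub>M\<^esub> t" "h \<oplus>\<^bsub>M\<^esub> \<pi> \<odot>\<^bsub>M\<^esub> u"]
      by (simp add: M.a_lcomm)
    finally have "k \<odot>\<^bsub>M\<^esub> t = h \<oplus>\<^bsub>M\<^esub> \<pi> \<odot>\<^bsub>M\<^esub> u"
      unfolding k_def a_minus_def using t(1) ru(1) by (simp add: smult_l_distr smult_l_minus)
    then have "inv k \<odot>\<^bsub>M\<^esub> (k \<odot>\<^bsub>M\<^esub> t) \<in> module_span R M (H \<union> F)" using S(5)[OF _ z] k by simp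
    moreover have "inv k \<odot>\<^bsub>M\<^esub> (k \<odot>\<^bsub>M\<^esub> t) = t"
      using k t by (simp add: smult_assoc1[symmetric] Units_closed)
    ultimately have "insert t (H \<union> F) \<subseteq> module_span R M (H \<union> F)" by (auto intro: module_span.base)
    then have "module_span R M (insert t (H \<union> F)) \<subseteq> module_span R M (H \<union> F)"
      using span_least[OF span_submodule[OF sub]] by blast
    then show ?case using insert by auto
  qed
  show ?thesis
  proof (rule main[OF F(1)])
    show "F \<subseteq> A" using F by (auto intro: module_span.base)
    show "A \<subseteq> module_span R M (H \<union> F)" unfolding F(2) by (rule module_span_mono) auto
  qed
qed

text \<open>Linear independence over the residue field of the classes in \<open>M / pM\<close>, expressed without
  forming these quotients.\<close>

definition p_independent :: "'c set \<Rightarrow> bool" where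
  "p_independent B \<longleftrightarrow> (\<forall>c \<in> B \<rightarrow> carrier R. (\<Oplus>\<^bsub>M\<^esub>b\<in>B. c b \<odot>\<^bsub>M\<^esub> b) \<in> pM \<longrightarrow> (\<forall>b\<in>B. c b \<notin> Units R))"

text \<open>If \<open>a\<close> occurs in a relation with a unit as coefficient, then \<open>a\<close> can be solved for; otherwise its
  term vanishes modulo \<open>p\<close> and the independence of \<open>B\<close> applies.\<close>

lemma p_independent_insert:
  assumes B: "finite B" "B \<subseteq> carrier M" "p_independent B" and a: "a \<in> carrier M"
    and nspan: "a \<notin> module_span R M (B \<union> pM)"
  shows "p_independent (insert a B)"
  unfolding p_independent_def
proof (intro ballI impI)
  fix c b assume c: "c \<in> insert a B \<rightarrow> carrier R" and b: "b \<in> insert a B"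
    and sum: "(\<Oplus>\<^bsub>M\<^esub>b\<in>insert a B. c b \<odot>\<^bsub>M\<^esub> b) \<in> pM"
  let ?s = "\<Oplus>\<^bsub>M\<^esub>b\<in>B. c b \<odot>\<^bsub>M\<^esub> b"
  have sub: "B \<union> pM \<subseteq> carrier M" using B submoduleD(1)[OF pM_submodule] by auto
  note S = submoduleD[OF span_submodule[OF sub]]
  have aB: "a \<notin> B" using nspan by (auto intro: module_span.base)
  have ca: "c a \<in> carrier R" and sM: "?s \<in> carrier M"
    using c B by (auto intro!: M.finsum_closed)
  have sS: "?s \<in> module_span R M (B \<union> pM)"
    using c B by (intro submodule_finsum[OF span_submodule[OF sub]] S(5)) (auto intro: module_span.base)
  have eq: "(\<Oplus>\<^bsub>M\<^esub>b\<in>insert a B. c b \<odot>\<^bsub>M\<^esub> b) = c a \<odot>\<^bsub>M\<^esub> a \<oplus>\<^bsub>M\<^esub> ?s"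
    using c B a aB by (subst M.finsum_insert) auto
  have ca_nu: "c a \<notin> Units R"
  proof
    assume u: "c a \<in> Units R"
    have "(c a \<odot>\<^bsub>M\<^esub> a \<oplus>\<^bsub>M\<^esub> ?s) \<ominus>\<^bsub>M\<^esub> ?s \<in> module_span R M (B \<union> pM)"
      using S(4)[OF _ sS] sum unfolding eq by (auto intro: module_span.base)
    then have "c a \<odot>\<^bsub>M\<^esub> a \<in> module_span R M (B \<union> pM)"
      using ca a sM by (simp add: M.add_diff_cancel_right1)
    then have "inv (c a) \<odot>\<^bsub>M\<^esub> (c a \<odot>\<^bsub>M\<^esub> a) \<in> module_span R M (B \<union> pM)"
      using S(5) u by simp
    then have "a \<in> module_span R M (B \<union> pM)"
      using u a ca by (simp add: smult_assoc1[symmetric])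
    then show False using nspan by simp
  qed
  show "c b \<notin> Units R"
  proof (cases "b = a")
    case False
    obtain d where d: "d \<in> carrier R" "c a = \<pi> \<otimes> d" using nonunit_dvd[OF ca ca_nu] by blast
    then have "c a \<odot>\<^bsub>M\<^esub> a \<in> pM" using a by (auto simp: pM_def smult_assoc1)
    then have "(c a \<odot>\<^bsub>M\<^esub> a \<oplus>\<^bsub>M\<^esub> ?s) \<ominus>\<^bsub>M\<^esub> c a \<odot>\<^bsub>M\<^esub> a \<in> pM"
      using submoduleD(4)[OF pM_submodule] sum eq by simp
    then have "?s \<in> pM" using ca a sM by (simp add: M.add_diff_cancel_left1)
    then show ?thesis using B(3) c b False by (auto simp: p_independent_def)
  qed (use ca_nu in simp)
qed

lemma p_independent_extend:
  assumes A: "finite A" "A \<subseteq> carrier M" and B: "finite B" "B \<subseteq> carrier M" "p_independent B"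
  shows "\<exists>B'. B \<subseteq> B' \<and> B' \<subseteq> B \<union> A \<and> p_independent B' \<and> A \<subseteq> module_span R M (B' \<union> pM)"
  using A
proof (induction A)
  case (insert a A)
  then obtain B' where B': "B \<subseteq> B'" "B' \<subseteq> B \<union> A" "p_independent B'"
    "A \<subseteq> module_span R M (B' \<union> pM)" by auto
  have fin: "finite B'" "B' \<subseteq> carrier M"
    using B' B insert finite_subset[of B' "B \<union> A"] by auto
  show ?case
  proof (cases "a \<in> module_span R M (B' \<union> pM)")
    case True
    then show ?thesis using B' by (intro exI[of _ B']) auto
  next
    case False
    have "p_independent (insert a B')"
      using False fin B' insert by (intro p_independent_insert) auto
    moreover have "A \<subseteq> module_span R M (insert a B' \<union> pM)"
      using B'(4) module_span_mono[of "B' \<union> pM" "insert a B' \<union> pM"] by blast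
    moreover have "a \<in> module_span R M (insert a B' \<union> pM)" by (rule module_span.base) simp
    ultimately show ?thesis using B' by (intro exI[of _ "insert a B'"] conjI) auto
  qed
qed (use B in auto)

end

section \<open>Modules with an endomorphism T, and polynomials in T - 1\<close>

abbreviation poly_x :: "int poly" where "poly_x \<equiv> [:0, 1:]"

locale p_local_endo = p_local_module R p \<pi> M for R (structure) and p \<pi> and M (structure) +
  fixes T
  assumes T_hom: "T \<in> module_homs R M M"
begin

lemmas T_closed [simp] = module_homD(1)[OF T_hom]
lemmas T_add = module_homD(2)[OF T_hom]
lemmas T_smult = module_homD(3)[OF T_hom]

definition int_scalar :: "int \<Rightarrow> 'a" where "int_scalar a = [a] \<cdot> \<one>"

lemma int_scalar_closed [simp]: "int_scalar a \<in> carrier R"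
  by (simp add: int_scalar_def)

lemma int_scalar_simps:
  "int_scalar 0 = \<zero>" "int_scalar 1 = \<one>" "int_scalar (int p) = \<pi>"
  "int_scalar (a + b) = int_scalar a \<oplus> int_scalar b"
  "int_scalar (a * b) = int_scalar a \<otimes> int_scalar b"
proof -
  show "int_scalar 0 = \<zero>" "int_scalar 1 = \<one>" "int_scalar (int p) = \<pi>"
    using R.add.int_pow_1[OF R.one_closed] by (simp_all add: int_scalar_def pi_def add_pow_def)
  show "int_scalar (a + b) = int_scalar a \<oplus> int_scalar b"
    by (simp add: int_scalar_def R.add.int_pow_mult)
  have "[a] \<cdot> (\<one> \<otimes> [b] \<cdot> \<one>) = ([a] \<cdot> \<one>) \<otimes> ([b] \<cdot> \<one>)"
    by (rule R.add_pow_ldistr_int[symmetric]) auto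
  then show "int_scalar (a * b) = int_scalar a \<otimes> int_scalar b"
    by (simp add: int_scalar_def R.add.int_pow_pow mult.commute)
qed

text \<open>The polynomial \<open>f\<close> acts as \<open>f (T - 1)\<close>, evaluated by Horner's scheme. All identities between
  operators are proved in the ring of integer polynomials and transported by \<open>act_add\<close> and
  \<open>act_mult\<close>.\<close>

definition act :: "int poly \<Rightarrow> 'c \<Rightarrow> 'c" where
  "act f v = fold_coeffs (\<lambda>a u. int_scalar a \<odot>\<^bsub>M\<^esub> v \<oplus>\<^bsub>M\<^esub> (T u \<ominus>\<^bsub>M\<^esub> u)) f \<zero>\<^bsub>M\<^esub>"

lemma T_zero [simp]: "T \<zero>\<^bsub>M\<^esub> = \<zero>\<^bsub>M\<^esub>"
  using T_smult[of \<zero> "\<zero>\<^bsub>M\<^esub>"] by simp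

lemma act_0 [simp]: "act 0 v = \<zero>\<^bsub>M\<^esub>"
  by (simp add: act_def)

lemma act_pCons:
  assumes "v \<in> carrier M"
  shows "act (pCons a f) v = int_scalar a \<odot>\<^bsub>M\<^esub> v \<oplus>\<^bsub>M\<^esub> (T (act f v) \<ominus>\<^bsub>M\<^esub> act f v)"
proof (cases "a = 0 \<and> f = 0")
  case True
  then show ?thesis using assms by (simp add: int_scalar_simps a_minus_def)
next
  case False
  then show ?thesis
    by (cases "a = 0") (simp_all add: act_def fold_coeffs_pCons_coeff_not_0_eq fold_coeffs_pCons_not_0_0_eq)
qed

lemma act_closed [simp]: "v \<in> carrier M \<Longrightarrow> act f v \<in> carrier M"
  by (induction f) (simp_all add: act_pCons)

lemma T_diff_add:
  assumes "u \<in> carrier M" "v \<in> carrier M"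
  shows "T (u \<oplus>\<^bsub>M\<^esub> v) \<ominus>\<^bsub>M\<^esub> (u \<oplus>\<^bsub>M\<^esub> v) = (T u \<ominus>\<^bsub>M\<^esub> u) \<oplus>\<^bsub>M\<^esub> (T v \<ominus>\<^bsub>M\<^esub> v)"
  using assms by (simp add: T_add a_minus_def M.minus_add M.a_ac)

lemma T_diff_smult:
  assumes "u \<in> carrier M" "r \<in> carrier R"
  shows "T (r \<odot>\<^bsub>M\<^esub> u) \<ominus>\<^bsub>M\<^esub> (r \<odot>\<^bsub>M\<^esub> u) = r \<odot>\<^bsub>M\<^esub> (T u \<ominus>\<^bsub>M\<^esub> u)"
  using assms by (simp add: T_smult a_minus_def smult_r_distr smult_r_minus)

lemma act_add:
  assumes v: "v \<in> carrier M"
  shows "act (f + h) v = act f v \<oplus>\<^bsub>M\<^esub> act h v"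
proof (induction f h rule: poly_induct2)
  case (pCons a f b h)
  then show ?case using v
    by (simp add: act_pCons int_scalar_simps smult_l_distr T_diff_add)
      (simp add: M.a_ac a_minus_def)
qed simp

lemma act_smult_poly:
  assumes v: "v \<in> carrier M"
  shows "act (smult a f) v = int_scalar a \<odot>\<^bsub>M\<^esub> act f v"
proof (induction f)
  case (pCons b f)
  then show ?case using v
    by (simp add: act_pCons int_scalar_simps smult_assoc1 smult_r_distr T_diff_smult)
qed simp

lemma act_mult:
  assumes v: "v \<in> carrier M"
  shows "act (f * h) v = act f (act h v)"
proof (induction f)
  case (pCons a f)
  then show ?case using v
    by (simp add: mult_pCons_left act_add act_smult_poly act_pCons int_scalar_simps)
qed simp

lemma act_commute: "v \<in> carrier M \<Longrightarrow> act f (act h v) = act h (act f v)"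
  by (simp add: act_mult[symmetric] mult.commute)

lemma act_add_right:
  assumes "u \<in> carrier M" "v \<in> carrier M"
  shows "act f (u \<oplus>\<^bsub>M\<^esub> v) = act f u \<oplus>\<^bsub>M\<^esub> act f v"
proof (induction f)
  case (pCons b f)
  then show ?case using assms
    by (simp add: act_pCons T_diff_add smult_r_distr) (simp add: M.a_ac a_minus_def)
qed simp

lemma act_smult_right:
  assumes "v \<in> carrier M" "r \<in> carrier R"
  shows "act f (r \<odot>\<^bsub>M\<^esub> v) = r \<odot>\<^bsub>M\<^esub> act f v"
proof (induction f)
  case (pCons b f)
  have "int_scalar b \<odot>\<^bsub>M\<^esub> (r \<odot>\<^bsub>M\<^esub> v) = r \<odot>\<^bsub>M\<^esub> (int_scalar b \<odot>\<^bsub>M\<^esub> v)"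
    using assms by (simp add: smult_assoc1[symmetric] m_comm)
  with pCons show ?case using assms
    by (simp add: act_pCons T_diff_smult smult_r_distr)
qed (use assms in simp)

lemma act_1 [simp]: "v \<in> carrier M \<Longrightarrow> act 1 v = v"
  by (simp add: one_pCons act_pCons int_scalar_simps a_minus_def)

lemma act_of_nat_p: "v \<in> carrier M \<Longrightarrow> act (of_nat p) v = \<pi> \<odot>\<^bsub>M\<^esub> v"
  by (simp add: of_nat_poly act_pCons int_scalar_simps a_minus_def)

lemma act_x: "v \<in> carrier M \<Longrightarrow> act poly_x v = T v \<ominus>\<^bsub>M\<^esub> v"
  by (simp add: act_pCons int_scalar_simps a_minus_def)

lemma act_one_plus_x: "v \<in> carrier M \<Longrightarrow> act (1 + poly_x) v = T v"
  by (simp only: act_add act_1 act_x) (simp add: M.a_comm[of v] M.diff_add_cancel1)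

lemma funpow_T_closed [simp]: "v \<in> carrier M \<Longrightarrow> (T ^^ k) v \<in> carrier M"
  by (induction k) auto

lemma act_T_power: "v \<in> carrier M \<Longrightarrow> act ((1 + poly_x) ^ k) v = (T ^^ k) v"
proof (induction k)
  case (Suc k)
  then show ?case unfolding power_Suc by (simp only: act_mult act_one_plus_x funpow_T_closed) simp
qed simp

lemma act_submodule_closed:
  assumes "submodule Q R M" "\<And>v. v \<in> Q \<Longrightarrow> T v \<in> Q" "v \<in> Q"
  shows "act f v \<in> Q"
proof (induction f)
  case (pCons a f)
  then show ?case
    using submoduleD[OF assms(1)] assms(2,3) by (simp add: act_pCons)
qed (use submoduleD[OF assms(1)] in simp)

lemma pM_iff: "v \<in> pM \<longleftrightarrow> (\<exists>z\<in>carrier M. v = \<pi> \<odot>\<^bsub>M\<^esub> z)"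
  by (auto simp: pM_def)

lemma pM_I: "z \<in> carrier M \<Longrightarrow> \<pi> \<odot>\<^bsub>M\<^esub> z \<in> pM"
  by (auto simp: pM_def)

lemma act_pM: "v \<in> pM \<Longrightarrow> act f v \<in> pM"
  by (auto simp: pM_def act_smult_right)

definition fixed :: "nat \<Rightarrow> 'c set" where
  "fixed m = {v \<in> carrier M. (T ^^ (p ^ m)) v = v}"

lemma fixed_iff: "v \<in> fixed m \<longleftrightarrow> v \<in> carrier M \<and> act ((1 + poly_x) ^ (p ^ m)) v = v"
  by (auto simp: fixed_def act_T_power)

lemma fixed_submodule: "submodule (fixed m) R M"
proof (rule submodule_intro)
  show "\<zero>\<^bsub>M\<^esub> \<in> fixed m"
    using act_smult_right[of "\<zero>\<^bsub>M\<^esub>" \<zero>] by (simp add: fixed_iff)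
qed (auto simp: fixed_iff act_add_right act_smult_right)

lemma act_fixed: "v \<in> fixed m \<Longrightarrow> act f v \<in> fixed m"
  by (auto simp: fixed_iff act_commute[of v _ f])

lemma fixed_mono: 
  assumes "m \<le> k" shows "fixed m \<subseteq> fixed k"
proof
  fix v assume v: "v \<in> fixed m"
  have "((T ^^ (p ^ m)) ^^ j) v = v" for j
    using v by (induction j) (auto simp: fixed_def)
  then show "v \<in> fixed k"
    using v assms by (auto simp: fixed_def le_iff_add power_add funpow_mult mult.commute)
qed

lemma T_power_expand:
  "\<exists>a. \<forall>v\<in>carrier M.
     (T ^^ (p ^ m)) v = v \<oplus>\<^bsub>M\<^esub> (act (poly_x ^ (p ^ m)) v \<oplus>\<^bsub>M\<^esub> \<pi> \<odot>\<^bsub>M\<^esub> act a v)"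
proof -
  obtain a where a: "(1 + poly_x) ^ (p ^ m) = 1 + poly_x ^ (p ^ m) + of_nat p * (poly_x * a)"
    using prime_power_of_one_plus[OF prime_p] by blast
  have "(T ^^ (p ^ m)) v = v \<oplus>\<^bsub>M\<^esub> (act (poly_x ^ (p ^ m)) v \<oplus>\<^bsub>M\<^esub> \<pi> \<odot>\<^bsub>M\<^esub> act (poly_x * a) v)"
    if "v \<in> carrier M" for v
    unfolding act_T_power[OF that, symmetric] a using that
    by (simp only: act_add act_mult[of _ "of_nat p"] act_1 act_of_nat_p act_closed M.a_assoc smult_closed pi_closed)
  then show ?thesis by blast
qed

text \<open>The operators \<open>T ^ (p ^ m) - 1\<close> and \<open>x ^ (p ^ m)\<close> agree modulo \<open>p\<close>.\<close>

lemma fixed_x_power: "v \<in> fixed m \<Longrightarrow> act (poly_x ^ (p ^ m)) v \<in> pM"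
proof -
  assume v: "v \<in> fixed m"
  then have vM: "v \<in> carrier M" by (simp add: fixed_def)
  obtain a where a: "(T ^^ (p ^ m)) v = v \<oplus>\<^bsub>M\<^esub> (act (poly_x ^ (p ^ m)) v \<oplus>\<^bsub>M\<^esub> \<pi> \<odot>\<^bsub>M\<^esub> act a v)"
    using T_power_expand vM by blast
  let ?z = "act a v"
  have eq: "v = v \<oplus>\<^bsub>M\<^esub> (act (poly_x ^ (p ^ m)) v \<oplus>\<^bsub>M\<^esub> \<pi> \<odot>\<^bsub>M\<^esub> ?z)"
    using a v by (simp add: fixed_def)
  have "act (poly_x ^ (p ^ m)) v \<oplus>\<^bsub>M\<^esub> \<pi> \<odot>\<^bsub>M\<^esub> ?z = v \<ominus>\<^bsub>M\<^esub> v"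
    by (subst (2) eq, rule M.add_diff_cancel_left1[symmetric]) (use vM in auto)
  then have "act (poly_x ^ (p ^ m)) v \<oplus>\<^bsub>M\<^esub> \<pi> \<odot>\<^bsub>M\<^esub> ?z = \<zero>\<^bsub>M\<^esub>"
    using vM by (simp add: a_minus_def M.r_neg)
  then have "act (poly_x ^ (p ^ m)) v = \<ominus>\<^bsub>M\<^esub> (\<pi> \<odot>\<^bsub>M\<^esub> ?z)"
    using vM by (intro M.minus_equality[symmetric]) auto
  also have "\<dots> = \<pi> \<odot>\<^bsub>M\<^esub> (\<ominus>\<^bsub>M\<^esub> ?z)" using vM by (simp add: smult_r_minus)
  finally show ?thesis using vM by (auto simp: pM_def)
qed

lemma lincomb_pM_cong:
  assumes "finite I" "c \<in> I \<rightarrow> carrier R" "u \<in> I \<rightarrow> carrier M" "z \<in> I \<rightarrow> carrier M"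
    and "\<And>i. i \<in> I \<Longrightarrow> v i = u i \<oplus>\<^bsub>M\<^esub> \<pi> \<odot>\<^bsub>M\<^esub> z i"
  shows "(\<Oplus>\<^bsub>M\<^esub>i\<in>I. c i \<odot>\<^bsub>M\<^esub> v i) \<in> pM \<longleftrightarrow> (\<Oplus>\<^bsub>M\<^esub>i\<in>I. c i \<odot>\<^bsub>M\<^esub> u i) \<in> pM"
proof -
  let ?u = "\<Oplus>\<^bsub>M\<^esub>i\<in>I. c i \<odot>\<^bsub>M\<^esub> u i" and ?z = "\<Oplus>\<^bsub>M\<^esub>i\<in>I. c i \<odot>\<^bsub>M\<^esub> (\<pi> \<odot>\<^bsub>M\<^esub> z i)"
  have [simp]: "c i \<in> carrier R" "u i \<in> carrier M" "z i \<in> carrier M" if "i \<in> I" for i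
    using assms that by auto
  have cl: "?u \<in> carrier M" "?z \<in> carrier M" by (auto intro!: M.finsum_closed)
  have z: "?z \<in> pM"
    by (intro submodule_finsum[OF pM_submodule assms(1)] submoduleD(5)[OF pM_submodule] pM_I) auto
  have "(\<Oplus>\<^bsub>M\<^esub>i\<in>I. c i \<odot>\<^bsub>M\<^esub> v i) = (\<Oplus>\<^bsub>M\<^esub>i\<in>I. c i \<odot>\<^bsub>M\<^esub> u i \<oplus>\<^bsub>M\<^esub> c i \<odot>\<^bsub>M\<^esub> (\<pi> \<odot>\<^bsub>M\<^esub> z i))"
    using assms(5) by (intro M.finsum_cong') (auto simp: smult_r_distr)
  also have "\<dots> = ?u \<oplus>\<^bsub>M\<^esub> ?z" by (intro M.finsum_addf) auto
  finally have eq: "(\<Oplus>\<^bsub>M\<^esub>i\<in>I. c i \<odot>\<^bsub>M\<^esub> v i) = ?u \<oplus>\<^bsub>M\<^esub> ?z" .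
  show ?thesis unfolding eq
    using submoduleD(3)[OF pM_submodule _ z, of ?u] submoduleD(4)[OF pM_submodule _ z, of "?u \<oplus>\<^bsub>M\<^esub> ?z"] cl
    by (auto simp: M.add_diff_cancel_right1)
qed

lemma norm_cong:
  assumes v: "v \<in> carrier M"
  shows "\<exists>z\<in>carrier M. (\<Oplus>\<^bsub>M\<^esub>i\<in>{..<p ^ m}. (T ^^ i) v) = act (poly_x ^ (p ^ m - 1)) v \<oplus>\<^bsub>M\<^esub> \<pi> \<odot>\<^bsub>M\<^esub> z"
proof -
  obtain d where d: "(\<Sum>i<p ^ m. (1 + poly_x) ^ i) = poly_x ^ (p ^ m - 1) + of_nat p * d"
    using norm_prime_power[OF prime_p] by blast
  have "act (\<Sum>i<k. (1 + poly_x) ^ i) v = (\<Oplus>\<^bsub>M\<^esub>i\<in>{..<k}. (T ^^ i) v)" for k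
  proof (induction k)
    case (Suc k)
    then show ?case using v
      by (simp only: sum.lessThan_Suc act_add act_T_power lessThan_Suc)
        (simp add: Pi_def M.a_comm act_add act_T_power)
  qed simp
  then have "(\<Oplus>\<^bsub>M\<^esub>i\<in>{..<p ^ m}. (T ^^ i) v) = act (poly_x ^ (p ^ m - 1) + of_nat p * d) v"
    using d by metis
  also have "\<dots> = act (poly_x ^ (p ^ m - 1)) v \<oplus>\<^bsub>M\<^esub> \<pi> \<odot>\<^bsub>M\<^esub> act d v"
    using v by (simp only: act_add act_mult[of _ "of_nat p"] act_of_nat_p act_closed)
  finally show ?thesis using v by auto
qed

end

section \<open>Coflasque lattices are permutation modules\<close>

text \<open>If \<open>T\<close> is the action of a generator of a cyclic group of order \<open>p ^ n\<close>, the assumption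
  \<open>fixed_lift\<close> says that for each subgroup \<open>U\<close> the fixed vectors of \<open>M / pM\<close> lift to fixed vectors of
  \<open>M\<close>. By the long exact sequence of multiplication by \<open>p\<close>, this means that \<open>H\<^sup>1(U, M)\<close> has no
  \<open>p\<close>-torsion, hence that it vanishes, as it is annihilated by the order of \<open>U\<close>.\<close>

locale coflasque_endo = p_local_endo R p \<pi> M T for R (structure) and p \<pi> and M (structure) and T +
  fixes n :: nat and F0
  assumes period: "v \<in> carrier M \<Longrightarrow> (T ^^ (p ^ n)) v = v"
    and torsion_free: "v \<in> carrier M \<Longrightarrow> \<pi> \<odot>\<^bsub>M\<^esub> v = \<zero>\<^bsub>M\<^esub> \<Longrightarrow> v = \<zero>\<^bsub>M\<^esub>"
    and fin_gen: "finite F0" "F0 \<subseteq> carrier M" "carrier M = module_span R M F0"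
    and fixed_lift: "m \<le> n \<Longrightarrow> v \<in> carrier M \<Longrightarrow> z \<in> carrier M \<Longrightarrow>
        (T ^^ (p ^ m)) v = v \<oplus>\<^bsub>M\<^esub> \<pi> \<odot>\<^bsub>M\<^esub> z \<Longrightarrow>
        \<exists>w\<in>carrier M. (T ^^ (p ^ m)) w = w \<and> (\<exists>z'\<in>carrier M. v = w \<oplus>\<^bsub>M\<^esub> \<pi> \<odot>\<^bsub>M\<^esub> z')"
begin

lemma lift:
  assumes m: "m \<le> n" and v: "v \<in> carrier M" and xv: "act (poly_x ^ (p ^ m)) v \<in> pM"
  shows "\<exists>w\<in>fixed m. \<exists>z\<in>carrier M. v = w \<oplus>\<^bsub>M\<^esub> \<pi> \<odot>\<^bsub>M\<^esub> z"
proof -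
  obtain z where z: "z \<in> carrier M" "act (poly_x ^ (p ^ m)) v = \<pi> \<odot>\<^bsub>M\<^esub> z" using xv by (auto simp: pM_iff)
  obtain a where "\<And>v. v \<in> carrier M \<Longrightarrow>
      (T ^^ (p ^ m)) v = v \<oplus>\<^bsub>M\<^esub> (act (poly_x ^ (p ^ m)) v \<oplus>\<^bsub>M\<^esub> \<pi> \<odot>\<^bsub>M\<^esub> act a v)"
    using T_power_expand by blast
  then have "(T ^^ (p ^ m)) v = v \<oplus>\<^bsub>M\<^esub> \<pi> \<odot>\<^bsub>M\<^esub> (z \<oplus>\<^bsub>M\<^esub> act a v)"
    using v z by (simp add: smult_r_distr)
  from fixed_lift[OF m v _ this] v z show ?thesis by (auto simp: fixed_def)
qed

lemma pi_smult_fixed: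
  assumes "v \<in> carrier M" "\<pi> \<odot>\<^bsub>M\<^esub> v \<in> fixed m"
  shows "v \<in> fixed m"
proof -
  let ?w = "act ((1 + poly_x) ^ (p ^ m)) v"
  have "\<pi> \<odot>\<^bsub>M\<^esub> ?w = \<pi> \<odot>\<^bsub>M\<^esub> v"
    using assms by (simp add: fixed_iff act_smult_right)
  then have "\<pi> \<odot>\<^bsub>M\<^esub> (?w \<ominus>\<^bsub>M\<^esub> v) = \<zero>\<^bsub>M\<^esub>"
    using assms by (simp add: a_minus_def smult_r_distr smult_r_minus M.r_neg)
  then have "?w \<ominus>\<^bsub>M\<^esub> v = \<zero>\<^bsub>M\<^esub>" using assms by (rule_tac torsion_free) simp_all
  then have "?w = v" using assms M.diff_add_cancel1[of ?w v] by simp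
  then show ?thesis using assms by (simp add: fixed_iff)
qed

text \<open>Let \<open>W = F\<^sub>m\<^sub>+\<^sub>1 / F\<^sub>m\<close>, where \<open>F\<^sub>m\<close> denotes \<open>fixed m\<close>, and let \<open>\<Phi> = x ^ d + p (1 + x c)\<close> be the
  cyclotomic polynomial of order \<open>p ^ (m + 1)\<close>. The statement is that on \<open>W / pW\<close> the kernel of \<open>x\<close>
  is contained in the image of \<open>x ^ (d - 1)\<close>. Indeed \<open>\<Phi>\<close> is zero on \<open>W\<close>, and \<open>W\<close> is torsion-free, so
  \<open>x\<close> is injective on \<open>W\<close>: if \<open>x u = 0\<close> then \<open>0 = \<Phi> u = p u\<close>. If now \<open>x w = p w'\<close>, then multiplying
  by \<open>1 + x c\<close> and using \<open>\<Phi> w' = 0\<close> gives \<open>x ((1 + x c) w + x ^ (d - 1) w') = 0\<close>; cancel \<open>x\<close>, and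
  note that \<open>(1 + x c) w\<close> differs from \<open>w\<close> by the multiple \<open>c x w = p c w'\<close> of \<open>p\<close>.\<close>

lemma cyclotomic_quotient:
  assumes m: "Suc m \<le> n" and v: "v \<in> carrier M"
    and v1: "act (poly_x ^ (p ^ Suc m)) v \<in> pM" and v2: "act (poly_x ^ Suc (p ^ m)) v \<in> pM"
  shows "\<exists>w\<in>fixed (Suc m). \<exists>f\<in>fixed m. \<exists>z\<in>carrier M.
    v = act (poly_x ^ (p ^ Suc m - p ^ m - 1)) w \<oplus>\<^bsub>M\<^esub> f \<oplus>\<^bsub>M\<^esub> \<pi> \<odot>\<^bsub>M\<^esub> z"
proof -
  define e where "e = p ^ Suc m - p ^ m - 1"
  have p1: "p \<ge> 2" using prime_p by (rule prime_ge_2_nat)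
  have "p ^ m * 2 \<le> p ^ Suc m" using p1 by simp
  moreover have "p ^ m \<ge> 1" using p1 by simp
  ultimately have e: "p ^ Suc m - p ^ m = Suc e" unfolding e_def by linarith
  define \<Phi> where "\<Phi> = (\<Sum>i<p. ((1 + poly_x) ^ (p ^ m)) ^ i)"
  obtain c where c: "\<Phi> = poly_x ^ Suc e + of_nat p * (1 + poly_x * c)"
    unfolding \<Phi>_def e[symmetric] using cyclotomic_prime_power[OF prime_p] by blast
  define U where "U = 1 + poly_x * c"
  have geo: "y * (\<Sum>i<k. y ^ i) + 1 = (\<Sum>i<k. y ^ i) + y ^ k" for k and y :: "int poly"
    by (induction k) (auto simp: algebra_simps)
  have "(1 + poly_x) ^ (p ^ Suc m) = ((1 + poly_x) ^ (p ^ m)) ^ p"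
    by (simp only: power_mult[symmetric] power_Suc mult.commute)
  then have cyc: "(1 + poly_x) ^ (p ^ m) * \<Phi> + 1 = \<Phi> + (1 + poly_x) ^ (p ^ Suc m)"
    unfolding \<Phi>_def using geo by simp
  have norm: "act \<Phi> u \<in> fixed m" if u: "u \<in> fixed (Suc m)" for u
  proof -
    have uM: "u \<in> carrier M" using u by (simp add: fixed_def)
    have "act ((1 + poly_x) ^ (p ^ m)) (act \<Phi> u) \<oplus>\<^bsub>M\<^esub> u = act \<Phi> u \<oplus>\<^bsub>M\<^esub> u"
      using arg_cong[OF cyc, of "\<lambda>f. act f u"] uM u
      by (simp only: act_add act_mult act_1 fixed_iff)
    then show ?thesis using uM by (simp add: fixed_iff)
  qed
  note S = submoduleD[OF fixed_submodule]
  \<comment> \<open>replace \<open>v\<close> by a fixed vector \<open>w\<close>, for which \<open>x w = p w'\<close> modulo \<open>fixed m\<close>\<close>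
  obtain w z where w: "w \<in> fixed (Suc m)" and z: "z \<in> carrier M" and vw: "v = w \<oplus>\<^bsub>M\<^esub> \<pi> \<odot>\<^bsub>M\<^esub> z"
    using lift[OF m v v1] by blast
  have wM: "w \<in> carrier M" using w S by blast
  have "act (poly_x ^ Suc (p ^ m)) w \<in> pM"
  proof -
    have "act (poly_x ^ Suc (p ^ m)) v \<ominus>\<^bsub>M\<^esub> act (poly_x ^ Suc (p ^ m)) (\<pi> \<odot>\<^bsub>M\<^esub> z) \<in> pM"
      using v2 z by (intro submoduleD(4)[OF pM_submodule]) (auto simp: act_pM pM_I)
    moreover have "act (poly_x ^ Suc (p ^ m)) v
        = act (poly_x ^ Suc (p ^ m)) w \<oplus>\<^bsub>M\<^esub> act (poly_x ^ Suc (p ^ m)) (\<pi> \<odot>\<^bsub>M\<^esub> z)"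
      unfolding vw using wM z by (intro act_add_right) auto
    ultimately show ?thesis using wM z by (simp only: M.add_diff_cancel_right1 act_closed smult_closed pi_closed)
  qed
  then have "act (poly_x ^ (p ^ m)) (act poly_x w) \<in> pM"
    using wM by (simp only: act_mult[symmetric] power_Suc2)
  from lift[OF _ _ this] m wM obtain f w' where f: "f \<in> fixed m" and w'M: "w' \<in> carrier M"
    and xw: "act poly_x w = f \<oplus>\<^bsub>M\<^esub> \<pi> \<odot>\<^bsub>M\<^esub> w'" by auto
  have fM: "f \<in> carrier M" and f': "f \<in> fixed (Suc m)" using f S fixed_mono[of m "Suc m"] by auto
  have "act poly_x w \<ominus>\<^bsub>M\<^esub> f \<in> fixed (Suc m)" using S(4)[OF act_fixed[OF w] f'] .
  then have "\<pi> \<odot>\<^bsub>M\<^esub> w' \<in> fixed (Suc m)"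
    unfolding xw using fM w'M by (simp add: M.add_diff_cancel_left1)
  then have w': "w' \<in> fixed (Suc m)" using w'M by (rule pi_smult_fixed[rotated])
  define u where "u = act U w \<oplus>\<^bsub>M\<^esub> act (poly_x ^ e) w'"
  have u: "u \<in> fixed (Suc m)" unfolding u_def using S(3)[OF act_fixed[OF w] act_fixed[OF w']] .
  then have uM: "u \<in> carrier M" using S by blast
  have xu: "act poly_x u \<in> fixed m"
  proof -
    have "act poly_x u = act U (act poly_x w) \<oplus>\<^bsub>M\<^esub> act (poly_x ^ Suc e) w'"
      unfolding u_def using wM w'M by (simp only: act_add_right act_closed act_commute[of w U] act_mult power_Suc)
    also have "act U (act poly_x w) = act U f \<oplus>\<^bsub>M\<^esub> act (of_nat p * U) w'"
      unfolding xw using fM w'M by (simp only: act_add_right smult_closed pi_closed act_smult_right act_mult act_of_nat_p act_closed)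
    also have "act U f \<oplus>\<^bsub>M\<^esub> act (of_nat p * U) w' \<oplus>\<^bsub>M\<^esub> act (poly_x ^ Suc e) w' = act U f \<oplus>\<^bsub>M\<^esub> act \<Phi> w'"
      unfolding c U_def[symmetric] using fM w'M by (simp only: act_add act_closed M.a_assoc M.a_comm)
    finally show ?thesis using S(3)[OF act_fixed[OF f] norm[OF w']] by simp
  qed
  \<comment> \<open>\<open>x\<close> is injective on the quotient by \<open>fixed m\<close>, as \<open>\<Phi>\<close> vanishes there and has constant term \<open>p\<close>\<close>
  have "\<Phi> = (poly_x ^ e + of_nat p * c) * poly_x + of_nat p"
    unfolding c by (simp add: algebra_simps)
  then have "act \<Phi> u = act (poly_x ^ e + of_nat p * c) (act poly_x u) \<oplus>\<^bsub>M\<^esub> \<pi> \<odot>\<^bsub>M\<^esub> u"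
    using uM by (simp only: act_add[of u] act_mult[of u] act_of_nat_p)
  moreover have "act \<Phi> u \<ominus>\<^bsub>M\<^esub> act (poly_x ^ e + of_nat p * c) (act poly_x u) \<in> fixed m"
    using S(4)[OF norm[OF u] act_fixed[OF xu]] .
  ultimately have "\<pi> \<odot>\<^bsub>M\<^esub> u \<in> fixed m"
    using uM by (simp only: M.add_diff_cancel_left1 act_closed smult_closed pi_closed)
  then have uf: "u \<in> fixed m" using uM by (rule pi_smult_fixed[rotated])
  let ?nw = "act (- 1) w'" and ?f = "u \<oplus>\<^bsub>M\<^esub> act (- c) f" and ?z = "act (- c) w' \<oplus>\<^bsub>M\<^esub> z"
  have "act (- c) (act poly_x w) = act (- c) f \<oplus>\<^bsub>M\<^esub> \<pi> \<odot>\<^bsub>M\<^esub> act (- c) w'"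
    unfolding xw using fM w'M by (simp only: act_add_right smult_closed pi_closed act_smult_right)
  moreover have "w = u \<oplus>\<^bsub>M\<^esub> act (poly_x ^ e) ?nw \<oplus>\<^bsub>M\<^esub> act (- c) (act poly_x w)"
  proof -
    have "u \<oplus>\<^bsub>M\<^esub> act (poly_x ^ e) ?nw \<oplus>\<^bsub>M\<^esub> act (- c) (act poly_x w)
        = (act U w \<oplus>\<^bsub>M\<^esub> act (- c * poly_x) w) \<oplus>\<^bsub>M\<^esub> (act (poly_x ^ e) w' \<oplus>\<^bsub>M\<^esub> act (poly_x ^ e * - 1) w')"
      unfolding u_def using wM w'M by (simp only: act_mult act_closed M.a_ac M.a_closed)
    also have "\<dots> = act (U + - c * poly_x) w \<oplus>\<^bsub>M\<^esub> act (poly_x ^ e + poly_x ^ e * - 1) w'"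
      using wM w'M by (simp only: act_add)
    also have "U + - c * poly_x = 1" by (simp add: U_def)
    also have "poly_x ^ e + poly_x ^ e * - 1 = 0" by simp
    finally show ?thesis using wM by simp
  qed
  ultimately have "w = u \<oplus>\<^bsub>M\<^esub> act (poly_x ^ e) ?nw \<oplus>\<^bsub>M\<^esub> (act (- c) f \<oplus>\<^bsub>M\<^esub> \<pi> \<odot>\<^bsub>M\<^esub> act (- c) w')"
    by simp
  then have "v = u \<oplus>\<^bsub>M\<^esub> act (poly_x ^ e) ?nw \<oplus>\<^bsub>M\<^esub> (act (- c) f \<oplus>\<^bsub>M\<^esub> \<pi> \<odot>\<^bsub>M\<^esub> act (- c) w') \<oplus>\<^bsub>M\<^esub> \<pi> \<odot>\<^bsub>M\<^esub> z"
    using vw by simp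
  also have "\<dots> = act (poly_x ^ e) ?nw \<oplus>\<^bsub>M\<^esub> ?f \<oplus>\<^bsub>M\<^esub> \<pi> \<odot>\<^bsub>M\<^esub> ?z"
    using uM w'M fM z by (simp add: smult_r_distr M.a_ac)
  finally show ?thesis unfolding e_def[symmetric]
    using act_fixed[OF w', of "- 1"] S(3)[OF uf act_fixed[OF f]] w'M z by (metis M.a_closed act_closed)
qed

text \<open>Modulo \<open>p\<close> this is the space of those vectors that end a Jordan chain of length
  \<open>p ^ m\<close> for \<open>x\<close>, the preimage in \<open>M\<close> being taken so that no quotient has to be formed.\<close>

definition socle_layer :: "nat \<Rightarrow> 'c set" where
  "socle_layer m = {v. \<exists>w\<in>fixed m. \<exists>z\<in>carrier M. v = act (poly_x ^ (p ^ m - 1)) w \<oplus>\<^bsub>M\<^esub> \<pi> \<odot>\<^bsub>M\<^esub> z}"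

lemma image_plus_pM_submodule:
  assumes Q: "submodule Q R M"
  shows "submodule {v. \<exists>w\<in>Q. \<exists>z\<in>carrier M. v = act f w \<oplus>\<^bsub>M\<^esub> \<pi> \<odot>\<^bsub>M\<^esub> z} R M" (is "submodule ?H R M")
proof (rule submodule_intro)
  note Q = submoduleD[OF Q]
  show "?H \<subseteq> carrier M" using Q by auto
  have "\<zero>\<^bsub>M\<^esub> = act f \<zero>\<^bsub>M\<^esub> \<oplus>\<^bsub>M\<^esub> \<pi> \<odot>\<^bsub>M\<^esub> \<zero>\<^bsub>M\<^esub>"
    using act_smult_right[of "\<zero>\<^bsub>M\<^esub>" \<zero> f] by simp
  then show "\<zero>\<^bsub>M\<^esub> \<in> ?H" using Q(2) by blast
  show "a \<oplus>\<^bsub>M\<^esub> b \<in> ?H" if ab: "a \<in> ?H" "b \<in> ?H" for a b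
  proof -
    obtain w z w' z' where *: "w \<in> Q" "z \<in> carrier M" "a = act f w \<oplus>\<^bsub>M\<^esub> \<pi> \<odot>\<^bsub>M\<^esub> z"
      "w' \<in> Q" "z' \<in> carrier M" "b = act f w' \<oplus>\<^bsub>M\<^esub> \<pi> \<odot>\<^bsub>M\<^esub> z'" using ab by blast
    have "a \<oplus>\<^bsub>M\<^esub> b = act f (w \<oplus>\<^bsub>M\<^esub> w') \<oplus>\<^bsub>M\<^esub> \<pi> \<odot>\<^bsub>M\<^esub> (z \<oplus>\<^bsub>M\<^esub> z')"
      using * Q(1) by (simp add: act_add_right smult_r_distr M.a_ac)
    then show ?thesis using * Q(3) by blast
  qed
  show "r \<odot>\<^bsub>M\<^esub> a \<in> ?H" if ra: "r \<in> carrier R" "a \<in> ?H" for r a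
  proof -
    obtain w z where *: "w \<in> Q" "z \<in> carrier M" "a = act f w \<oplus>\<^bsub>M\<^esub> \<pi> \<odot>\<^bsub>M\<^esub> z"
      using ra by blast
    have "r \<odot>\<^bsub>M\<^esub> a = act f (r \<odot>\<^bsub>M\<^esub> w) \<oplus>\<^bsub>M\<^esub> \<pi> \<odot>\<^bsub>M\<^esub> (r \<odot>\<^bsub>M\<^esub> z)"
      using * ra Q(1) by (simp add: act_smult_right smult_r_distr smult_assoc1[symmetric] m_comm)
    then show ?thesis using * ra Q(5) by blast
  qed
qed

lemma socle_layer_submodule: "submodule (socle_layer m) R M"
  unfolding socle_layer_def by (rule image_plus_pM_submodule[OF fixed_submodule])

text \<open>The top of the longer chain, multiplied by \<open>x ^ (p ^ (m + 1) - p ^ m)\<close>, is the top of a chain of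
  length \<open>p ^ m\<close> with the same end; by \<open>lift\<close> it may be replaced by a fixed vector.\<close>

lemma socle_layer_Suc:
  assumes m: "m < n"
  shows "socle_layer (Suc m) \<subseteq> socle_layer m"
proof
  fix v assume "v \<in> socle_layer (Suc m)"
  then obtain w z where w: "w \<in> fixed (Suc m)" and z: "z \<in> carrier M"
    and v: "v = act (poly_x ^ (p ^ Suc m - 1)) w \<oplus>\<^bsub>M\<^esub> \<pi> \<odot>\<^bsub>M\<^esub> z"
    by (auto simp: socle_layer_def)
  have wM: "w \<in> carrier M" using w by (simp add: fixed_def)
  have p1: "p \<ge> 2" using prime_p by (rule prime_ge_2_nat)
  have ge: "p ^ m \<ge> 1" "p ^ m \<le> p ^ Suc m" using p1 by auto
  let ?e = "p ^ Suc m - p ^ m"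
  have "act (poly_x ^ (p ^ m)) (act (poly_x ^ ?e) w) = act (poly_x ^ (p ^ Suc m)) w"
    using wM ge by (simp only: act_mult[symmetric] power_add[symmetric]) simp
  also have "\<dots> \<in> pM" using w by (rule fixed_x_power)
  finally obtain w' z' where w': "w' \<in> fixed m" and z': "z' \<in> carrier M"
    and xw: "act (poly_x ^ ?e) w = w' \<oplus>\<^bsub>M\<^esub> \<pi> \<odot>\<^bsub>M\<^esub> z'"
    using lift[of m "act (poly_x ^ ?e) w"] m wM by auto
  have w'M: "w' \<in> carrier M" using w' by (simp add: fixed_def)
  have "p ^ Suc m - 1 = (p ^ m - 1) + ?e" using ge by linarith
  then have "act (poly_x ^ (p ^ Suc m - 1)) w = act (poly_x ^ (p ^ m - 1)) (act (poly_x ^ ?e) w)"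
    using wM by (simp only: act_mult[symmetric] power_add)
  also have "\<dots> = act (poly_x ^ (p ^ m - 1)) w' \<oplus>\<^bsub>M\<^esub> \<pi> \<odot>\<^bsub>M\<^esub> act (poly_x ^ (p ^ m - 1)) z'"
    unfolding xw using w'M z' by (simp add: act_add_right act_smult_right)
  finally have "v = act (poly_x ^ (p ^ m - 1)) w' \<oplus>\<^bsub>M\<^esub> \<pi> \<odot>\<^bsub>M\<^esub> (act (poly_x ^ (p ^ m - 1)) z' \<oplus>\<^bsub>M\<^esub> z)"
    unfolding v using w'M z z' by (simp add: smult_r_distr M.a_assoc)
  then show "v \<in> socle_layer m" unfolding socle_layer_def
    using w' z z' by (metis (mono_tags, lifting) M.a_closed act_closed mem_Collect_eq)
qed

lemma socle_layer_antimono: "m \<le> k \<Longrightarrow> k \<le> n \<Longrightarrow> socle_layer k \<subseteq> socle_layer m"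
proof (induction k rule: dec_induct)
  case (step k)
  then show ?case using socle_layer_Suc[of k] by auto
qed simp

text \<open>A chain whose length \<open>t + 1\<close> exceeds \<open>p ^ k\<close> can be prolonged to length \<open>p ^ (k + 1)\<close> without
  changing its end. This is \<open>cyclotomic_quotient\<close>, applied to the member of the chain which
  \<open>x ^ (p ^ k)\<close> sends to the end: it agrees with an element of the image of \<open>x ^ (d - 1)\<close>, where
  \<open>d = p ^ (k + 1) - p ^ k\<close>, up to terms that \<open>x ^ (p ^ k)\<close> annihilates modulo \<open>p\<close>.\<close>

lemma socle_layerI:
  assumes m: "m \<le> n" and t: "t < p ^ m" "\<And>k. m = Suc k \<Longrightarrow> p ^ k \<le> t"
    and v: "v \<in> carrier M" "act (poly_x ^ Suc t) v \<in> pM"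
  shows "act (poly_x ^ t) v \<in> socle_layer m"
proof (cases m)
  case 0
  then have "t = 0" using t by simp
  then have "act (poly_x ^ (p ^ 0)) v \<in> pM" using v by simp
  then obtain w z where "w \<in> fixed 0" "z \<in> carrier M" "v = w \<oplus>\<^bsub>M\<^esub> \<pi> \<odot>\<^bsub>M\<^esub> z"
    using lift[of 0 v] v(1) by auto
  moreover from this have "w \<in> carrier M" by (simp add: fixed_def)
  ultimately have "act (poly_x ^ t) v = act (poly_x ^ (p ^ 0 - 1)) w \<oplus>\<^bsub>M\<^esub> \<pi> \<odot>\<^bsub>M\<^esub> z"
    using \<open>t = 0\<close> v(1) by simp
  then show ?thesis unfolding socle_layer_def 0 using \<open>w \<in> fixed 0\<close> \<open>z \<in> carrier M\<close> by blast
next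
  case (Suc k)
  note t2 = t(2)[OF Suc]
  have p1: "p \<ge> 2" using prime_p by (rule prime_ge_2_nat)
  have ge: "p ^ k \<ge> 1" "p ^ k * 2 \<le> p ^ Suc k" using p1 by auto
  define v' where "v' = act (poly_x ^ (t - p ^ k)) v"
  have v': "v' \<in> carrier M" using v by (simp add: v'_def)
  have low: "act (poly_x ^ Suc (p ^ k)) v' = act (poly_x ^ Suc t) v"
    unfolding v'_def using v t2 by (simp only: act_mult[symmetric] power_add[symmetric]) simp
  have "p ^ Suc k = (p ^ Suc k - Suc (p ^ k)) + Suc (p ^ k)" using ge by linarith
  then have "act (poly_x ^ (p ^ Suc k)) v' = act (poly_x ^ (p ^ Suc k - Suc (p ^ k))) (act (poly_x ^ Suc (p ^ k)) v')"
    using v' by (simp only: act_mult[symmetric] power_add[symmetric])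
  also have "\<dots> \<in> pM" unfolding low using v(2) by (rule act_pM)
  finally obtain w f z where *: "w \<in> fixed (Suc k)" "f \<in> fixed k" "z \<in> carrier M"
    "v' = act (poly_x ^ (p ^ Suc k - p ^ k - 1)) w \<oplus>\<^bsub>M\<^esub> f \<oplus>\<^bsub>M\<^esub> \<pi> \<odot>\<^bsub>M\<^esub> z"
    using cyclotomic_quotient[of k v'] v' m Suc low v(2) by auto
  have M: "w \<in> carrier M" "f \<in> carrier M" using * by (auto simp: fixed_def)
  obtain z' where z': "z' \<in> carrier M" "act (poly_x ^ (p ^ k)) f = \<pi> \<odot>\<^bsub>M\<^esub> z'"
    using fixed_x_power[OF *(2)] by (auto simp: pM_iff)
  have "act (poly_x ^ t) v = act (poly_x ^ (p ^ k)) v'"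
    unfolding v'_def using v t2 by (simp only: act_mult[symmetric] power_add[symmetric]) simp
  also have "\<dots> = act (poly_x ^ (p ^ k) * poly_x ^ (p ^ Suc k - p ^ k - 1)) w \<oplus>\<^bsub>M\<^esub>
      act (poly_x ^ (p ^ k)) f \<oplus>\<^bsub>M\<^esub> \<pi> \<odot>\<^bsub>M\<^esub> act (poly_x ^ (p ^ k)) z"
    unfolding *(4) using M *(3) by (simp only: act_add_right act_mult act_smult_right act_closed smult_closed pi_closed M.a_closed)
  also have "poly_x ^ (p ^ k) * poly_x ^ (p ^ Suc k - p ^ k - 1) = poly_x ^ (p ^ Suc k - 1)"
    unfolding power_add[symmetric] by (rule arg_cong[of _ _ "\<lambda>k. poly_x ^ k"]) (use ge in linarith)
  finally have "act (poly_x ^ t) v = act (poly_x ^ (p ^ Suc k - 1)) w \<oplus>\<^bsub>M\<^esub>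
      \<pi> \<odot>\<^bsub>M\<^esub> (z' \<oplus>\<^bsub>M\<^esub> act (poly_x ^ (p ^ k)) z)"
    unfolding z'(2) using M z' *(3) by (simp add: smult_r_distr M.a_assoc)
  then show ?thesis unfolding socle_layer_def Suc
    using *(1,3) z' by (metis (mono_tags, lifting) M.a_closed act_closed mem_Collect_eq)
qed

text \<open>The basis is built from the smallest layer, \<open>m = n\<close>, downwards, extending it to a basis of the
  next layer at each step; after \<open>j\<close> steps the layers with \<open>n < m + j\<close> are done.\<close>

lemma socle_basis:
  "\<exists>B. finite B \<and> B \<subseteq> socle_layer 0 \<and> p_independent B \<and>
     (\<forall>m\<le>n. socle_layer m \<subseteq> module_span R M ((B \<inter> socle_layer m) \<union> pM))"
proof -
  have "\<exists>B. finite B \<and> p_independent B \<and> (\<forall>m\<le>n. m + j \<le> Suc n \<longrightarrow> B \<subseteq> socle_layer m) \<and>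
     (\<forall>m\<le>n. Suc n \<le> m + j \<longrightarrow> socle_layer m \<subseteq> module_span R M ((B \<inter> socle_layer m) \<union> pM))"
    if "j \<le> Suc n" for j
    using that
  proof (induction j)
    case 0
    show ?case by (rule exI[of _ "{}"]) (auto simp: p_independent_def)
  next
    case (Suc j)
    define k where "k = n - j"
    have k: "k \<le> n" "k + j = n" using Suc.prems by (auto simp: k_def)
    obtain B where B: "finite B" "p_independent B" "B \<subseteq> socle_layer k"
      "\<And>m. m \<le> n \<Longrightarrow> Suc n \<le> m + j \<Longrightarrow> socle_layer m \<subseteq> module_span R M ((B \<inter> socle_layer m) \<union> pM)"
      using Suc k by auto
    note S = submoduleD[OF socle_layer_submodule[of k]]
    have Sc: "socle_layer k \<subseteq> carrier M" using S(1) by blast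
    obtain F' where F': "finite F'" "F' \<subseteq> socle_layer k" "socle_layer k = module_span R M F'"
      using finitely_generated_submodule[OF R.principal_domain_axioms fin_gen(1,2) socle_layer_submodule] Sc fin_gen(3)
      by metis
    obtain B' where B': "B \<subseteq> B'" "B' \<subseteq> B \<union> F'" "p_independent B'" "F' \<subseteq> module_span R M (B' \<union> pM)"
      using p_independent_extend[OF F'(1) _ B(1) _ B(2)] F'(2) B(3) Sc by (meson subset_trans)
    have "finite B'" using B' B F' finite_subset[of B' "B \<union> F'"] by auto
    have B'S: "B' \<subseteq> socle_layer k" using B' B F' by blast
    have sub: "B' \<union> pM \<subseteq> carrier M" using B'S Sc submoduleD(1)[OF pM_submodule] by blast
    have "socle_layer m \<subseteq> module_span R M ((B' \<inter> socle_layer m) \<union> pM)" if "m \<le> n" "Suc n \<le> m + Suc j" for m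
    proof (cases "m = k")
      case True
      have "socle_layer k \<subseteq> module_span R M (B' \<union> pM)"
        using F'(3) span_least[OF span_submodule[OF sub] B'(4)] by blast
      then show ?thesis using True B'S by (simp add: inf.absorb1)
    next
      case False
      then have "Suc n \<le> m + j" using that k by linarith
      then show ?thesis using B(4)[of m] that
          module_span_mono[of "(B \<inter> socle_layer m) \<union> pM" "(B' \<inter> socle_layer m) \<union> pM"] B'(1) by blast
    qed
    moreover have "B' \<subseteq> socle_layer m" if "m \<le> n" "m + Suc j \<le> Suc n" for m
      using socle_layer_antimono[of m k] that k B'S by auto
    ultimately show ?case using \<open>finite B'\<close> B'(3) by blast
  qed
  from this[of "Suc n"] show ?thesis by auto
qed

text \<open>Each element \<open>b\<close> of an adapted basis is the end of a chain of the greatest possible length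
  \<open>p ^ e\<close>, whose top \<open>y\<close> is fixed by \<open>T ^ (p ^ e)\<close>; modulo \<open>p\<close>, the sum of the orbit of \<open>y\<close> is \<open>b\<close>. That
  the vectors \<open>y\<close> generate is shown by induction on the power of \<open>x\<close> that annihilates a vector modulo
  \<open>p\<close>: the end of the chain of such a vector is, by \<open>socle_layerI\<close>, a combination of basis elements
  whose own chains are at least as long, so that subtracting suitable members of those chains
  lowers the power.\<close>

theorem permutation_generators:
  "\<exists>(r :: nat) y e. (\<forall>j<r. e j \<le> n \<and> y j \<in> fixed (e j)) \<and>
     (\<forall>c \<in> {..<r} \<rightarrow> carrier R.
        (\<Oplus>\<^bsub>M\<^esub>j\<in>{..<r}. c j \<odot>\<^bsub>M\<^esub> (\<Oplus>\<^bsub>M\<^esub>i\<in>{..<p ^ e j}. (T ^^ i) (y j))) \<in> pM \<longrightarrow>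
        (\<forall>j<r. c j \<notin> Units R)) \<and>
     (\<forall>Q. submodule Q R M \<longrightarrow> pM \<subseteq> Q \<longrightarrow> (\<forall>v\<in>Q. T v \<in> Q) \<longrightarrow> (\<forall>j<r. y j \<in> Q) \<longrightarrow> Q = carrier M)"
proof -
  obtain B where B: "finite B" "B \<subseteq> socle_layer 0" "p_independent B"
    and span: "\<And>m. m \<le> n \<Longrightarrow> socle_layer m \<subseteq> module_span R M ((B \<inter> socle_layer m) \<union> pM)"
    using socle_basis by blast
  have BM: "B \<subseteq> carrier M" using B submoduleD(1)[OF socle_layer_submodule] by blast
  obtain h where "bij_betw h {0..<card B} B" using ex_bij_betw_nat_finite[OF B(1)] by blast
  moreover define r where "r = card B"
  ultimately have h: "bij_betw h {..<r} B" by (simp add: atLeast0LessThan)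
  have hB: "h j \<in> B" if "j < r" for j using bij_betwE[OF h] that by auto
  define e where "e j = Max {m. m \<le> n \<and> h j \<in> socle_layer m}" for j
  have fin: "finite {m. m \<le> n \<and> h j \<in> socle_layer m}" for j
    by (rule finite_subset[of _ "{..n}"]) auto
  have ej: "e j \<le> n" "h j \<in> socle_layer (e j)" if "j < r" for j
  proof -
    have "{m. m \<le> n \<and> h j \<in> socle_layer m} \<noteq> {}" using hB[OF that] B by blast
    from Max_in[OF fin this] show "e j \<le> n" "h j \<in> socle_layer (e j)" by (auto simp: e_def)
  qed
  have e_max: "m \<le> e j" if "m \<le> n" "h j \<in> socle_layer m" for m j
    unfolding e_def by (rule Max_ge[OF fin]) (use that in simp)
  have "\<forall>j. \<exists>w. j < r \<longrightarrow> w \<in> fixed (e j) \<and> (\<exists>z\<in>carrier M. h j = act (poly_x ^ (p ^ e j - 1)) w \<oplus>\<^bsub>M\<^esub> \<pi> \<odot>\<^bsub>M\<^esub> z)"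
    using ej(2) unfolding socle_layer_def by blast
  from choice[OF this] obtain y where y: "\<And>j. j < r \<Longrightarrow> y j \<in> fixed (e j)"
    and yz: "\<And>j. j < r \<Longrightarrow> \<exists>z\<in>carrier M. h j = act (poly_x ^ (p ^ e j - 1)) (y j) \<oplus>\<^bsub>M\<^esub> \<pi> \<odot>\<^bsub>M\<^esub> z"
    by auto
  have yM: "y j \<in> carrier M" if "j < r" for j using y[OF that] by (simp add: fixed_def)
  have "\<forall>j. \<exists>z. j < r \<longrightarrow> z \<in> carrier M \<and> h j = act (poly_x ^ (p ^ e j - 1)) (y j) \<oplus>\<^bsub>M\<^esub> \<pi> \<odot>\<^bsub>M\<^esub> z"
    using yz by blast
  from choice[OF this] obtain z1 where z1: "\<And>j. j < r \<Longrightarrow> z1 j \<in> carrier M"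
    "\<And>j. j < r \<Longrightarrow> h j = act (poly_x ^ (p ^ e j - 1)) (y j) \<oplus>\<^bsub>M\<^esub> \<pi> \<odot>\<^bsub>M\<^esub> z1 j" by auto
  have "\<forall>j. \<exists>z. j < r \<longrightarrow> z \<in> carrier M \<and> (\<Oplus>\<^bsub>M\<^esub>i\<in>{..<p ^ e j}. (T ^^ i) (y j)) = act (poly_x ^ (p ^ e j - 1)) (y j) \<oplus>\<^bsub>M\<^esub> \<pi> \<odot>\<^bsub>M\<^esub> z"
    using norm_cong yM by blast
  from choice[OF this] obtain z2 where z2: "\<And>j. j < r \<Longrightarrow> z2 j \<in> carrier M"
    "\<And>j. j < r \<Longrightarrow> (\<Oplus>\<^bsub>M\<^esub>i\<in>{..<p ^ e j}. (T ^^ i) (y j)) = act (poly_x ^ (p ^ e j - 1)) (y j) \<oplus>\<^bsub>M\<^esub> \<pi> \<odot>\<^bsub>M\<^esub> z2 j" by auto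
  have indep: "c j \<notin> Units R"
    if c: "c \<in> {..<r} \<rightarrow> carrier R" and j: "j < r"
      and sum: "(\<Oplus>\<^bsub>M\<^esub>j\<in>{..<r}. c j \<odot>\<^bsub>M\<^esub> (\<Oplus>\<^bsub>M\<^esub>i\<in>{..<p ^ e j}. (T ^^ i) (y j))) \<in> pM" for c j
  proof -
    have "(\<Oplus>\<^bsub>M\<^esub>j\<in>{..<r}. c j \<odot>\<^bsub>M\<^esub> act (poly_x ^ (p ^ e j - 1)) (y j)) \<in> pM"
      using sum lincomb_pM_cong[of "{..<r}" c "\<lambda>j. act (poly_x ^ (p ^ e j - 1)) (y j)" z2
          "\<lambda>j. \<Oplus>\<^bsub>M\<^esub>i\<in>{..<p ^ e j}. (T ^^ i) (y j)"] c yM z2 by auto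
    then have "(\<Oplus>\<^bsub>M\<^esub>j\<in>{..<r}. c j \<odot>\<^bsub>M\<^esub> h j) \<in> pM"
      using lincomb_pM_cong[of "{..<r}" c "\<lambda>j. act (poly_x ^ (p ^ e j - 1)) (y j)" z1 h] c yM z1 by auto
    moreover define c' where "c' b = c (inv_into {..<r} h b)" for b
    have c'h: "c' (h j) = c j" if "j < r" for j
      unfolding c'_def using h that by (simp add: bij_betw_def)
    have c'B: "c' \<in> B \<rightarrow> carrier R"
      unfolding c'_def using bij_betw_apply[OF bij_betw_inv_into[OF h]] c by (auto simp: Pi_def)
    have "(\<Oplus>\<^bsub>M\<^esub>b\<in>h ` {..<r}. c' b \<odot>\<^bsub>M\<^esub> b) = (\<Oplus>\<^bsub>M\<^esub>j\<in>{..<r}. c' (h j) \<odot>\<^bsub>M\<^esub> h j)"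
      using h c'B BM by (intro M.add.finprod_reindex) (auto simp: bij_betw_def Pi_def)
    moreover have "\<dots> = (\<Oplus>\<^bsub>M\<^esub>j\<in>{..<r}. c j \<odot>\<^bsub>M\<^esub> h j)"
      using c hB BM by (intro M.finsum_cong') (auto simp: c'h)
    ultimately have "(\<Oplus>\<^bsub>M\<^esub>b\<in>B. c' b \<odot>\<^bsub>M\<^esub> b) \<in> pM" using h by (simp add: bij_betw_def)
    then show ?thesis using B(3) c'B hB[OF j] c'h[OF j] by (force simp: p_independent_def)
  qed
  have gen: "Q = carrier M"
    if Q: "submodule Q R M" "pM \<subseteq> Q" "\<forall>v\<in>Q. T v \<in> Q" "\<forall>j<r. y j \<in> Q" for Q
  proof -
    note QD = submoduleD[OF Q(1)]
    have QA: "act f v \<in> Q" if "v \<in> Q" for f v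
      using act_submodule_closed[OF Q(1)] Q(3) that by blast
    have main: "v \<in> Q" if "t \<le> p ^ n" "v \<in> carrier M" "act (poly_x ^ t) v \<in> pM" for t v
      using that
    proof (induction t arbitrary: v)
      case 0
      then show ?case using Q(2) by auto
    next
      case (Suc t)
      \<comment> \<open>the smallest layer that contains the end of this chain\<close>
      define m where "m = (LEAST m. Suc t \<le> p ^ m)"
      have tm: "Suc t \<le> p ^ m" unfolding m_def by (rule LeastI[of _ n]) (use Suc.prems in simp)
      have mn: "m \<le> n" unfolding m_def by (rule Least_le) (use Suc.prems in simp)
      have mk: "p ^ k \<le> t" if "m = Suc k" for k
        using not_less_Least[of k "\<lambda>m. Suc t \<le> p ^ m"] that by (simp add: m_def)
      define H where "H = {v. \<exists>w\<in>Q. \<exists>z\<in>carrier M. v = act (poly_x ^ t) w \<oplus>\<^bsub>M\<^esub> \<pi> \<odot>\<^bsub>M\<^esub> z}"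
      have H: "submodule H R M" unfolding H_def by (rule image_plus_pM_submodule[OF Q(1)])
      have "B \<inter> socle_layer m \<subseteq> H"
      proof
        fix b assume b: "b \<in> B \<inter> socle_layer m"
        then obtain j where j: "j < r" "b = h j" using h by (auto simp: bij_betw_def)
        then have "m \<le> e j" using b mn e_max by blast
        then have "p ^ m \<le> p ^ e j" using prime_gt_0_nat[OF prime_p] by (intro power_increasing) auto
        then have "p ^ e j - 1 = t + (p ^ e j - Suc t)" using tm by linarith
        then have "b = act (poly_x ^ t) (act (poly_x ^ (p ^ e j - Suc t)) (y j)) \<oplus>\<^bsub>M\<^esub> \<pi> \<odot>\<^bsub>M\<^esub> z1 j"
          using z1(2)[OF j(1)] j(2) yM[OF j(1)] by (simp only: act_mult[symmetric] power_add)
        then show "b \<in> H" unfolding H_def using QA Q(4) z1(1) j(1) by blast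
      qed
      moreover have "pM \<subseteq> H"
      proof
        fix b assume "b \<in> pM"
        then obtain z where z: "z \<in> carrier M" "b = \<pi> \<odot>\<^bsub>M\<^esub> z" by (auto simp: pM_iff)
        have "act (poly_x ^ t) \<zero>\<^bsub>M\<^esub> = \<zero>\<^bsub>M\<^esub>"
          using act_smult_right[of "\<zero>\<^bsub>M\<^esub>" \<zero> "poly_x ^ t"] by simp
        then have "b = act (poly_x ^ t) \<zero>\<^bsub>M\<^esub> \<oplus>\<^bsub>M\<^esub> \<pi> \<odot>\<^bsub>M\<^esub> z" using z by simp
        then show "b \<in> H" unfolding H_def using z(1) QD(2) by blast
      qed
      ultimately have "module_span R M ((B \<inter> socle_layer m) \<union> pM) \<subseteq> H"
        by (intro subsetI) (rule span_least[OF H], auto)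
      moreover have "act (poly_x ^ t) v \<in> socle_layer m"
        by (rule socle_layerI[OF mn _ mk Suc.prems(2,3)]) (use tm in simp)
      ultimately have "act (poly_x ^ t) v \<in> H" using span[OF mn] by blast
      then obtain u z where uz: "u \<in> Q" "z \<in> carrier M" "act (poly_x ^ t) v = act (poly_x ^ t) u \<oplus>\<^bsub>M\<^esub> \<pi> \<odot>\<^bsub>M\<^esub> z"
        unfolding H_def by blast
      have uM: "u \<in> carrier M" using uz QD by blast
      have d: "v \<ominus>\<^bsub>M\<^esub> u \<oplus>\<^bsub>M\<^esub> u = v" using Suc.prems uM by (simp add: M.diff_add_cancel1)
      then have "act (poly_x ^ t) (v \<ominus>\<^bsub>M\<^esub> u) \<oplus>\<^bsub>M\<^esub> act (poly_x ^ t) u = \<pi> \<odot>\<^bsub>M\<^esub> z \<oplus>\<^bsub>M\<^esub> act (poly_x ^ t) u"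
        using uz uM Suc.prems act_add_right[of "v \<ominus>\<^bsub>M\<^esub> u" u "poly_x ^ t"] by (simp add: M.a_comm)
      then have "act (poly_x ^ t) (v \<ominus>\<^bsub>M\<^esub> u) = \<pi> \<odot>\<^bsub>M\<^esub> z"
        using uM Suc.prems uz by simp
      then have "act (poly_x ^ t) (v \<ominus>\<^bsub>M\<^esub> u) \<in> pM" using uz by (simp add: pM_I)
      then have "v \<ominus>\<^bsub>M\<^esub> u \<in> Q" using Suc uM by (intro Suc.IH) auto
      then show ?case using QD(3)[OF _ uz(1)] d by metis
    qed
    have "v \<in> Q" if "v \<in> carrier M" for v
      using main[of "p ^ n" v] that fixed_x_power[of v n] period by (simp add: fixed_def)
    then show ?thesis using QD(1) by blast
  qed
  show ?thesis
  proof (rule exI[of _ r], rule exI[of _ y], rule exI[of _ e], intro conjI)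
    show "\<forall>j<r. e j \<le> n \<and> y j \<in> fixed (e j)" using ej y by blast
  qed (use indep gen in \<open>blast+\<close>)
qed

end

section \<open>Group rings and permutation modules\<close>

lemma restrict_scalars_simps [simp]:
  "carrier (restrict_scalars R G M) = carrier M"
  "\<zero>\<^bsub>restrict_scalars R G M\<^esub> = \<zero>\<^bsub>M\<^esub>"
  "x \<oplus>\<^bsub>restrict_scalars R G M\<^esub> y = x \<oplus>\<^bsub>M\<^esub> y"
  "r \<odot>\<^bsub>restrict_scalars R G M\<^esub> x = group_ring_scalar R G r \<odot>\<^bsub>M\<^esub> x"
  by (simp_all add: restrict_scalars_def)

locale finite_group_ring = R?: cring R + G: comm_group G for R (structure) and G +
  assumes fin_G: "finite (carrier G)"
begin

abbreviation "S \<equiv> group_ring R G"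
abbreviation "scalar \<equiv> group_ring_scalar R G"
abbreviation "delta \<equiv> group_ring_elem R G"

lemma S_cring: "cring S"
  by (rule group_ring_cring[OF R.is_cring G.comm_group_axioms fin_G])

lemma scalar_closed: "r \<in> carrier R \<Longrightarrow> scalar r \<in> carrier S"
  by (rule group_ring_scalar_simps(1)[OF R.is_cring G.is_group fin_G])

lemma elem_closed: "h \<in> carrier G \<Longrightarrow> delta h \<in> carrier S"
  by (auto simp: group_ring_elem_def group_ring_def)

lemma group_ring_mult_eval:
  assumes "a \<in> carrier S" "b \<in> carrier S" "x \<in> carrier G"
  shows "(a \<otimes>\<^bsub>S\<^esub> b) x = (\<Oplus>y\<in>carrier G. a y \<otimes> b (inv\<^bsub>G\<^esub> y \<otimes>\<^bsub>G\<^esub> x))"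
  using assms by (simp add: group_ring_def)

lemma scalar_mult_elem:
  assumes r: "r \<in> carrier R" and h: "h \<in> carrier G"
  shows "scalar r \<otimes>\<^bsub>S\<^esub> delta h = (\<lambda>x\<in>carrier G. if x = h then r else \<zero>)"
proof
  fix x
  show "(scalar r \<otimes>\<^bsub>S\<^esub> delta h) x = (\<lambda>x\<in>carrier G. if x = h then r else \<zero>) x"
  proof (cases "x \<in> carrier G")
    case x: True
    have "(\<Oplus>y\<in>carrier G. scalar r y \<otimes> delta h (inv\<^bsub>G\<^esub> y \<otimes>\<^bsub>G\<^esub> x))
      = (\<Oplus>y\<in>carrier G. if \<one>\<^bsub>G\<^esub> = y then r \<otimes> delta h x else \<zero>)"
      using r h x by (intro R.finsum_cong') (auto simp: group_ring_scalar_def group_ring_elem_def)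
    also have "\<dots> = r \<otimes> delta h x"
      using r h x fin_G by (intro R.finsum_singleton) (auto simp: group_ring_elem_def)
    finally show ?thesis
      using x r h group_ring_mult_eval[OF scalar_closed[OF r] elem_closed[OF h] x]
      by (simp add: group_ring_elem_def)
  qed (simp add: group_ring_def)
qed

lemma elem_one: "delta \<one>\<^bsub>G\<^esub> = \<one>\<^bsub>S\<^esub>"
  by (auto simp: group_ring_elem_def group_ring_def)

lemma elem_mult:
  assumes h: "h \<in> carrier G" and k: "k \<in> carrier G"
  shows "delta h \<otimes>\<^bsub>S\<^esub> delta k = delta (h \<otimes>\<^bsub>G\<^esub> k)"
proof
  fix x
  show "(delta h \<otimes>\<^bsub>S\<^esub> delta k) x = delta (h \<otimes>\<^bsub>G\<^esub> k) x"
  proof (cases "x \<in> carrier G")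
    case x: True
    have "(\<Oplus>y\<in>carrier G. delta h y \<otimes> delta k (inv\<^bsub>G\<^esub> y \<otimes>\<^bsub>G\<^esub> x))
      = (\<Oplus>y\<in>carrier G. if h = y then delta k (inv\<^bsub>G\<^esub> h \<otimes>\<^bsub>G\<^esub> x) else \<zero>)"
      using h k x by (intro R.finsum_cong') (auto simp: group_ring_elem_def)
    also have "\<dots> = delta k (inv\<^bsub>G\<^esub> h \<otimes>\<^bsub>G\<^esub> x)"
      using h k x fin_G by (intro R.finsum_singleton) (auto simp: group_ring_elem_def)
    also have "\<dots> = delta (h \<otimes>\<^bsub>G\<^esub> k) x"
      using h k x by (simp add: group_ring_elem_def) (metis G.inv_solve_left)
    finally show ?thesis
      using x group_ring_mult_eval[OF elem_closed[OF h] elem_closed[OF k] x] by simp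
  qed (simp add: group_ring_def group_ring_elem_def)
qed

text \<open>A property of group ring elements that is closed under addition need only be checked on the
  monomials \<open>r \<cdot> h\<close>; hence linearity over the group ring reduces to linearity over \<open>R\<close> and
  \<open>G\<close>-equivariance.\<close>

lemma group_ring_induct:
  assumes a: "a \<in> carrier S"
    and zero: "P \<zero>\<^bsub>S\<^esub>"
    and add: "\<And>a b. a \<in> carrier S \<Longrightarrow> b \<in> carrier S \<Longrightarrow> P a \<Longrightarrow> P b \<Longrightarrow> P (a \<oplus>\<^bsub>S\<^esub> b)"
    and monomial: "\<And>r h. r \<in> carrier R \<Longrightarrow> h \<in> carrier G \<Longrightarrow> P (scalar r \<otimes>\<^bsub>S\<^esub> delta h)"
  shows "P a"
proof -
  have aR: "a x \<in> carrier R" if "x \<in> carrier G" for x using a that by (auto simp: group_ring_def)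
  define cut where "cut A = (\<lambda>x\<in>carrier G. if x \<in> A then a x else \<zero>)" for A
  have cut: "cut A \<in> carrier S" for A using aR by (auto simp: group_ring_def cut_def)
  have "P (cut A)" if "finite A" "A \<subseteq> carrier G" for A
    using that
  proof (induction A)
    case empty
    have "cut {} = \<zero>\<^bsub>S\<^esub>" by (auto simp: group_ring_def cut_def)
    then show ?case using zero by simp
  next
    case (insert h A)
    have h: "h \<in> carrier G" "a h \<in> carrier R" using insert aR by auto
    have t: "scalar (a h) \<otimes>\<^bsub>S\<^esub> delta h \<in> carrier S"
      using h scalar_mult_elem[of "a h" h] by (auto simp: group_ring_def)
    have "scalar (a h) \<otimes>\<^bsub>S\<^esub> delta h \<oplus>\<^bsub>S\<^esub> cut A = cut (insert h A)"
      using insert h aR scalar_mult_elem[of "a h" h] by (auto simp: group_ring_def cut_def fun_eq_iff)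
    then show ?case using add[OF t cut monomial[OF h(2,1)] insert.IH] insert.prems by simp
  qed
  moreover have "cut (carrier G) = a"
    using a by (auto simp: group_ring_def cut_def PiE_iff extensional_def)
  ultimately show ?thesis using fin_G by force
qed

lemma smult_scalar_elem:
  assumes "module S N" "r \<in> carrier R" "h \<in> carrier G" "v \<in> carrier N"
  shows "(scalar r \<otimes>\<^bsub>S\<^esub> delta h) \<odot>\<^bsub>N\<^esub> v = scalar r \<odot>\<^bsub>N\<^esub> (delta h \<odot>\<^bsub>N\<^esub> v)"
  using assms scalar_closed elem_closed by (intro module.smult_assoc1[OF assms(1)]) auto

lemma restrict_module: "module S N \<Longrightarrow> module R (restrict_scalars R G N)"
  by (rule restrict_scalars_module[OF R.is_cring G.is_group fin_G])

lemma elem_smult_hom: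
  assumes N: "module S N" and h: "h \<in> carrier G"
  shows "(\<lambda>v. delta h \<odot>\<^bsub>N\<^esub> v) \<in> module_homs R (restrict_scalars R G N) (restrict_scalars R G N)"
proof -
  interpret N: module S N by fact
  note e = elem_closed[OF h] and s = scalar_closed
  show ?thesis
    by (rule module_homI)
      (use e s in \<open>auto simp: N.smult_r_distr N.smult_assoc1[symmetric] cring.cring_simprules(14)[OF S_cring e]\<close>)
qed

lemma group_ring_homI:
  assumes N: "module S N" and N': "module S N'"
    and f: "f \<in> module_homs R (restrict_scalars R G N) (restrict_scalars R G N')"
    and elem: "\<And>h v. h \<in> carrier G \<Longrightarrow> v \<in> carrier N \<Longrightarrow> f (delta h \<odot>\<^bsub>N\<^esub> v) = delta h \<odot>\<^bsub>N'\<^esub> f v"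
  shows "f \<in> module_homs S N N'"
proof -
  interpret N: module S N by fact
  interpret N': module S N' by fact
  have fc: "f v \<in> carrier N'" if "v \<in> carrier N" for v using module_homD(1)[OF f] that by simp
  have fa: "f (v \<oplus>\<^bsub>N\<^esub> w) = f v \<oplus>\<^bsub>N'\<^esub> f w" if "v \<in> carrier N" "w \<in> carrier N" for v w
    using module_homD(2)[OF f] that by simp
  have fs: "f (scalar r \<odot>\<^bsub>N\<^esub> v) = scalar r \<odot>\<^bsub>N'\<^esub> f v" if "r \<in> carrier R" "v \<in> carrier N" for r v
    using module_homD(3)[OF f] that by simp
  show ?thesis
  proof (rule module_homI)
    show "f (a \<odot>\<^bsub>N\<^esub> v) = a \<odot>\<^bsub>N'\<^esub> f v" if a: "a \<in> carrier S" and v: "v \<in> carrier N" for a v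
      using a
    proof (rule group_ring_induct)
      have "f (\<zero>\<^bsub>S\<^esub> \<odot>\<^bsub>N\<^esub> v) \<oplus>\<^bsub>N'\<^esub> f v = \<zero>\<^bsub>N'\<^esub> \<oplus>\<^bsub>N'\<^esub> f v"
        using v fa[of "\<zero>\<^bsub>S\<^esub> \<odot>\<^bsub>N\<^esub> v" v, symmetric] fc[OF v] by simp
      then show "f (\<zero>\<^bsub>S\<^esub> \<odot>\<^bsub>N\<^esub> v) = \<zero>\<^bsub>S\<^esub> \<odot>\<^bsub>N'\<^esub> f v" using v fc by simp
    next
      fix r h assume rh: "r \<in> carrier R" "h \<in> carrier G"
      then show "f ((scalar r \<otimes>\<^bsub>S\<^esub> delta h) \<odot>\<^bsub>N\<^esub> v) = (scalar r \<otimes>\<^bsub>S\<^esub> delta h) \<odot>\<^bsub>N'\<^esub> f v"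
        using v fc elem elem_closed by (simp add: smult_scalar_elem[OF N] smult_scalar_elem[OF N'] fs)
    next
      fix a b assume "a \<in> carrier S" "b \<in> carrier S"
        "f (a \<odot>\<^bsub>N\<^esub> v) = a \<odot>\<^bsub>N'\<^esub> f v" "f (b \<odot>\<^bsub>N\<^esub> v) = b \<odot>\<^bsub>N'\<^esub> f v"
      then show "f ((a \<oplus>\<^bsub>S\<^esub> b) \<odot>\<^bsub>N\<^esub> v) = (a \<oplus>\<^bsub>S\<^esub> b) \<odot>\<^bsub>N'\<^esub> f v"
        using v fc by (simp add: N.smult_l_distr N'.smult_l_distr fa)
    qed
  qed (use fc fa in auto)
qed

lemma finitely_generated_restrict:
  assumes N: "module S N" and fg: "finitely_generated_module S N"
  shows "\<exists>F. finite F \<and> F \<subseteq> carrier N \<and> carrier N = module_span R (restrict_scalars R G N) F"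
proof -
  interpret N: module S N by fact
  interpret NR: module R "restrict_scalars R G N" by (rule restrict_module[OF N])
  obtain A where A: "finite A" "A \<subseteq> carrier N"
    and gen: "\<And>x. x \<in> carrier N \<Longrightarrow> \<exists>c \<in> A \<rightarrow> carrier S. x = (\<Oplus>\<^bsub>N\<^esub>s\<in>A. c s \<odot>\<^bsub>N\<^esub> s)"
    using fg by (auto simp: finitely_generated_module_def)
  define F where "F = (\<lambda>(h, s). delta h \<odot>\<^bsub>N\<^esub> s) ` (carrier G \<times> A)"
  let ?H = "module_span R (restrict_scalars R G N) F"
  have F: "finite F" "F \<subseteq> carrier N" using A fin_G elem_closed by (auto simp: F_def)
  have H: "submodule ?H R (restrict_scalars R G N)" using F by (intro NR.span_submodule) simp
  note HD = NR.submoduleD[OF H, simplified]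
  have "a \<odot>\<^bsub>N\<^esub> s \<in> ?H" if a: "a \<in> carrier S" and s: "s \<in> A" for a s
    using a
  proof (rule group_ring_induct)
    have sN: "s \<in> carrier N" using A s by auto
    show "\<zero>\<^bsub>S\<^esub> \<odot>\<^bsub>N\<^esub> s \<in> ?H" using sN HD(2) by simp
    show "(scalar r \<otimes>\<^bsub>S\<^esub> delta h) \<odot>\<^bsub>N\<^esub> s \<in> ?H" if rh: "r \<in> carrier R" "h \<in> carrier G" for r h
    proof -
      have "delta h \<odot>\<^bsub>N\<^esub> s \<in> ?H" using rh s by (intro module_span.base) (auto simp: F_def)
      then show ?thesis using HD(5) rh sN by (simp add: smult_scalar_elem[OF N])
    qed
    show "(a \<oplus>\<^bsub>S\<^esub> b) \<odot>\<^bsub>N\<^esub> s \<in> ?H"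
      if "a \<in> carrier S" "b \<in> carrier S" "a \<odot>\<^bsub>N\<^esub> s \<in> ?H" "b \<odot>\<^bsub>N\<^esub> s \<in> ?H" for a b
      using that HD(3) sN by (simp add: N.smult_l_distr)
  qed
  note as = this
  have "x \<in> ?H" if x: "x \<in> carrier N" for x
  proof -
    obtain c where c: "c \<in> A \<rightarrow> carrier S" "x = (\<Oplus>\<^bsub>N\<^esub>s\<in>A. c s \<odot>\<^bsub>N\<^esub> s)" using gen[OF x] by blast
    have "(\<Oplus>\<^bsub>N\<^esub>s\<in>A'. c s \<odot>\<^bsub>N\<^esub> s) \<in> ?H" if "finite A'" "A' \<subseteq> A" for A'
      using that
    proof (induction A')
      case (insert s A')
      have "(\<Oplus>\<^bsub>N\<^esub>s\<in>insert s A'. c s \<odot>\<^bsub>N\<^esub> s) = c s \<odot>\<^bsub>N\<^esub> s \<oplus>\<^bsub>N\<^esub> (\<Oplus>\<^bsub>N\<^esub>s\<in>A'. c s \<odot>\<^bsub>N\<^esub> s)"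
        using insert A c(1) by (intro N.finsum_insert) (auto simp: Pi_def subset_iff)
      moreover have "c s \<odot>\<^bsub>N\<^esub> s \<in> ?H" using as c(1) insert by auto
      ultimately show ?case using HD(3) insert by simp
    qed (use HD(2) in simp)
    then show ?thesis using A c(2) by auto
  qed
  then show ?thesis using F HD(1) by blast
qed

end

locale finite_G_set = finite_group_ring R G + A: group_action G E \<phi> for R (structure) and G and E and \<phi> +
  assumes fin_E: "finite E"
begin

abbreviation "P \<equiv> permutation_module R G E \<phi>"
abbreviation "PR \<equiv> restrict_scalars R G P"
abbreviation "basis \<equiv> permutation_basis R E"

lemma P_module: "module S P"
  by (rule permutation_module_module[OF R.is_cring G.comm_group_axioms fin_G A.group_action_axioms])

lemma PR_module: "module R PR"
  by (rule restrict_module[OF P_module])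

lemma P_simps:
  "carrier P = E \<rightarrow>\<^sub>E carrier R" "\<zero>\<^bsub>P\<^esub> = (\<lambda>w\<in>E. \<zero>)" "f \<oplus>\<^bsub>P\<^esub> f' = (\<lambda>w\<in>E. f w \<oplus> f' w)"
  by (simp_all add: permutation_module_def)

lemma action_closed: "h \<in> carrier G \<Longrightarrow> w \<in> E \<Longrightarrow> \<phi> h w \<in> E"
  using A.element_image by blast

lemma P_scalar:
  assumes r: "r \<in> carrier R" and f: "f \<in> carrier P"
  shows "scalar r \<odot>\<^bsub>P\<^esub> f = (\<lambda>w\<in>E. r \<otimes> f w)"
proof -
  have "(\<Oplus>h\<in>carrier G. scalar r h \<otimes> f (\<phi> (inv\<^bsub>G\<^esub> h) w)) = r \<otimes> f w" if w: "w \<in> E" for w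
  proof -
    have fR: "f (\<phi> (inv\<^bsub>G\<^esub> h) w) \<in> carrier R" if "h \<in> carrier G" for h
      using f w that action_closed by (auto simp: P_simps)
    have one: "\<phi> \<one>\<^bsub>G\<^esub> w = w" using w by (simp flip: A.id_eq_one)
    have fw: "f w \<in> carrier R" using f w by (auto simp: P_simps)
    have "(\<Oplus>h\<in>carrier G. scalar r h \<otimes> f (\<phi> (inv\<^bsub>G\<^esub> h) w))
      = (\<Oplus>h\<in>carrier G. if \<one>\<^bsub>G\<^esub> = h then r \<otimes> f w else \<zero>)"
      using r fw fR one by (intro R.finsum_cong') (auto simp: group_ring_scalar_def)
    also have "\<dots> = r \<otimes> f w"
      using r fw fin_G by (intro R.finsum_singleton) auto
    finally show ?thesis .
  qed
  then show ?thesis by (auto simp: permutation_module_def fun_eq_iff)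
qed

lemma P_elem:
  assumes h: "h \<in> carrier G" and f: "f \<in> carrier P"
  shows "delta h \<odot>\<^bsub>P\<^esub> f = (\<lambda>w\<in>E. f (\<phi> (inv\<^bsub>G\<^esub> h) w))"
proof -
  have "(\<Oplus>k\<in>carrier G. delta h k \<otimes> f (\<phi> (inv\<^bsub>G\<^esub> k) w)) = f (\<phi> (inv\<^bsub>G\<^esub> h) w)" if w: "w \<in> E" for w
  proof -
    have fR: "f (\<phi> (inv\<^bsub>G\<^esub> h) w) \<in> carrier R" if "h \<in> carrier G" for h
      using f w that action_closed by (auto simp: P_simps)
    have "(\<Oplus>k\<in>carrier G. delta h k \<otimes> f (\<phi> (inv\<^bsub>G\<^esub> k) w))
      = (\<Oplus>k\<in>carrier G. if h = k then f (\<phi> (inv\<^bsub>G\<^esub> h) w) else \<zero>)"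
      using fR by (intro R.finsum_cong') (auto simp: group_ring_elem_def)
    also have "\<dots> = f (\<phi> (inv\<^bsub>G\<^esub> h) w)"
      using h fR fin_G by (intro R.finsum_singleton) auto
    finally show ?thesis .
  qed
  then show ?thesis by (auto simp: permutation_module_def fun_eq_iff)
qed

lemma basis_closed: "basis w \<in> carrier P"
  by (auto simp: permutation_basis_def P_simps)

lemma basis_action: "h \<in> carrier G \<Longrightarrow> w \<in> E \<Longrightarrow> delta h \<odot>\<^bsub>P\<^esub> basis w = basis (\<phi> h w)"
  by (rule permutation_module_basis_action[OF R.is_cring G.is_group fin_G A.group_action_axioms])

lemma basis_span: "carrier P = module_span R PR (basis ` E)"
proof
  interpret PR: module R PR by (rule PR_module)
  have sub: "basis ` E \<subseteq> carrier PR" using basis_closed by auto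
  note SD = PR.submoduleD[OF PR.span_submodule[OF sub]]
  show "module_span R PR (basis ` E) \<subseteq> carrier P" using SD(1) by auto
  show "carrier P \<subseteq> module_span R PR (basis ` E)"
  proof
    fix f assume f: "f \<in> carrier P"
    have fR: "f w \<in> carrier R" if "w \<in> E" for w using f that by (auto simp: P_simps)
    define cut where "cut A = (\<lambda>w\<in>E. if w \<in> A then f w else \<zero>)" for A
    have "cut A \<in> module_span R PR (basis ` E)" if "finite A" "A \<subseteq> E" for A
      using that
    proof (induction A)
      case empty
      have "cut {} = \<zero>\<^bsub>PR\<^esub>" by (auto simp: P_simps cut_def)
      then show ?case using SD(2) by simp
    next
      case (insert v A)
      have v: "v \<in> E" "f v \<in> carrier R" using insert fR by auto
      have "cut (insert v A) = f v \<odot>\<^bsub>PR\<^esub> basis v \<oplus>\<^bsub>PR\<^esub> cut A"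
        using insert v fR P_scalar[OF v(2) basis_closed, of v]
        by (auto simp: P_simps permutation_basis_def cut_def fun_eq_iff)
      moreover have "f v \<odot>\<^bsub>PR\<^esub> basis v \<in> module_span R PR (basis ` E)"
        using v by (intro SD(5) module_span.base) auto
      ultimately show ?case using SD(3) insert by (simp only: insert_subset)
    qed
    moreover have "cut E = f" using f by (auto simp: P_simps cut_def PiE_iff extensional_def)
    ultimately show "f \<in> module_span R PR (basis ` E)" using fin_E by force
  qed
qed

text \<open>As an \<open>R\<close>-module, \<open>P\<close> is the free module on \<open>E\<close>: for finite \<open>E\<close> the support condition in
  \<open>free_module\<close> is void.\<close>

lemma linear_extension_perm_hom:
  assumes "module R N" "z \<in> E \<rightarrow> carrier N"
  shows "linear_extension R E N z \<in> module_homs R PR N"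
proof -
  note l = module_homD[OF linear_extension_hom[OF assms]]
  have c: "f \<in> carrier (free_module R E)" if "f \<in> carrier P" for f
    using that fin_E by (auto simp: free_module_def P_simps coefficient_support_def)
  have a: "f \<oplus>\<^bsub>P\<^esub> f' = f \<oplus>\<^bsub>free_module R E\<^esub> f'" for f f'
    by (simp add: P_simps free_module_def)
  have s: "scalar r \<odot>\<^bsub>P\<^esub> f = r \<odot>\<^bsub>free_module R E\<^esub> f" if "r \<in> carrier R" "f \<in> carrier P" for r f
    using P_scalar[OF that] by (simp add: free_module_def)
  show ?thesis
    by (rule module_homI) (use l c in \<open>auto simp: a s\<close>)
qed

lemma linear_extension_basis:
  assumes N: "module R N" and z: "z \<in> E \<rightarrow> carrier N" and w: "w \<in> E"
  shows "linear_extension R E N z (basis w) = z w"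
proof -
  interpret N: module R N by fact
  have zw: "z w \<in> carrier N" using z w by auto
  have "linear_extension R E N z (basis w) = (\<Oplus>\<^bsub>N\<^esub>v\<in>{w}. basis w v \<odot>\<^bsub>N\<^esub> z v)"
    using z w by (intro linear_extension_eq[OF N]) (auto simp: coefficient_support_def permutation_basis_def)
  also have "\<dots> = z w" using w zw by (simp add: N.finsum_insert permutation_basis_def)
  finally show ?thesis .
qed

lemma perm_hom_induct:
  assumes N: "module R N" and f: "f \<in> module_homs R PR N" and f': "f' \<in> module_homs R PR N"
    and eq: "\<And>w. w \<in> E \<Longrightarrow> f (basis w) = f' (basis w)" and v: "v \<in> carrier P"
  shows "f v = f' v"
proof -
  interpret N: module R N by fact
  interpret PR: module R PR by (rule PR_module)
  note fD = module_homD[OF f] and f'D = module_homD[OF f']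
  have zero: "h \<zero>\<^bsub>PR\<^esub> = \<zero>\<^bsub>N\<^esub>" if "h \<in> module_homs R PR N" for h
    using module_homD(3)[OF that R.zero_closed PR.zero_closed] module_homD(1)[OF that PR.zero_closed]
      PR.smult_l_null[OF PR.zero_closed] by (simp del: restrict_scalars_simps)
  have sub: "submodule {v \<in> carrier PR. f v = f' v} R PR"
    by (rule PR.submodule_intro) (auto simp: fD f'D zero[OF f] zero[OF f'] simp del: restrict_scalars_simps)
  have "basis ` E \<subseteq> {v \<in> carrier PR. f v = f' v}" using eq basis_closed by auto
  moreover have "v \<in> module_span R PR (basis ` E)" using v basis_span by simp
  ultimately have "v \<in> {v \<in> carrier PR. f v = f' v}" by (rule PR.span_least[OF sub])
  then show ?thesis by simp
qed

lemma P_finitely_generated: "finitely_generated_module S P"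
proof -
  interpret P: module S P by (rule P_module)
  interpret S: cring S by (rule S_cring)
  have "\<exists>c \<in> basis ` E \<rightarrow> carrier S. x = (\<Oplus>\<^bsub>P\<^esub>s\<in>basis ` E. c s \<odot>\<^bsub>P\<^esub> s)" if "x \<in> module_span R PR (basis ` E)" for x
    using that
  proof induction
    case zero
    have "(\<Oplus>\<^bsub>P\<^esub>s\<in>basis ` E. \<zero>\<^bsub>S\<^esub> \<odot>\<^bsub>P\<^esub> s) = (\<Oplus>\<^bsub>P\<^esub>s\<in>basis ` E. \<zero>\<^bsub>P\<^esub>)"
      using basis_closed by (intro P.finsum_cong') auto
    then show ?case by (intro bexI[of _ "\<lambda>s. \<zero>\<^bsub>S\<^esub>"]) (auto simp: P.finsum_zero)
  next
    case (base b)
    have "(\<Oplus>\<^bsub>P\<^esub>s\<in>basis ` E. (if s = b then \<one>\<^bsub>S\<^esub> else \<zero>\<^bsub>S\<^esub>) \<odot>\<^bsub>P\<^esub> s) = (\<Oplus>\<^bsub>P\<^esub>s\<in>basis ` E. (if b = s then s else \<zero>\<^bsub>P\<^esub>))"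
      using basis_closed by (intro P.finsum_cong') auto
    also have "\<dots> = b"
      using base fin_E basis_closed by (intro P.finsum_singleton) auto
    finally show ?case by (intro bexI[of _ "\<lambda>s. if s = b then \<one>\<^bsub>S\<^esub> else \<zero>\<^bsub>S\<^esub>"]) auto
  next
    case (add u v)
    then obtain c d where *: "c \<in> basis ` E \<rightarrow> carrier S" "u = (\<Oplus>\<^bsub>P\<^esub>s\<in>basis ` E. c s \<odot>\<^bsub>P\<^esub> s)"
      "d \<in> basis ` E \<rightarrow> carrier S" "v = (\<Oplus>\<^bsub>P\<^esub>s\<in>basis ` E. d s \<odot>\<^bsub>P\<^esub> s)" by blast
    have cd: "c s \<in> carrier S" "d s \<in> carrier S" if "s \<in> basis ` E" for s
      using *(1,3) that by auto
    have "(\<Oplus>\<^bsub>P\<^esub>s\<in>basis ` E. (c s \<oplus>\<^bsub>S\<^esub> d s) \<odot>\<^bsub>P\<^esub> s) = (\<Oplus>\<^bsub>P\<^esub>s\<in>basis ` E. c s \<odot>\<^bsub>P\<^esub> s \<oplus>\<^bsub>P\<^esub> d s \<odot>\<^bsub>P\<^esub> s)"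
      using basis_closed cd by (intro P.finsum_cong') (auto simp: P.smult_l_distr)
    also have "\<dots> = u \<oplus>\<^bsub>P\<^esub> v"
      unfolding *(2,4) using basis_closed cd by (intro P.finsum_addf) auto
    finally show ?case using cd by (intro bexI[of _ "\<lambda>s. c s \<oplus>\<^bsub>S\<^esub> d s"]) auto
  next
    case (smult r u)
    then obtain c where *: "c \<in> basis ` E \<rightarrow> carrier S" "u = (\<Oplus>\<^bsub>P\<^esub>s\<in>basis ` E. c s \<odot>\<^bsub>P\<^esub> s)" by blast
    have c: "c s \<in> carrier S" if "s \<in> basis ` E" for s using *(1) that by auto
    have r: "scalar r \<in> carrier S" using smult scalar_closed by auto
    have "scalar r \<odot>\<^bsub>P\<^esub> u = (\<Oplus>\<^bsub>P\<^esub>s\<in>basis ` E. scalar r \<odot>\<^bsub>P\<^esub> (c s \<odot>\<^bsub>P\<^esub> s))"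
      unfolding *(2) using basis_closed c r fin_E by (intro P.finsum_smult_ldistr) auto
    also have "\<dots> = (\<Oplus>\<^bsub>P\<^esub>s\<in>basis ` E. (scalar r \<otimes>\<^bsub>S\<^esub> c s) \<odot>\<^bsub>P\<^esub> s)"
      using basis_closed c r by (intro P.finsum_cong') (auto simp: P.smult_assoc1)
    finally show ?case using c r by (intro bexI[of _ "\<lambda>s. scalar r \<otimes>\<^bsub>S\<^esub> c s"]) auto
  qed
  then show ?thesis unfolding finitely_generated_module_def
    using fin_E basis_closed basis_span by (intro exI[of _ "basis ` E"]) auto
qed

text \<open>Free modules are projective: lift the images of the basis vectors.\<close>

lemma P_projective: "projective_module R PR"
  unfolding projective_module_def
proof (intro allI ballI impI)
  fix U :: "('a, ('e \<Rightarrow> 'a) \<Rightarrow> 'a) module" and V :: "('a, 'e \<Rightarrow> 'a) module" and g f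
  assume g: "g \<in> module_homs R U V" and f: "f \<in> module_homs R PR V"
    and U: "module R U" and V: "module R V" and surj: "g ` carrier U = carrier V"
  have "\<forall>w. \<exists>u. w \<in> E \<longrightarrow> u \<in> carrier U \<and> g u = f (basis w)"
  proof
    fix w
    have "f (basis w) \<in> g ` carrier U" unfolding surj using module_homD(1)[OF f] basis_closed by simp
    then show "\<exists>u. w \<in> E \<longrightarrow> u \<in> carrier U \<and> g u = f (basis w)" by auto
  qed
  from choice[OF this] obtain z where z: "\<And>w. w \<in> E \<Longrightarrow> z w \<in> carrier U \<and> g (z w) = f (basis w)" by blast
  let ?h = "linear_extension R E U z"
  have zU: "z \<in> E \<rightarrow> carrier U" using z by auto
  have h: "?h \<in> module_homs R PR U" by (rule linear_extension_perm_hom[OF U zU])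
  have gh: "(\<lambda>v. g (?h v)) \<in> module_homs R PR V"
    by (rule module_homI) (simp_all only: module_homD[OF h] module_homD[OF g])
  have "g (?h v) = f v" if "v \<in> carrier P" for v
    by (rule perm_hom_induct[OF V gh f _ that]) (use z zU in \<open>auto simp: linear_extension_basis[OF U]\<close>)
  then show "\<exists>h\<in>module_homs R PR U. \<forall>x\<in>carrier PR. g (h x) = f x" using h by auto
qed

lemma P_lattice: "group_ring_lattice R G P"
  unfolding group_ring_lattice_def
  using P_module P_finitely_generated P_projective by blast

end

section \<open>Disjoint unions of cycles as sets with an action of a cyclic group\<close>

text \<open>The disjoint union of \<open>r\<close> cycles, the \<open>j\<close>-th one being the integers modulo \<open>len j\<close>, encoded in the
  natural numbers. With \<open>len j\<close> a divisor of the order of a cyclic group, every finite set with an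
  action of that group has this form up to isomorphism.\<close>

definition cycle_points :: "(nat \<Rightarrow> nat) \<Rightarrow> nat \<Rightarrow> nat set" where
  "cycle_points len r = {prod_encode (j, i) | j i. j < r \<and> i < len j}"

definition cycle_shift :: "(nat \<Rightarrow> nat) \<Rightarrow> nat \<Rightarrow> nat \<Rightarrow> nat" where
  "cycle_shift len a w = (case prod_decode w of (j, i) \<Rightarrow> prod_encode (j, (i + a) mod len j))"

lemma cycle_points_cases:
  assumes "w \<in> cycle_points len r"
  obtains j i where "w = prod_encode (j, i)" "j < r" "i < len j"
  using assms by (auto simp: cycle_points_def)

lemma cycle_points_iff [simp]: "prod_encode (j, i) \<in> cycle_points len r \<longleftrightarrow> j < r \<and> i < len j"
  by (auto simp: cycle_points_def)

lemma cycle_points_UN: "cycle_points len r = (\<Union>j\<in>{..<r}. (\<lambda>i. prod_encode (j, i)) ` {..<len j})"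
  by (auto simp: cycle_points_def)

lemma finite_cycle_points: "finite (cycle_points len r)"
  unfolding cycle_points_UN by auto

lemma cycle_shift_encode [simp]:
  "cycle_shift len a (prod_encode (j, i)) = prod_encode (j, (i + a) mod len j)"
  by (simp add: cycle_shift_def)

lemma cycle_shift_closed: "w \<in> cycle_points len r \<Longrightarrow> cycle_shift len a w \<in> cycle_points len r"
  by (erule cycle_points_cases) simp

lemma cycle_shift_0: "w \<in> cycle_points len r \<Longrightarrow> cycle_shift len 0 w = w"
  by (erule cycle_points_cases) simp

lemma cycle_shift_shift:
  "w \<in> cycle_points len r \<Longrightarrow> cycle_shift len a (cycle_shift len b w) = cycle_shift len (a + b) w"
  by (erule cycle_points_cases) (simp add: mod_simps ac_simps)

lemma cycle_shift_cong:
  assumes "w \<in> cycle_points len r" "\<And>j. j < r \<Longrightarrow> len j dvd N" "a mod N = b mod N"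
  shows "cycle_shift len a w = cycle_shift len b w"
  using assms(1)
proof (rule cycle_points_cases)
  fix j i assume w: "w = prod_encode (j, i)" "j < r"
  have "a mod len j = b mod len j"
    using assms(2)[OF w(2)] assms(3) by (metis mod_mod_cancel)
  then have "(i + a) mod len j = (i + b) mod len j" by (metis mod_add_right_eq)
  then show ?thesis by (simp add: w)
qed

lemma (in abelian_monoid) finsum_cycle_points:
  assumes "\<And>j i. j < r \<Longrightarrow> i < len j \<Longrightarrow> f (prod_encode (j, i)) \<in> carrier G"
  shows "(\<Oplus>w\<in>cycle_points len r. f w) = (\<Oplus>j\<in>{..<r}. \<Oplus>i\<in>{..<len j}. f (prod_encode (j, i)))"
proof -
  have "(\<Oplus>w\<in>cycle_points len r. f w) = (\<Oplus>j\<in>{..<r}. \<Oplus>w\<in>(\<lambda>i. prod_encode (j, i)) ` {..<len j}. f w)"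
    unfolding cycle_points_UN
    by (rule add.finprod_UN_disjoint) (use assms in \<open>auto simp: pairwise_def disjnt_def\<close>)
  also have "\<dots> = (\<Oplus>j\<in>{..<r}. \<Oplus>i\<in>{..<len j}. f (prod_encode (j, i)))"
    by (intro finsum_cong' refl add.finprod_reindex) (use assms in \<open>auto simp: inj_on_def intro!: finsum_closed\<close>)
  finally show ?thesis .
qed

section \<open>Group rings of cyclic p-groups\<close>

locale cyclic_group_ring = R?: p_local_pid R p \<pi> + finite_group_ring R G
  for R (structure) and p and \<pi> and G +
  fixes g :: 'c and n :: nat
  assumes g_closed [simp]: "g \<in> carrier G"
    and g_generates: "h \<in> carrier G \<Longrightarrow> \<exists>k::nat. h = g [^]\<^bsub>G\<^esub> k"
    and g_pow_eq: "g [^]\<^bsub>G\<^esub> (a::nat) = g [^]\<^bsub>G\<^esub> (b::nat) \<longleftrightarrow> a mod p ^ n = b mod p ^ n"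
begin

lemma g_pow_n: "g [^]\<^bsub>G\<^esub> (p ^ n) = \<one>\<^bsub>G\<^esub>"
  using g_pow_eq[of "p ^ n" 0] by simp

abbreviation "g_act N \<equiv> (\<lambda>v. delta g \<odot>\<^bsub>N\<^esub> v)"

lemma g_act_hom: "module S N \<Longrightarrow> g_act N \<in> module_homs R (restrict_scalars R G N) (restrict_scalars R G N)"
  by (rule elem_smult_hom) auto

lemma g_act_power:
  assumes N: "module S N" and v: "v \<in> carrier N"
  shows "(g_act N ^^ k) v = delta (g [^]\<^bsub>G\<^esub> k) \<odot>\<^bsub>N\<^esub> v"
proof (induction k)
  interpret N: module S N by fact
  case 0
  then show ?case using v by (simp add: elem_one)
next
  interpret N: module S N by fact
  case (Suc k)
  have "g \<otimes>\<^bsub>G\<^esub> g [^]\<^bsub>G\<^esub> k = g [^]\<^bsub>G\<^esub> Suc k" using G.nat_pow_Suc2[OF g_closed] by simp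
  then show ?case using Suc v elem_closed
    by (simp add: N.smult_assoc1[symmetric] elem_mult)
qed

lemma g_act_period: "module S N \<Longrightarrow> v \<in> carrier N \<Longrightarrow> (g_act N ^^ (p ^ n)) v = v"
  using module.smult_one[of S N v] by (simp add: g_act_power g_pow_n elem_one)

text \<open>Commuting with the generator suffices, as every group element is a power of it.\<close>

lemma g_equivariant_homI:
  assumes N: "module S N" and N': "module S N'"
    and f: "f \<in> module_homs R (restrict_scalars R G N) (restrict_scalars R G N')"
    and eq: "\<And>v. v \<in> carrier N \<Longrightarrow> f (g_act N v) = g_act N' (f v)"
  shows "f \<in> module_homs S N N'"
proof (rule group_ring_homI[OF N N' f])
  fix h v assume h: "h \<in> carrier G" and v: "v \<in> carrier N"
  interpret N: module S N by fact
  obtain k :: nat where k: "h = g [^]\<^bsub>G\<^esub> k" using g_generates[OF h] by blast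
  have fv: "f v \<in> carrier N'" using module_homD(1)[OF f] v by simp
  have cl: "(g_act N ^^ k) v \<in> carrier N" for k using v elem_closed by (simp add: g_act_power[OF N])
  have "f ((g_act N ^^ k) v) = (g_act N' ^^ k) (f v)"
    by (induction k) (simp_all add: eq cl)
  then show "f (delta h \<odot>\<^bsub>N\<^esub> v) = delta h \<odot>\<^bsub>N'\<^esub> f v"
    unfolding k using v fv by (simp add: g_act_power N N')
qed

definition dlog :: "'c \<Rightarrow> nat" where "dlog h = (SOME k. g [^]\<^bsub>G\<^esub> k = h)"

lemma dlog: "h \<in> carrier G \<Longrightarrow> g [^]\<^bsub>G\<^esub> dlog h = h"
  unfolding dlog_def by (rule someI_ex) (metis g_generates)

end

section \<open>Permutation modules of cyclic p-groups\<close>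

locale cyclic_G_set = cyclic_group_ring R p \<pi> G g n
  for R (structure) and p and \<pi> and G and g and n +
  fixes e :: "nat \<Rightarrow> nat" and r :: nat
  assumes e_le: "j < r \<Longrightarrow> e j \<le> n"
begin

abbreviation "len \<equiv> (\<lambda>j. p ^ e j)"
abbreviation "points \<equiv> cycle_points len r"
abbreviation "shift \<equiv> cycle_shift len"
definition "act_points = (\<lambda>h. \<lambda>w\<in>points. shift (dlog h) w)"

lemma p_pos [simp]: "0 < p"
  using prime_gt_0_nat[OF prime_p] .

lemma len_pos: "0 < p ^ k"
  by simp

lemma len_dvd: "j < r \<Longrightarrow> p ^ e j dvd p ^ n"
  by (rule le_imp_power_dvd) (rule e_le)

lemma shift_eq:
  assumes "w \<in> points" "g [^]\<^bsub>G\<^esub> a = g [^]\<^bsub>G\<^esub> b"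
  shows "shift a w = shift b w"
  by (rule cycle_shift_cong[OF assms(1) len_dvd]) (use assms(2) g_pow_eq in auto)

lemma shift_surj:
  assumes w: "w \<in> points"
  shows "\<exists>v\<in>points. w = shift a v"
proof -
  have "g [^]\<^bsub>G\<^esub> (a + dlog (inv\<^bsub>G\<^esub> (g [^]\<^bsub>G\<^esub> a))) = g [^]\<^bsub>G\<^esub> (0::nat)"
    by (simp add: G.nat_pow_mult[symmetric] dlog)
  then have "shift (a + dlog (inv\<^bsub>G\<^esub> (g [^]\<^bsub>G\<^esub> a))) w = w"
    using shift_eq[OF w] cycle_shift_0[OF w] by (rule_tac trans)
  then show ?thesis using cycle_shift_shift[OF w] cycle_shift_closed[OF w] by metis
qed

lemma points_action: "group_action G points act_points"
proof -
  have comp: "act_points h (act_points k w) = act_points (h \<otimes>\<^bsub>G\<^esub> k) w"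
    if "h \<in> carrier G" "k \<in> carrier G" "w \<in> points" for h k w
  proof -
    have "g [^]\<^bsub>G\<^esub> (dlog h + dlog k) = g [^]\<^bsub>G\<^esub> dlog (h \<otimes>\<^bsub>G\<^esub> k)"
      using that by (simp add: G.nat_pow_mult[symmetric] dlog)
    from shift_eq[OF that(3) this] show ?thesis using that
      by (simp add: act_points_def cycle_shift_closed cycle_shift_shift)
  qed
  have one: "act_points \<one>\<^bsub>G\<^esub> w = w" if "w \<in> points" for w
  proof -
    have "g [^]\<^bsub>G\<^esub> dlog \<one>\<^bsub>G\<^esub> = g [^]\<^bsub>G\<^esub> (0::nat)" by (simp add: dlog)
    from shift_eq[OF that this] show ?thesis using that cycle_shift_0[OF that] by (simp add: act_points_def)
  qed
  have cl: "act_points h w \<in> points" if "w \<in> points" for h w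
    using that by (simp add: act_points_def cycle_shift_closed)
  have bij: "act_points h \<in> Bij points" if h: "h \<in> carrier G" for h
  proof -
    have "bij_betw (act_points h) points points"
      by (rule bij_betw_byWitness[where f' = "act_points (inv\<^bsub>G\<^esub> h)"])
        (use h cl one in \<open>auto simp: comp\<close>)
    then show ?thesis by (auto simp: Bij_def act_points_def)
  qed
  have "act_points \<in> hom G (BijGroup points)"
  proof (rule homI)
    show "act_points h \<in> carrier (BijGroup points)" if "h \<in> carrier G" for h
      using bij[OF that] by (simp add: BijGroup_def)
    show "act_points (h \<otimes>\<^bsub>G\<^esub> k) = act_points h \<otimes>\<^bsub>BijGroup points\<^esub> act_points k"
      if "h \<in> carrier G" "k \<in> carrier G" for h k
    proof
      fix w
      show "act_points (h \<otimes>\<^bsub>G\<^esub> k) w = (act_points h \<otimes>\<^bsub>BijGroup points\<^esub> act_points k) w"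
        using comp[OF that, of w, symmetric] bij[OF that(1)] bij[OF that(2)]
        by (cases "w \<in> points") (simp_all add: BijGroup_def compose_def, simp add: act_points_def)
    qed
  qed
  then show ?thesis
    unfolding group_action_def group_hom_def group_hom_axioms_def
    using G.is_group group_BijGroup by blast
qed

sublocale finite_G_set R G points act_points
  by (intro finite_G_set.intro finite_group_ring_axioms points_action finite_G_set_axioms.intro
      finite_cycle_points)

abbreviation "T \<equiv> g_act P"

lemma T_hom: "T \<in> module_homs R PR PR"
  by (rule g_act_hom[OF P_module])

sublocale PM: p_local_endo R p \<pi> PR T
  by (intro p_local_endo.intro p_local_module.intro p_local_endo_axioms.intro
      p_local_pid_axioms PR_module T_hom)

text \<open>Stated with the shift on the argument of \<open>T f\<close>, so that no inverse shift has to be mentioned.\<close>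

lemma T_shift:
  assumes f: "f \<in> carrier P" and w: "w \<in> points"
  shows "T f (shift 1 w) = f w"
proof -
  have "g [^]\<^bsub>G\<^esub> (dlog (inv\<^bsub>G\<^esub> g) + 1) = g [^]\<^bsub>G\<^esub> (0::nat)"
    by (simp add: G.nat_pow_mult[symmetric] dlog)
  then have "shift (dlog (inv\<^bsub>G\<^esub> g) + 1) w = w"
    using shift_eq[OF w] cycle_shift_0[OF w] by (rule_tac trans)
  then have "act_points (inv\<^bsub>G\<^esub> g) (shift 1 w) = w"
    using w by (simp add: act_points_def cycle_shift_closed cycle_shift_shift)
  then show ?thesis using P_elem[OF g_closed f] cycle_shift_closed[OF w] by simp
qed

lemma T_closed_P: "f \<in> carrier P \<Longrightarrow> T f \<in> carrier P"
  using PM.T_closed by simp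

lemma Tk_closed: "f \<in> carrier P \<Longrightarrow> (T ^^ k) f \<in> carrier P"
  using PM.funpow_T_closed by simp

lemma Tk_shift:
  assumes f: "f \<in> carrier P" and w: "w \<in> points"
  shows "(T ^^ k) f (shift k w) = f w"
proof (induction k)
  case (Suc k)
  have "shift (Suc k) w = shift 1 (shift k w)" using cycle_shift_shift[OF w] by simp
  then have "(T ^^ Suc k) f (shift (Suc k) w) = T ((T ^^ k) f) (shift 1 (shift k w))" by simp
  also have "\<dots> = (T ^^ k) f (shift k w)"
    using Tk_closed[OF f] w by (intro T_shift) (auto simp: cycle_shift_closed)
  finally show ?case using Suc by simp
qed (use cycle_shift_0[OF w] in simp)

lemma P_ext_shift:
  assumes "f \<in> carrier P" "f' \<in> carrier P" "\<And>w. w \<in> points \<Longrightarrow> f (shift k w) = f' (shift k w)"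
  shows "f = f'"
proof
  fix w
  show "f w = f' w"
  proof (cases "w \<in> points")
    case True
    then show ?thesis using shift_surj[OF True, of k] assms(3) by auto
  next
    case False
    then show ?thesis using assms(1,2) by (auto simp: P_simps PiE_iff extensional_def)
  qed
qed

lemma T_basis:
  assumes w: "w \<in> points"
  shows "T (basis w) = basis (shift 1 w)"
proof -
  have "act_points g w = shift 1 w"
    using shift_eq[OF w, of "dlog g" 1] w by (simp add: act_points_def dlog)
  then show ?thesis using basis_action[OF g_closed w] by simp
qed

lemma Tk_basis: "w \<in> points \<Longrightarrow> (T ^^ k) (basis w) = basis (shift k w)"
proof (induction k)
  case (Suc k)
  then show ?case
    using T_basis[of "shift k w"] cycle_shift_shift[of w len r 1 k] by (simp add: cycle_shift_closed)
qed (simp add: cycle_shift_0)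

lemma P_closed_eval: "f \<in> carrier P \<Longrightarrow> w \<in> points \<Longrightarrow> f w \<in> carrier R"
  by (auto simp: P_simps)

lemma PR_add_eval: "w \<in> points \<Longrightarrow> (f \<oplus>\<^bsub>PR\<^esub> f') w = f w \<oplus> f' w"
  by (simp add: P_simps)

lemma PR_smult_eval: "s \<in> carrier R \<Longrightarrow> f \<in> carrier P \<Longrightarrow> w \<in> points \<Longrightarrow> (s \<odot>\<^bsub>PR\<^esub> f) w = s \<otimes> f w"
  by (simp add: P_scalar)

lemma P_decompose:
  assumes f: "f \<in> carrier P" and f': "f' \<in> carrier P"
    and c: "\<And>w. w \<in> points \<Longrightarrow> \<exists>u\<in>carrier R. f w = f' w \<oplus> \<pi> \<otimes> u"
  shows "\<exists>z\<in>carrier P. f = f' \<oplus>\<^bsub>PR\<^esub> \<pi> \<odot>\<^bsub>PR\<^esub> z"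
proof -
  have "\<forall>w. \<exists>u. w \<in> points \<longrightarrow> u \<in> carrier R \<and> f w = f' w \<oplus> \<pi> \<otimes> u" using c by blast
  from choice[OF this] obtain u where u: "\<And>w. w \<in> points \<Longrightarrow> u w \<in> carrier R \<and> f w = f' w \<oplus> \<pi> \<otimes> u w"
    by blast
  define z where "z = (\<lambda>w\<in>points. u w)"
  have z: "z \<in> carrier P" using u by (auto simp: z_def P_simps)
  have "f = f' \<oplus>\<^bsub>PR\<^esub> \<pi> \<odot>\<^bsub>PR\<^esub> z"
  proof (rule P_ext_shift[of _ _ 0])
    show "f' \<oplus>\<^bsub>PR\<^esub> \<pi> \<odot>\<^bsub>PR\<^esub> z \<in> carrier P"
      using PM.M.a_closed[of f' "\<pi> \<odot>\<^bsub>PR\<^esub> z"] PM.smult_closed[of \<pi> z] f' z by simp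
    show "f (shift 0 w) = (f' \<oplus>\<^bsub>PR\<^esub> \<pi> \<odot>\<^bsub>PR\<^esub> z) (shift 0 w)" if "w \<in> points" for w
      using u[OF that] that z by (simp only: cycle_shift_0 PR_add_eval PR_smult_eval pi_closed) (simp add: z_def)
  qed (rule f)
  then show ?thesis using z by blast
qed

lemma P_torsion_free:
  assumes f: "f \<in> carrier P" and zero: "\<pi> \<odot>\<^bsub>PR\<^esub> f = \<zero>\<^bsub>PR\<^esub>"
  shows "f = \<zero>\<^bsub>PR\<^esub>"
proof (rule P_ext_shift[of _ _ 0])
  show "f (shift 0 w) = \<zero>\<^bsub>PR\<^esub> (shift 0 w)" if w: "w \<in> points" for w
  proof -
    have "\<pi> \<otimes> f w = \<zero>"
      using fun_cong[OF zero, of w] PR_smult_eval[OF pi_closed f w] w by (simp add: P_simps)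
    then show ?thesis
      using integral[OF _ pi_closed P_closed_eval[OF f w]] pi_nonzero w
      by (simp add: P_simps cycle_shift_0)
  qed
qed (use f PM.M.zero_closed in simp_all)

text \<open>A vector that is fixed modulo \<open>p\<close> by the shift by \<open>q\<close> is, modulo \<open>p\<close>, constant on the orbits of
  this shift. Choosing a representative of each orbit and extending its value to the whole orbit
  yields a fixed vector congruent to the given one.\<close>

lemma P_fixed_lift:
  assumes f: "f \<in> carrier P" and z: "z \<in> carrier P" and eq: "(T ^^ q) f = f \<oplus>\<^bsub>PR\<^esub> \<pi> \<odot>\<^bsub>PR\<^esub> z"
  shows "\<exists>f1\<in>carrier P. (T ^^ q) f1 = f1 \<and> (\<exists>z'\<in>carrier P. f = f1 \<oplus>\<^bsub>PR\<^esub> \<pi> \<odot>\<^bsub>PR\<^esub> z')"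
proof -
  define orb where "orb w = range (\<lambda>k. shift (q * k) w)" for w
  define rep where "rep w = (SOME v. v \<in> orb w)" for w
  have orb_shift: "orb (shift q w) = orb w" if w: "w \<in> points" for w
  proof -
    have s: "shift (q * k) (shift q w) = shift (q * Suc k) w" for k
      using cycle_shift_shift[OF w] by (simp add: add.commute)
    \<comment> \<open>shifting by \<open>q * p ^ n\<close> is the identity, so backward steps are forward steps\<close>
    have "shift (q * k) w = shift (q * Suc (k + (p ^ n - 1))) w" for k
    proof (rule shift_eq[OF w])
      have "Suc (k + (p ^ n - 1)) = k + p ^ n" using len_pos[of n] by linarith
      then have "q * Suc (k + (p ^ n - 1)) = q * k + q * p ^ n"
        by (simp only: add_mult_distrib2)
      then show "g [^]\<^bsub>G\<^esub> (q * k) = g [^]\<^bsub>G\<^esub> (q * Suc (k + (p ^ n - 1)))"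
        unfolding g_pow_eq by simp
    qed
    then have sub: "orb w \<subseteq> range (\<lambda>k. shift (q * Suc k) w)" unfolding orb_def by blast
    moreover have "range (\<lambda>k. shift (q * Suc k) w) \<subseteq> orb w" unfolding orb_def by blast
    moreover have "orb (shift q w) = range (\<lambda>k. shift (q * Suc k) w)" unfolding orb_def by (simp only: s)
    ultimately show ?thesis by blast
  qed
  have step: "\<exists>u\<in>carrier R. f w = f (shift q w) \<oplus> \<pi> \<otimes> u" if w: "w \<in> points" for w
  proof (rule bexI[of _ "z (shift q w)"])
    show "f w = f (shift q w) \<oplus> \<pi> \<otimes> z (shift q w)"
      using Tk_shift[OF f w, of q] w z
      unfolding eq by (simp only: PR_add_eval PR_smult_eval cycle_shift_closed pi_closed)
    show "z (shift q w) \<in> carrier R" using z w by (intro P_closed_eval) (auto simp: cycle_shift_closed)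
  qed
  have steps: "\<exists>u\<in>carrier R. f w = f (shift (q * k) w) \<oplus> \<pi> \<otimes> u" if w: "w \<in> points" for w k
  proof (induction k)
    case 0
    show ?case using w f by (intro bexI[of _ \<zero>]) (auto simp: cycle_shift_0 P_closed_eval)
  next
    case (Suc k)
    let ?v = "shift (q * k) w"
    have v: "?v \<in> points" using w by (rule cycle_shift_closed)
    obtain u where u: "u \<in> carrier R" "f w = f ?v \<oplus> \<pi> \<otimes> u" using Suc by blast
    obtain u' where u': "u' \<in> carrier R" "f ?v = f (shift q ?v) \<oplus> \<pi> \<otimes> u'" using step[OF v] by blast
    have "f (shift q ?v) \<in> carrier R" using f v by (intro P_closed_eval) (auto simp: cycle_shift_closed)
    then have "f w = f (shift q ?v) \<oplus> \<pi> \<otimes> (u' \<oplus> u)"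
      using u(1) u'(1) unfolding u(2) u'(2) by (simp add: r_distr a_assoc)
    moreover have "shift q ?v = shift (q * Suc k) w" using cycle_shift_shift[OF w] by simp
    ultimately show ?case using u(1) u'(1) by auto
  qed
  have rep: "rep w \<in> orb w" for w unfolding rep_def orb_def by (rule someI_ex) blast
  have rep_points: "rep w \<in> points" if "w \<in> points" for w
    using rep[of w] that by (auto simp: orb_def cycle_shift_closed)
  define f1 where "f1 = (\<lambda>w\<in>points. f (rep w))"
  have f1: "f1 \<in> carrier P" using f rep_points by (auto simp: f1_def P_simps)
  have "(T ^^ q) f1 = f1"
  proof (rule P_ext_shift[OF Tk_closed[OF f1] f1, of q])
    fix w assume w: "w \<in> points"
    have "rep (shift q w) = rep w" by (simp add: rep_def orb_shift[OF w])
    then show "(T ^^ q) f1 (shift q w) = f1 (shift q w)"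
      using Tk_shift[OF f1 w, of q] w by (simp add: f1_def cycle_shift_closed)
  qed
  moreover have "\<exists>z'\<in>carrier P. f = f1 \<oplus>\<^bsub>PR\<^esub> \<pi> \<odot>\<^bsub>PR\<^esub> z'"
  proof (rule P_decompose[OF f f1])
    fix w assume w: "w \<in> points"
    obtain k where "rep w = shift (q * k) w" using rep[of w] by (auto simp: orb_def)
    then show "\<exists>u\<in>carrier R. f w = f1 w \<oplus> \<pi> \<otimes> u" using steps[OF w, of k] w by (simp add: f1_def)
  qed
  ultimately show ?thesis using f1 by blast
qed

text \<open>The universal property of \<open>P\<close>: vectors \<open>y j\<close> fixed by \<open>T' ^ (p ^ e j)\<close> determine an equivariant map
  that sends the point \<open>i\<close> of the \<open>j\<close>-th cycle to \<open>T' ^ i\<close> applied to \<open>y j\<close>.\<close>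

definition cycle_vector :: "('m \<Rightarrow> 'm) \<Rightarrow> (nat \<Rightarrow> 'm) \<Rightarrow> nat \<Rightarrow> 'm" where
  "cycle_vector T' y w = (case prod_decode w of (j, i) \<Rightarrow> (T' ^^ i) (y j))"

lemma cycle_vector_encode [simp]: "cycle_vector T' y (prod_encode (j, i)) = (T' ^^ i) (y j)"
  by (simp add: cycle_vector_def)

definition cycle_map where
  "cycle_map N T' y = linear_extension R points N (cycle_vector T' y)"

lemma cycle_map:
  assumes N: "module R N" and T': "T' \<in> module_homs R N N"
    and y: "\<forall>j<r. y j \<in> carrier N" "\<forall>j<r. (T' ^^ (p ^ e j)) (y j) = y j"
  shows "cycle_vector T' y \<in> points \<rightarrow> carrier N"
    and "cycle_map N T' y \<in> module_homs R PR N"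
    and "\<And>w. w \<in> points \<Longrightarrow> cycle_map N T' y (basis w) = cycle_vector T' y w"
    and "\<And>f. f \<in> carrier P \<Longrightarrow> cycle_map N T' y (T f) = T' (cycle_map N T' y f)"
proof -
  have cl: "(T' ^^ i) (y j) \<in> carrier N" if "j < r" for i j
    using y(1) that by (induction i) (auto simp: module_homD(1)[OF T'])
  show z: "cycle_vector T' y \<in> points \<rightarrow> carrier N"
    using cl by (auto simp: cycle_points_def)
  show hom: "cycle_map N T' y \<in> module_homs R PR N"
    unfolding cycle_map_def by (rule linear_extension_perm_hom[OF N z])
  show b: "cycle_map N T' y (basis w) = cycle_vector T' y w" if "w \<in> points" for w
    unfolding cycle_map_def by (rule linear_extension_basis[OF N z that])
  have eqv: "cycle_vector T' y (shift 1 w) = T' (cycle_vector T' y w)" if "w \<in> points" for w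
    using that
  proof (rule cycle_points_cases)
    fix j i assume w: "w = prod_encode (j, i)" "j < r"
    show ?thesis using funpow_mod_eq[OF y(2)[rule_format, OF w(2)], of "Suc i"] by (simp add: w)
  qed
  show "cycle_map N T' y (T f) = T' (cycle_map N T' y f)" if f: "f \<in> carrier P" for f
  proof (rule perm_hom_induct[OF N _ _ _ f])
    show "(\<lambda>f. cycle_map N T' y (T f)) \<in> module_homs R PR N"
      by (rule module_homI) (simp_all only: module_homD[OF hom] module_homD[OF T_hom])
    show "(\<lambda>f. T' (cycle_map N T' y f)) \<in> module_homs R PR N"
      by (rule module_homI) (simp_all only: module_homD[OF hom] module_homD[OF T'])
    show "cycle_map N T' y (T (basis w)) = T' (cycle_map N T' y (basis w))" if "w \<in> points" for w
      using that by (simp only: T_basis b cycle_shift_closed eqv)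
  qed
qed

end

section \<open>Kernels of maps from permutation modules\<close>

context cyclic_G_set
begin

text \<open>If the image of \<open>f\<close> is divisible by \<open>p\<close> but \<open>f\<close> is not, multiply \<open>f\<close> by the last power of \<open>x\<close> for
  which the product is still not divisible by \<open>p\<close>. The resulting vector \<open>v\<close> is annihilated by \<open>x\<close>
  modulo \<open>p\<close>, so it is constant on each cycle modulo \<open>p\<close>, and its image is a combination of the sums
  of the orbits of the vectors \<open>y j\<close>. These sums are independent modulo \<open>p\<close>, so all coefficients,
  and with them \<open>v\<close>, are divisible by \<open>p\<close>.\<close>

lemma cycle_map_p_injective:
  assumes N: "coflasque_endo R p \<pi> N T' n F0"
    and y: "\<forall>j<r. y j \<in> carrier N" "\<forall>j<r. (T' ^^ (p ^ e j)) (y j) = y j"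
    and indep: "\<And>c j. c \<in> {..<r} \<rightarrow> carrier R \<Longrightarrow>
        (\<Oplus>\<^bsub>N\<^esub>j\<in>{..<r}. c j \<odot>\<^bsub>N\<^esub> (\<Oplus>\<^bsub>N\<^esub>i\<in>{..<p ^ e j}. (T' ^^ i) (y j))) \<in> p_local_module.pM \<pi> N \<Longrightarrow>
        j < r \<Longrightarrow> c j \<notin> Units R"
    and f: "f \<in> carrier P" "cycle_map N T' y f \<in> p_local_module.pM \<pi> N"
  shows "f \<in> PM.pM"
proof -
  interpret N: coflasque_endo R p \<pi> N T' n F0 by fact
  note cm = cycle_map[OF N.module_axioms N.T_hom y]
  let ?i = "cycle_map N T' y"
  note iD = module_homD[OF cm(2)]
  have iP: "?i v \<in> carrier N" if "v \<in> carrier P" for v using iD(1) that by simp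
  note pN = N.submoduleD[OF N.pM_submodule]
  have xstep: "?i (T v \<ominus>\<^bsub>PR\<^esub> v) \<in> N.pM" if v: "v \<in> carrier P" and iv: "?i v \<in> N.pM" for v
  proof -
    have cl: "T v \<ominus>\<^bsub>PR\<^esub> v \<in> carrier PR" "v \<in> carrier PR"
      using v T_closed_P[OF v] PM.M.minus_closed[of "T v" v] by simp_all
    have "?i (T v \<ominus>\<^bsub>PR\<^esub> v) \<oplus>\<^bsub>N\<^esub> ?i v = ?i ((T v \<ominus>\<^bsub>PR\<^esub> v) \<oplus>\<^bsub>PR\<^esub> v)"
      using iD(2)[OF cl] by simp
    also have "(T v \<ominus>\<^bsub>PR\<^esub> v) \<oplus>\<^bsub>PR\<^esub> v = T v"
      using v T_closed_P[OF v] by (intro PM.M.diff_add_cancel1) auto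
    also have "?i (T v) = T' (?i v)" using v by (rule cm(4))
    finally have eq: "?i (T v \<ominus>\<^bsub>PR\<^esub> v) \<oplus>\<^bsub>N\<^esub> ?i v = T' (?i v)" .
    have "T' (?i v) \<in> N.pM" using N.act_pM[OF iv, of "1 + poly_x"] iP[OF v] by (simp only: N.act_one_plus_x)
    then have "(?i (T v \<ominus>\<^bsub>PR\<^esub> v) \<oplus>\<^bsub>N\<^esub> ?i v) \<ominus>\<^bsub>N\<^esub> ?i v \<in> N.pM"
      unfolding eq using iv by (rule pN(4))
    then show ?thesis using iD(1)[OF cl(1)] iP[OF v] by (simp only: N.M.add_diff_cancel_right1)
  qed
  have aP: "PM.act h v \<in> carrier P" if "v \<in> carrier P" for h v using PM.act_closed[of v h] that by simp
  have ix: "?i (PM.act (poly_x ^ t) f) \<in> N.pM" for t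
  proof (induction t)
    case (Suc t)
    have "PM.act (poly_x ^ Suc t) f = T (PM.act (poly_x ^ t) f) \<ominus>\<^bsub>PR\<^esub> PM.act (poly_x ^ t) f"
      using f aP by (simp only: power_Suc PM.act_mult PM.act_x restrict_scalars_simps)
    then show ?case using xstep[OF aP[OF f(1)] Suc] by simp
  qed (use f in simp)
  have socle: "v \<in> PM.pM"
    if v: "v \<in> carrier P" "?i v \<in> N.pM" "T v \<ominus>\<^bsub>PR\<^esub> v \<in> PM.pM" for v
  proof -
    obtain u where u: "u \<in> carrier P" "T v \<ominus>\<^bsub>PR\<^esub> v = \<pi> \<odot>\<^bsub>PR\<^esub> u"
      using v(3) by (auto simp: PM.pM_iff simp del: restrict_scalars_simps(4))
    have pu: "\<pi> \<odot>\<^bsub>PR\<^esub> u \<in> carrier PR" using u by (intro PM.smult_closed) auto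
    have "T v = \<pi> \<odot>\<^bsub>PR\<^esub> u \<oplus>\<^bsub>PR\<^esub> v"
      unfolding u(2)[symmetric] by (rule PM.M.diff_add_cancel1[symmetric]) (use v T_closed_P in auto)
    then have Tv: "T v w = \<pi> \<otimes> u w \<oplus> v w" if "w \<in> points" for w
      using PR_smult_eval[OF pi_closed u(1) that] that by (simp only: PR_add_eval)
    define c where "c j = v (prod_encode (j, 0))" for j
    have cR: "c j \<in> carrier R" if "j < r" for j
      unfolding c_def using v(1) that by (intro P_closed_eval) auto
    have const: "\<exists>b\<in>carrier R. v (prod_encode (j, i)) = c j \<oplus> \<pi> \<otimes> b" if "j < r" "i < p ^ e j" for j i
      using that(2)
    proof (induction i)
      case 0
      then show ?case using cR[OF that(1)] by (intro bexI[of _ \<zero>]) (auto simp: c_def)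
    next
      case (Suc i)
      let ?w = "prod_encode (j, i)" and ?w' = "prod_encode (j, Suc i)"
      have w: "?w \<in> points" "?w' \<in> points" using that Suc.prems by auto
      have R: "v ?w' \<in> carrier R" "u ?w' \<in> carrier R" using v(1) u(1) w by (auto intro: P_closed_eval)
      obtain b where b: "b \<in> carrier R" "v ?w = c j \<oplus> \<pi> \<otimes> b" using Suc by auto
      have "v ?w = T v (shift 1 ?w)" using T_shift[OF v(1) w(1)] by simp
      also have "shift 1 ?w = ?w'" using Suc.prems by simp
      also have "T v ?w' = \<pi> \<otimes> u ?w' \<oplus> v ?w'" by (rule Tv[OF w(2)])
      finally have "v ?w' = v ?w \<ominus> \<pi> \<otimes> u ?w'" using R by (simp add: R.add_diff_cancel_left1)
      also have "\<dots> = c j \<oplus> \<pi> \<otimes> (b \<ominus> u ?w')"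
        unfolding b(2) using b(1) cR[OF that(1)] R by (simp add: a_minus_def r_distr r_minus a_assoc)
      finally show ?case using b(1) R by auto
    qed
    \<comment> \<open>the vector congruent to \<open>v\<close> that is constant on cycles; its image is a sum of orbit sums\<close>
    define v0 where "v0 = (\<lambda>w\<in>points. c (fst (prod_decode w)))"
    have v0: "v0 \<in> carrier P" using cR by (auto simp: v0_def P_simps elim!: cycle_points_cases)
    have "\<exists>z\<in>carrier P. v = v0 \<oplus>\<^bsub>PR\<^esub> \<pi> \<odot>\<^bsub>PR\<^esub> z"
      using const by (intro P_decompose[OF v(1) v0]) (auto simp: v0_def elim!: cycle_points_cases)
    then obtain z where z: "z \<in> carrier P" "v = v0 \<oplus>\<^bsub>PR\<^esub> \<pi> \<odot>\<^bsub>PR\<^esub> z" by blast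
    have "?i v = ?i v0 \<oplus>\<^bsub>N\<^esub> \<pi> \<odot>\<^bsub>N\<^esub> ?i z"
      unfolding z(2) using v0 z(1) PM.smult_closed[of \<pi> z] iD(2)[of v0 "\<pi> \<odot>\<^bsub>PR\<^esub> z"] iD(3)[of \<pi> z] by simp
    then have "(?i v0 \<oplus>\<^bsub>N\<^esub> \<pi> \<odot>\<^bsub>N\<^esub> ?i z) \<ominus>\<^bsub>N\<^esub> \<pi> \<odot>\<^bsub>N\<^esub> ?i z \<in> N.pM"
      using v(2) iP[OF z(1)] by (intro pN(4) N.pM_I) auto
    then have iv0: "?i v0 \<in> N.pM" using iP[OF v0] iP[OF z(1)] by (simp only: N.M.add_diff_cancel_right1 N.smult_closed pi_closed)
    have yk: "(T' ^^ i) (y j) \<in> carrier N" if "j < r" for i j using y(1) that by simp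
    have "?i v0 = (\<Oplus>\<^bsub>N\<^esub>w\<in>points. v0 w \<odot>\<^bsub>N\<^esub> cycle_vector T' y w)"
      unfolding cycle_map_def using v0 cm(1)
      by (intro linear_extension_eq[OF N.module_axioms finite_cycle_points])
        (auto simp: coefficient_support_def P_simps)
    also have "\<dots> = (\<Oplus>\<^bsub>N\<^esub>j\<in>{..<r}. \<Oplus>\<^bsub>N\<^esub>i\<in>{..<p ^ e j}. v0 (prod_encode (j, i)) \<odot>\<^bsub>N\<^esub> cycle_vector T' y (prod_encode (j, i)))"
      using cR yk by (intro N.M.finsum_cycle_points) (auto simp: v0_def)
    also have "\<dots> = (\<Oplus>\<^bsub>N\<^esub>j\<in>{..<r}. c j \<odot>\<^bsub>N\<^esub> (\<Oplus>\<^bsub>N\<^esub>i\<in>{..<p ^ e j}. (T' ^^ i) (y j)))"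
    proof (intro N.M.finsum_cong' refl)
      fix j assume j: "j \<in> {..<r}"
      have "(\<Oplus>\<^bsub>N\<^esub>i\<in>{..<p ^ e j}. v0 (prod_encode (j, i)) \<odot>\<^bsub>N\<^esub> cycle_vector T' y (prod_encode (j, i)))
        = (\<Oplus>\<^bsub>N\<^esub>i\<in>{..<p ^ e j}. c j \<odot>\<^bsub>N\<^esub> (T' ^^ i) (y j))"
        using j cR yk by (intro N.M.finsum_cong') (auto simp: v0_def)
      also have "\<dots> = c j \<odot>\<^bsub>N\<^esub> (\<Oplus>\<^bsub>N\<^esub>i\<in>{..<p ^ e j}. (T' ^^ i) (y j))"
        using j cR yk by (intro N.finsum_smult_ldistr[symmetric]) auto
      finally show "(\<Oplus>\<^bsub>N\<^esub>i\<in>{..<p ^ e j}. v0 (prod_encode (j, i)) \<odot>\<^bsub>N\<^esub> cycle_vector T' y (prod_encode (j, i)))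
        = c j \<odot>\<^bsub>N\<^esub> (\<Oplus>\<^bsub>N\<^esub>i\<in>{..<p ^ e j}. (T' ^^ i) (y j))" .
    qed (use cR yk in \<open>auto intro!: N.M.finsum_closed N.smult_closed\<close>)
    finally have "(\<Oplus>\<^bsub>N\<^esub>j\<in>{..<r}. c j \<odot>\<^bsub>N\<^esub> (\<Oplus>\<^bsub>N\<^esub>i\<in>{..<p ^ e j}. (T' ^^ i) (y j))) \<in> N.pM"
      using iv0 by simp
    then have cnu: "c j \<notin> Units R" if "j < r" for j
      using indep[of c j] cR that by auto
    have "\<exists>z\<in>carrier P. v = \<zero>\<^bsub>PR\<^esub> \<oplus>\<^bsub>PR\<^esub> \<pi> \<odot>\<^bsub>PR\<^esub> z"
    proof (rule P_decompose[OF v(1)])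
      fix w assume "w \<in> points"
      then obtain j i where w: "w = prod_encode (j, i)" "j < r" "i < p ^ e j" by (rule cycle_points_cases)
      obtain b where b: "b \<in> carrier R" "v w = c j \<oplus> \<pi> \<otimes> b" using const[OF w(2,3)] w(1) by blast
      obtain d where d: "d \<in> carrier R" "c j = \<pi> \<otimes> d" using nonunit_dvd[OF cR[OF w(2)] cnu[OF w(2)]] by blast
      have "v w = \<zero>\<^bsub>PR\<^esub> w \<oplus> \<pi> \<otimes> (d \<oplus> b)"
        using b d \<open>w \<in> points\<close> by (simp add: P_simps r_distr)
      then show "\<exists>u\<in>carrier R. v w = \<zero>\<^bsub>PR\<^esub> w \<oplus> \<pi> \<otimes> u" using b(1) d(1) by blast
    qed (use PM.M.zero_closed in simp)
    then obtain z where z: "z \<in> carrier PR" "v = \<zero>\<^bsub>PR\<^esub> \<oplus>\<^bsub>PR\<^esub> \<pi> \<odot>\<^bsub>PR\<^esub> z" by auto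
    have "v = \<pi> \<odot>\<^bsub>PR\<^esub> z" unfolding z(2) by (rule PM.M.l_zero[OF PM.smult_closed[OF pi_closed z(1)]])
    then show ?thesis using PM.pM_I[OF z(1)] by (simp only:)
  qed
  show ?thesis
  proof (rule ccontr)
    assume nf: "f \<notin> PM.pM"
    have "f \<in> PM.fixed n" using f(1) g_act_period[OF P_module f(1)] by (simp add: PM.fixed_def)
    then have ex: "PM.act (poly_x ^ (p ^ n)) f \<in> PM.pM" by (rule PM.fixed_x_power)
    define t where "t = (LEAST t. PM.act (poly_x ^ t) f \<in> PM.pM)"
    have t: "PM.act (poly_x ^ t) f \<in> PM.pM" 
      unfolding t_def by (rule LeastI[of "\<lambda>t. PM.act (poly_x ^ t) f \<in> PM.pM", OF ex])
    have "t \<noteq> 0"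
    proof
      assume "t = 0"
      then show False using t nf f(1) by simp
    qed
    then obtain s where s: "t = Suc s" using not0_implies_Suc by blast
    have "T (PM.act (poly_x ^ s) f) \<ominus>\<^bsub>PR\<^esub> PM.act (poly_x ^ s) f \<in> PM.pM"
      using t f aP unfolding s by (simp only: power_Suc PM.act_mult PM.act_x restrict_scalars_simps)
    then have "PM.act (poly_x ^ s) f \<in> PM.pM" by (rule socle[OF aP[OF f(1)] ix])
    then show False using not_less_Least[of s "\<lambda>t. PM.act (poly_x ^ t) f \<in> PM.pM"] s by (simp add: t_def)
  qed
qed

text \<open>Surjectivity is Nakayama's lemma for the image \<open>I\<close>: the submodule \<open>Q = I + pN\<close> is everything.
  Injectivity is Nakayama's lemma for the kernel \<open>K\<close>: an element of \<open>K\<close> is divisible by \<open>p\<close>, and as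
  \<open>N\<close> is torsion-free the quotient again lies in \<open>K\<close>, so \<open>K = pK\<close>.\<close>

lemma cycle_map_bij:
  assumes N: "coflasque_endo R p \<pi> N T' n F0"
    and y: "\<forall>j<r. y j \<in> carrier N" "\<forall>j<r. (T' ^^ (p ^ e j)) (y j) = y j"
    and indep: "\<And>c j. c \<in> {..<r} \<rightarrow> carrier R \<Longrightarrow>
        (\<Oplus>\<^bsub>N\<^esub>j\<in>{..<r}. c j \<odot>\<^bsub>N\<^esub> (\<Oplus>\<^bsub>N\<^esub>i\<in>{..<p ^ e j}. (T' ^^ i) (y j))) \<in> p_local_module.pM \<pi> N \<Longrightarrow>
        j < r \<Longrightarrow> c j \<notin> Units R"
    and gen: "\<And>Q. submodule Q R N \<Longrightarrow> p_local_module.pM \<pi> N \<subseteq> Q \<Longrightarrow> \<forall>v\<in>Q. T' v \<in> Q \<Longrightarrow>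
        \<forall>j<r. y j \<in> Q \<Longrightarrow> Q = carrier N"
  shows "bij_betw (cycle_map N T' y) (carrier P) (carrier N)"
proof -
  interpret N: coflasque_endo R p \<pi> N T' n F0 by fact
  note cm = cycle_map[OF N.module_axioms N.T_hom y]
  let ?i = "cycle_map N T' y"
  note iD = module_homD[OF cm(2)]
  have iP: "?i v \<in> carrier N" if "v \<in> carrier P" for v using iD(1) that by simp
  have i0: "?i \<zero>\<^bsub>PR\<^esub> = \<zero>\<^bsub>N\<^esub>"
    using iD(3)[OF R.zero_closed PM.M.zero_closed] iD(1)[OF PM.M.zero_closed]
      PM.smult_l_null[OF PM.M.zero_closed] by (simp del: restrict_scalars_simps)
  define I where "I = ?i ` carrier PR"
  have I: "submodule I R N"
  proof (rule N.submodule_intro)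
    show "I \<subseteq> carrier N" using iP by (auto simp: I_def)
    show "\<zero>\<^bsub>N\<^esub> \<in> I" unfolding I_def using i0 PM.M.zero_closed by (metis image_eqI)
    show "a \<oplus>\<^bsub>N\<^esub> b \<in> I" if ab: "a \<in> I" "b \<in> I" for a b
    proof -
      obtain f where f: "a = ?i f" "f \<in> carrier PR" using ab(1) unfolding I_def by (rule imageE)
      obtain f' where f': "b = ?i f'" "f' \<in> carrier PR" using ab(2) unfolding I_def by (rule imageE)
      show ?thesis unfolding I_def f(1) f'(1) iD(2)[OF f(2) f'(2), symmetric]
        by (rule imageI[OF PM.M.a_closed[OF f(2) f'(2)]])
    qed
    show "s \<odot>\<^bsub>N\<^esub> a \<in> I" if sa: "s \<in> carrier R" "a \<in> I" for s a
    proof -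
      obtain f where f: "a = ?i f" "f \<in> carrier PR" using sa(2) unfolding I_def by (rule imageE)
      show ?thesis unfolding I_def f(1) iD(3)[OF sa(1) f(2), symmetric]
        by (rule imageI[OF PM.smult_closed[OF sa(1) f(2)]])
    qed
  qed
  note ID = N.submoduleD[OF I]
  define Q where "Q = {v. \<exists>w\<in>I. \<exists>z\<in>carrier N. v = w \<oplus>\<^bsub>N\<^esub> \<pi> \<odot>\<^bsub>N\<^esub> z}"
  have Q: "submodule Q R N"
  proof -
    have "Q = {v. \<exists>w\<in>I. \<exists>z\<in>carrier N. v = N.act 1 w \<oplus>\<^bsub>N\<^esub> \<pi> \<odot>\<^bsub>N\<^esub> z}"
      unfolding Q_def by (intro Collect_cong bex_cong refl) (simp add: ID(1))
    then show ?thesis using N.image_plus_pM_submodule[OF I, of 1] by simp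
  qed
  have Q_I: "v \<in> Q" if "w \<in> I" "z \<in> carrier N" "v = w \<oplus>\<^bsub>N\<^esub> \<pi> \<odot>\<^bsub>N\<^esub> z" for v w z
    unfolding Q_def using that by blast
  have "Q = carrier N"
  proof (rule gen)
    show "submodule Q R N" by (rule Q)
    show "N.pM \<subseteq> Q"
    proof
      fix v assume "v \<in> N.pM"
      then obtain z where "z \<in> carrier N" "v = \<pi> \<odot>\<^bsub>N\<^esub> z" by (auto simp: N.pM_iff)
      then show "v \<in> Q" by (intro Q_I[OF ID(2)]) auto
    qed
    show "\<forall>v\<in>Q. T' v \<in> Q"
    proof
      fix v assume "v \<in> Q"
      then obtain w z where wz: "w \<in> I" "z \<in> carrier N" "v = w \<oplus>\<^bsub>N\<^esub> \<pi> \<odot>\<^bsub>N\<^esub> z"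
        unfolding Q_def by blast
      from wz(1) obtain f where f: "f \<in> carrier P" "w = ?i f" by (auto simp: I_def)
      have "T' w \<in> I"
        unfolding I_def f(2) cm(4)[OF f(1), symmetric] by (rule imageI) (simp add: T_closed_P[OF f(1)])
      moreover have "T' v = T' w \<oplus>\<^bsub>N\<^esub> \<pi> \<odot>\<^bsub>N\<^esub> T' z"
        unfolding wz(3) using wz ID(1) by (simp add: N.T_add N.T_smult)
      ultimately show "T' v \<in> Q" by (intro Q_I) (use wz(2) in auto)
    qed
    show "\<forall>j<r. y j \<in> Q"
    proof (intro allI impI)
      fix j assume j: "j < r"
      have "prod_encode (j, 0) \<in> points" using j by simp
      from cm(3)[OF this] have "y j = ?i (basis (prod_encode (j, 0)))" by simp
      then have yI: "y j \<in> I" unfolding I_def using basis_closed by simp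
      then show "y j \<in> Q" using ID(1) by (intro Q_I[OF yI N.zero_closed]) simp
    qed
  qed
  then have "\<exists>h\<in>I. \<exists>w\<in>carrier N. v = h \<oplus>\<^bsub>N\<^esub> \<pi> \<odot>\<^bsub>N\<^esub> w" if "v \<in> carrier N" for v
    using that unfolding Q_def by blast
  then have surj: "I = carrier N"
    by (intro N.nakayama[OF N.carrier_is_submodule I _ N.fin_gen(1,3)]) (use ID(1) in blast)+
  define K where "K = {f \<in> carrier PR. ?i f = \<zero>\<^bsub>N\<^esub>}"
  have K: "submodule K R PR"
    by (rule PM.submodule_intro) (auto simp: K_def iD i0 simp del: restrict_scalars_simps)
  have Z: "submodule {\<zero>\<^bsub>PR\<^esub>} R PR"
    by (rule PM.submodule_intro) (auto simp del: restrict_scalars_simps)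
  have "K \<subseteq> module_span R PR (basis ` points)" using basis_span by (auto simp: K_def)
  then have "\<exists>F. finite F \<and> F \<subseteq> K \<and> K = module_span R PR F"
    by (intro PM.finitely_generated_submodule[OF principal_domain_axioms _ _ K, of "basis ` points"])
      (use finite_cycle_points basis_closed in auto)
  then obtain F where F: "finite F" "K = module_span R PR F" by blast
  have "{\<zero>\<^bsub>PR\<^esub>} = K"
  proof (rule PM.nakayama[OF K Z _ F])
    show "{\<zero>\<^bsub>PR\<^esub>} \<subseteq> K" using PM.submoduleD(2)[OF K] by blast
    fix v assume v: "v \<in> K"
    then have vP: "v \<in> carrier P" "?i v = \<zero>\<^bsub>N\<^esub>" by (auto simp: K_def)
    have "?i v \<in> N.pM" using N.submoduleD(2)[OF N.pM_submodule] vP(2) by simp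
    then have "v \<in> PM.pM" by (intro cycle_map_p_injective[OF N y _ vP(1)]) (use indep in blast)+
    then obtain w where w: "w \<in> carrier PR" "v = \<pi> \<odot>\<^bsub>PR\<^esub> w" by (auto simp only: PM.pM_iff)
    have "\<pi> \<odot>\<^bsub>N\<^esub> ?i w = \<zero>\<^bsub>N\<^esub>" using iD(3)[OF pi_closed w(1)] w(2) vP(2) by (simp only:)
    then have "?i w = \<zero>\<^bsub>N\<^esub>" by (rule N.torsion_free[OF iD(1)[OF w(1)]])
    then have "w \<in> K" using w(1) by (simp add: K_def)
    moreover have "v = \<zero>\<^bsub>PR\<^esub> \<oplus>\<^bsub>PR\<^esub> \<pi> \<odot>\<^bsub>PR\<^esub> w"
      unfolding w(2) by (rule PM.M.l_zero[OF PM.smult_closed[OF pi_closed w(1)], symmetric])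
    ultimately show "\<exists>h\<in>{\<zero>\<^bsub>PR\<^esub>}. \<exists>w\<in>K. v = h \<oplus>\<^bsub>PR\<^esub> \<pi> \<odot>\<^bsub>PR\<^esub> w" by blast
  qed
  then have ker: "v = \<zero>\<^bsub>PR\<^esub>" if "v \<in> carrier PR" "?i v = \<zero>\<^bsub>N\<^esub>" for v
    using that by (auto simp: K_def simp del: restrict_scalars_simps)
  have "inj_on ?i (carrier P)"
  proof (rule inj_onI)
    fix a b assume ab: "a \<in> carrier P" "b \<in> carrier P" "?i a = ?i b"
    have c: "a \<in> carrier PR" "b \<in> carrier PR" "a \<ominus>\<^bsub>PR\<^esub> b \<in> carrier PR"
      using ab PM.M.minus_closed[of a b] by auto
    have ba: "(a \<ominus>\<^bsub>PR\<^esub> b) \<oplus>\<^bsub>PR\<^esub> b = a" by (rule PM.M.diff_add_cancel1[OF c(1,2)])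
    have "?i (a \<ominus>\<^bsub>PR\<^esub> b) \<oplus>\<^bsub>N\<^esub> ?i b = ?i a"
      using iD(2)[OF c(3,2)] unfolding ba by (rule sym)
    also have "\<dots> = \<zero>\<^bsub>N\<^esub> \<oplus>\<^bsub>N\<^esub> ?i b"
      unfolding ab(3) by (rule N.M.l_zero[OF iD(1)[OF c(2)], symmetric])
    finally have "?i (a \<ominus>\<^bsub>PR\<^esub> b) = \<zero>\<^bsub>N\<^esub>" using iD(1)[OF c(2)] iD(1)[OF c(3)] by simp
    then have "a \<ominus>\<^bsub>PR\<^esub> b = \<zero>\<^bsub>PR\<^esub>" by (rule ker[OF c(3)])
    then show "a = b" using ba PM.M.l_zero[OF c(2)] by (simp only:)
  qed
  then show ?thesis using surj by (simp add: bij_betw_def I_def)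
qed

text \<open>Let \<open>v\<close> be a vector of the kernel fixed modulo \<open>p\<close>, say with \<open>T ^ k v = v + p z\<close>. In the
  permutation module one can write \<open>v = f1 + p u\<close> with \<open>f1\<close> fixed. Then \<open>T ^ k u = u + z\<close>, so the
  image of \<open>u\<close> is fixed, because \<open>z\<close> lies in the kernel. By assumption it is also the image of a
  fixed vector \<open>u'\<close>, and \<open>v = (f1 + p u') + p (u - u')\<close> is a decomposition inside the kernel.\<close>

lemma kernel_coflasque:
  assumes N: "module R N" and T': "T' \<in> module_homs R N N"
    and q: "q \<in> module_homs R PR N" and qT: "\<And>f. f \<in> carrier P \<Longrightarrow> q (T f) = T' (q f)"
    and lift: "\<And>m v. m \<le> n \<Longrightarrow> v \<in> carrier N \<Longrightarrow> (T' ^^ (p ^ m)) v = v \<Longrightarrow>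
        \<exists>u\<in>carrier P. (T ^^ (p ^ m)) u = u \<and> q u = v"
  shows "\<exists>F. coflasque_endo R p \<pi> (PR\<lparr>carrier := {f \<in> carrier P. q f = \<zero>\<^bsub>N\<^esub>}\<rparr>) T n F"
proof -
  interpret N: module R N by fact
  note qD = module_homD[OF q] and T'D = module_homD[OF T']
  have q0: "q \<zero>\<^bsub>PR\<^esub> = \<zero>\<^bsub>N\<^esub>"
    using qD(3)[OF R.zero_closed PM.M.zero_closed] qD(1)[OF PM.M.zero_closed]
      PM.smult_l_null[OF PM.M.zero_closed] by (simp del: restrict_scalars_simps)
  have T'0: "T' \<zero>\<^bsub>N\<^esub> = \<zero>\<^bsub>N\<^esub>" using T'D(3)[OF R.zero_closed N.zero_closed] T'D(1)[OF N.zero_closed] by simp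
  define L where "L = {f \<in> carrier P. q f = \<zero>\<^bsub>N\<^esub>}"
  let ?L = "PR\<lparr>carrier := L\<rparr>"
  have LPR: "L = {f \<in> carrier PR. q f = \<zero>\<^bsub>N\<^esub>}" by (simp add: L_def)
  have L: "submodule L R PR" unfolding LPR
    by (rule PM.submodule_intro) (auto simp: qD q0 simp del: restrict_scalars_simps)
  have LM: "module R ?L" by (rule submodule.submodule_is_module[OF L PR_module])
  note LD = PM.submoduleD[OF L]
  have TL: "T f \<in> L" if "f \<in> L" for f
    using that T_closed_P qT T'0 by (auto simp: L_def)
  have TkL: "(T ^^ k) f \<in> L" if "f \<in> L" for f k
    using that by (induction k) (auto simp: TL)
  have qTk: "q ((T ^^ k) f) = (T' ^^ k) (q f)" if "f \<in> carrier P" for f k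
    using that by (induction k) (auto simp: qT Tk_closed)
  have "L \<subseteq> module_span R PR (basis ` points)" using basis_span by (auto simp: L_def)
  then have "\<exists>F. finite F \<and> F \<subseteq> L \<and> L = module_span R PR F"
    by (intro PM.finitely_generated_submodule[OF principal_domain_axioms _ _ L, of "basis ` points"])
      (use finite_cycle_points basis_closed in auto)
  then obtain F where F: "finite F" "F \<subseteq> L" "L = module_span R PR F" by blast
  have "coflasque_endo R p \<pi> ?L T n F"
  proof (intro coflasque_endo.intro p_local_endo.intro p_local_module.intro p_local_pid_axioms LM
      p_local_endo_axioms.intro coflasque_endo_axioms.intro)
    show "T \<in> module_homs R ?L ?L"
    proof (rule module_homI)
      show "T (f \<oplus>\<^bsub>?L\<^esub> f') = T f \<oplus>\<^bsub>?L\<^esub> T f'" if "f \<in> carrier ?L" "f' \<in> carrier ?L" for f f'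
        using that PM.T_add[of f f'] by (simp add: L_def)
      show "T (s \<odot>\<^bsub>?L\<^esub> f) = s \<odot>\<^bsub>?L\<^esub> T f" if "s \<in> carrier R" "f \<in> carrier ?L" for s f
        using that PM.T_smult[of s f] by (simp add: L_def)
    qed (use TL in simp)
    show "(T ^^ (p ^ n)) v = v" if "v \<in> carrier ?L" for v
      using that g_act_period[OF P_module] by (simp add: L_def)
    show "v = \<zero>\<^bsub>?L\<^esub>" if "v \<in> carrier ?L" "\<pi> \<odot>\<^bsub>?L\<^esub> v = \<zero>\<^bsub>?L\<^esub>" for v
      using that P_torsion_free[of v] by (simp add: L_def)
    show "finite F" by (rule F(1))
    show "F \<subseteq> carrier ?L" using F(2) by simp
    show "carrier ?L = module_span R ?L F" using F(3) by (simp add: module_span_carrier_update)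
    show "\<exists>w\<in>carrier ?L. (T ^^ (p ^ m)) w = w \<and> (\<exists>z'\<in>carrier ?L. v = w \<oplus>\<^bsub>?L\<^esub> \<pi> \<odot>\<^bsub>?L\<^esub> z')"
      if m: "m \<le> n" and vz: "v \<in> carrier ?L" "z \<in> carrier ?L" and eq: "(T ^^ (p ^ m)) v = v \<oplus>\<^bsub>?L\<^esub> \<pi> \<odot>\<^bsub>?L\<^esub> z" for m v z
    proof -
      let ?k = "p ^ m"
      have v: "v \<in> carrier PR" "v \<in> L" and z: "z \<in> carrier PR" "q z = \<zero>\<^bsub>N\<^esub>" using vz by (auto simp: L_def)
      have eq': "(T ^^ ?k) v = v \<oplus>\<^bsub>PR\<^esub> \<pi> \<odot>\<^bsub>PR\<^esub> z" using eq by simp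
      have "\<exists>f1\<in>carrier P. (T ^^ ?k) f1 = f1 \<and> (\<exists>z'\<in>carrier P. v = f1 \<oplus>\<^bsub>PR\<^esub> \<pi> \<odot>\<^bsub>PR\<^esub> z')"
        by (rule P_fixed_lift[OF _ _ eq']) (use v z in simp_all)
      then obtain f1 u where f1: "f1 \<in> carrier PR" "(T ^^ ?k) f1 = f1" and u: "u \<in> carrier PR"
        and vf: "v = f1 \<oplus>\<^bsub>PR\<^esub> \<pi> \<odot>\<^bsub>PR\<^esub> u" by auto
      have Tk: "(T ^^ ?k) (a \<oplus>\<^bsub>PR\<^esub> \<pi> \<odot>\<^bsub>PR\<^esub> b) = (T ^^ ?k) a \<oplus>\<^bsub>PR\<^esub> \<pi> \<odot>\<^bsub>PR\<^esub> (T ^^ ?k) b"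
        if "a \<in> carrier PR" "b \<in> carrier PR" for a b
      proof -
        have pb: "\<pi> \<odot>\<^bsub>PR\<^esub> b \<in> carrier PR" using that(2) by (intro PM.smult_closed pi_closed)
        show ?thesis
          unfolding PM.act_T_power[OF that(1), symmetric] PM.act_T_power[OF that(2), symmetric]
            PM.act_T_power[OF PM.M.a_closed[OF that(1) pb], symmetric]
          by (simp only: PM.act_add_right[OF that(1) pb] PM.act_smult_right[OF that(2) pi_closed])
      qed
      have Tu: "(T ^^ ?k) u \<in> carrier PR" using PM.funpow_T_closed[OF u] .
      have pu: "\<pi> \<odot>\<^bsub>PR\<^esub> u \<in> carrier PR" "\<pi> \<odot>\<^bsub>PR\<^esub> z \<in> carrier PR" "\<pi> \<odot>\<^bsub>PR\<^esub> (T ^^ ?k) u \<in> carrier PR"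
        by (rule PM.smult_closed[OF pi_closed u] PM.smult_closed[OF pi_closed z(1)] PM.smult_closed[OF pi_closed Tu])+
      have "f1 \<oplus>\<^bsub>PR\<^esub> \<pi> \<odot>\<^bsub>PR\<^esub> (T ^^ ?k) u = (T ^^ ?k) v"
        unfolding vf Tk[OF f1(1) u] f1(2) ..
      also have "\<dots> = f1 \<oplus>\<^bsub>PR\<^esub> (\<pi> \<odot>\<^bsub>PR\<^esub> u \<oplus>\<^bsub>PR\<^esub> \<pi> \<odot>\<^bsub>PR\<^esub> z)"
        unfolding eq' unfolding vf by (rule PM.M.a_assoc[OF f1(1) pu(1,2)])
      also have "\<pi> \<odot>\<^bsub>PR\<^esub> u \<oplus>\<^bsub>PR\<^esub> \<pi> \<odot>\<^bsub>PR\<^esub> z = \<pi> \<odot>\<^bsub>PR\<^esub> (u \<oplus>\<^bsub>PR\<^esub> z)"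
        by (rule PM.smult_r_distr[OF pi_closed u z(1), symmetric])
      finally have "\<pi> \<odot>\<^bsub>PR\<^esub> (T ^^ ?k) u = \<pi> \<odot>\<^bsub>PR\<^esub> (u \<oplus>\<^bsub>PR\<^esub> z)"
        using PM.M.add.l_cancel[of f1 "\<pi> \<odot>\<^bsub>PR\<^esub> (T ^^ ?k) u" "\<pi> \<odot>\<^bsub>PR\<^esub> (u \<oplus>\<^bsub>PR\<^esub> z)"]
          f1(1) pu(3) PM.smult_closed[OF pi_closed PM.M.a_closed[OF u z(1)]]
        by (simp del: restrict_scalars_simps)
      then have "\<pi> \<odot>\<^bsub>PR\<^esub> ((T ^^ ?k) u \<ominus>\<^bsub>PR\<^esub> (u \<oplus>\<^bsub>PR\<^esub> z)) = \<zero>\<^bsub>PR\<^esub>"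
        using Tu u z(1) by (simp del: restrict_scalars_simps add: a_minus_def PM.smult_r_distr PM.smult_r_minus PM.M.r_neg)
      then have "(T ^^ ?k) u \<ominus>\<^bsub>PR\<^esub> (u \<oplus>\<^bsub>PR\<^esub> z) = \<zero>\<^bsub>PR\<^esub>"
        using P_torsion_free PM.M.minus_closed[OF Tu PM.M.a_closed[OF u z(1)]]
        by (simp only: restrict_scalars_simps(1))
      then have Tu_eq: "(T ^^ ?k) u = u \<oplus>\<^bsub>PR\<^esub> z"
        using PM.M.diff_add_cancel1[OF Tu PM.M.a_closed[OF u z(1)]] PM.M.l_zero[OF PM.M.a_closed[OF u z(1)]]
        by (simp only:)
      have "(T' ^^ ?k) (q u) = q u"
        using qTk[of u ?k] u qD(2)[OF u z(1)] z(2) qD(1)[OF u] unfolding Tu_eq by simp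
      then obtain u' where u': "u' \<in> carrier PR" "(T ^^ ?k) u' = u'" "q u' = q u"
        using lift[OF m qD(1)[OF u]] by auto
      define d where "d = u \<ominus>\<^bsub>PR\<^esub> u'"
      have d: "d \<in> carrier PR" "d \<oplus>\<^bsub>PR\<^esub> u' = u"
        unfolding d_def using PM.M.minus_closed[OF u u'(1)] PM.M.diff_add_cancel1[OF u u'(1)] by (simp_all only:)
      have "q d \<oplus>\<^bsub>N\<^esub> q u = \<zero>\<^bsub>N\<^esub> \<oplus>\<^bsub>N\<^esub> q u"
        using qD(2)[OF d(1) u'(1)] d(2) u'(3) qD(1)[OF u] by (simp only: N.l_zero)
      then have "q d = \<zero>\<^bsub>N\<^esub>" using qD(1)[OF d(1)] qD(1)[OF u] by simp
      then have dL: "d \<in> L" using d(1) by (simp add: L_def)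
      define w where "w = f1 \<oplus>\<^bsub>PR\<^esub> \<pi> \<odot>\<^bsub>PR\<^esub> u'"
      have pu': "\<pi> \<odot>\<^bsub>PR\<^esub> u' \<in> carrier PR" "\<pi> \<odot>\<^bsub>PR\<^esub> d \<in> carrier PR"
        by (rule PM.smult_closed[OF pi_closed u'(1)] PM.smult_closed[OF pi_closed d(1)])+
      have wP: "w \<in> carrier PR" unfolding w_def by (rule PM.M.a_closed[OF f1(1) pu'(1)])
      have "\<pi> \<odot>\<^bsub>PR\<^esub> u = \<pi> \<odot>\<^bsub>PR\<^esub> u' \<oplus>\<^bsub>PR\<^esub> \<pi> \<odot>\<^bsub>PR\<^esub> d"
        unfolding d(2)[symmetric] PM.smult_r_distr[OF pi_closed d(1) u'(1)] by (rule PM.M.a_comm[OF pu'(2,1)])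
      then have vw: "v = w \<oplus>\<^bsub>PR\<^esub> \<pi> \<odot>\<^bsub>PR\<^esub> d"
        unfolding w_def vf using PM.M.a_assoc[OF f1(1) pu'] by (simp only:)
      have "w = v \<ominus>\<^bsub>PR\<^esub> \<pi> \<odot>\<^bsub>PR\<^esub> d"
        unfolding vw by (rule PM.M.add_diff_cancel_right1[OF wP pu'(2), symmetric])
      then have wL: "w \<in> L" using LD(4)[OF v(2) LD(5)[OF pi_closed dL]] by (simp only:)
      have "(T ^^ ?k) w = w" unfolding w_def Tk[OF f1(1) u'(1)] f1(2) u'(2) ..
      then show ?thesis using wL dL vw by auto
    qed
  qed
  then show ?thesis unfolding L_def by blast
qed

end

section \<open>Permutation resolutions of lattices over cyclic p-groups\<close>

text \<open>An irreducible divisor of a nonzero nonunit generates a nonzero prime ideal, as \<open>p\<close> does, and there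
  is only one such ideal.\<close>

lemma discrete_valuation_domain_p_local_pid:
  fixes R :: "('r, 'a) ring_scheme" and p :: nat
  assumes "discrete_valuation_domain R" and "ring_char_zero R"
    and "normalization_semidom_class.prime p" and "maximalideal (PIdl\<^bsub>R\<^esub> ([p] \<cdot>\<^bsub>R\<^esub> \<one>\<^bsub>R\<^esub>)) R"
  shows "p_local_pid R p ([int p] \<cdot>\<^bsub>R\<^esub> \<one>\<^bsub>R\<^esub>)"
proof -
  interpret R: principal_domain R using assms(1) by (simp add: discrete_valuation_domain_def)
  define \<pi> where "\<pi> = [p] \<cdot>\<^bsub>R\<^esub> \<one>\<^bsub>R\<^esub>"
  have pi: "[int p] \<cdot>\<^bsub>R\<^esub> \<one>\<^bsub>R\<^esub> = \<pi>" by (simp add: \<pi>_def add_pow_int_ge)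
  have pc: "\<pi> \<in> carrier R" by (simp add: \<pi>_def)
  have nz: "\<pi> \<noteq> \<zero>\<^bsub>R\<^esub>"
    using assms(2,3) prime_gt_0_nat unfolding \<pi>_def ring_char_zero_def by blast
  have max: "maximalideal (PIdl\<^bsub>R\<^esub> \<pi>) R" using assms(4) by (simp add: \<pi>_def)
  have nonzero_ideal: "PIdl\<^bsub>R\<^esub> q \<noteq> {\<zero>\<^bsub>R\<^esub>}" if "q \<in> carrier R" "q \<noteq> \<zero>\<^bsub>R\<^esub>" for q
    using R.cgenideal_self[OF that(1)] that(2) by auto
  have nu: "\<pi> \<notin> Units R"
  proof
    assume u: "\<pi> \<in> Units R"
    have "PIdl\<^bsub>R\<^esub> \<pi> = carrier R"
    proof
      show "carrier R \<subseteq> PIdl\<^bsub>R\<^esub> \<pi>"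
      proof
        fix x assume x: "x \<in> carrier R"
        then have "x = (x \<otimes>\<^bsub>R\<^esub> inv\<^bsub>R\<^esub> \<pi>) \<otimes>\<^bsub>R\<^esub> \<pi>" using u by (simp add: R.m_assoc R.Units_closed)
        then show "x \<in> PIdl\<^bsub>R\<^esub> \<pi>" using x u unfolding cgenideal_def by blast
      qed
    qed (auto simp: cgenideal_def pc)
    then show False using maximalideal.I_notcarr[OF max] by simp
  qed
  have nonunit: "\<exists>b\<in>carrier R. a = \<pi> \<otimes>\<^bsub>R\<^esub> b" if a: "a \<in> carrier R" "a \<notin> Units R" for a
  proof (cases "a = \<zero>\<^bsub>R\<^esub>")
    case True
    then show ?thesis using pc by (intro bexI[of _ "\<zero>\<^bsub>R\<^esub>"]) auto
  next
    case False
    obtain q where q: "q \<in> carrier R" "ring_irreducible\<^bsub>R\<^esub> q" "q divides\<^bsub>R\<^esub> a"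
      by (rule R.exists_irreducible_divisor[of a]) (use False a in auto)
    have q0: "q \<noteq> \<zero>\<^bsub>R\<^esub>" using q(2) by (simp add: ring_irreducible_def)
    have "primeideal (PIdl\<^bsub>R\<^esub> q) R"
      using R.maximalideal_prime[OF R.irreducible_imp_maximalideal[OF q(1,2)]] .
    moreover have "primeideal (PIdl\<^bsub>R\<^esub> \<pi>) R" using R.maximalideal_prime[OF max] .
    ultimately have "PIdl\<^bsub>R\<^esub> q = PIdl\<^bsub>R\<^esub> \<pi>"
      using assms(1) nonzero_ideal[OF q(1) q0] nonzero_ideal[OF pc nz]
      unfolding discrete_valuation_domain_def by blast
    then have "q \<in> PIdl\<^bsub>R\<^esub> \<pi>" using R.cgenideal_self[OF q(1)] by simp
    then obtain c where c: "c \<in> carrier R" "q = c \<otimes>\<^bsub>R\<^esub> \<pi>" by (auto simp: cgenideal_def)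
    obtain d where d: "d \<in> carrier R" "a = q \<otimes>\<^bsub>R\<^esub> d" using q(3) by (auto simp: factor_def)
    have "a = \<pi> \<otimes>\<^bsub>R\<^esub> (c \<otimes>\<^bsub>R\<^esub> d)" using c d pc by (simp add: R.m_ac)
    then show ?thesis using c d by auto
  qed
  show ?thesis
    unfolding pi by (intro p_local_pid.intro p_local_pid_axioms.intro R.principal_domain_axioms assms(3) pi[symmetric] nz nu nonunit)
qed

lemma cyclic_p_group_generator:
  assumes G: "group G" "finite (carrier G)" "cyclic_group G" and N: "order G = N"
  shows "\<exists>g\<in>carrier G. (\<forall>h\<in>carrier G. \<exists>k::nat. h = g [^]\<^bsub>G\<^esub> k) \<and>
    (\<forall>a b :: nat. g [^]\<^bsub>G\<^esub> a = g [^]\<^bsub>G\<^esub> b \<longleftrightarrow> a mod N = b mod N)"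
proof -
  interpret G: group G by fact
  obtain g where g: "g \<in> carrier G" "subgroup_generated G {g} = G"
    using G(3) by (auto simp: cyclic_group_def)
  have car: "carrier G = generate G {g}"
  proof -
    have "carrier (subgroup_generated G {g}) = generate G (carrier G \<inter> {g})"
      by (rule carrier_subgroup_generated)
    moreover have "carrier G \<inter> {g} = {g}" using g(1) by auto
    ultimately show ?thesis unfolding g(2) by simp
  qed
  have ord: "G.ord g = N"
    using G.generate_pow_card[OF g(1)] car N by (simp add: Coset.order_def)
  have "carrier G \<noteq> {}" using g(1) by blast
  then have N0: "N > 0" using N G(2) by (auto simp: Coset.order_def card_gt_0_iff)
  have int_iff: "g [^]\<^bsub>G\<^esub> (a::int) = g [^]\<^bsub>G\<^esub> (b::int) \<longleftrightarrow> a mod int N = b mod int N" for a b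
    using G.int_pow_eq[OF g(1), of a b] ord by (metis dvd_diff_commute mod_eq_dvd_iff)
  have "g [^]\<^bsub>G\<^esub> a = g [^]\<^bsub>G\<^esub> b \<longleftrightarrow> a mod N = b mod N" for a b :: nat
    using int_iff[of "int a" "int b"] by (simp add: int_pow_int flip: of_nat_mod)
  moreover have "\<exists>k::nat. h = g [^]\<^bsub>G\<^esub> k" if hG: "h \<in> carrier G" for h
  proof -
    have "h \<in> carrier (subgroup_generated G {g})" using hG unfolding g(2) .
    then obtain i :: int where i: "h = g [^]\<^bsub>G\<^esub> i"
      unfolding G.carrier_subgroup_generated_by_singleton[OF g(1)] by blast
    have "g [^]\<^bsub>G\<^esub> i = g [^]\<^bsub>G\<^esub> int (nat (i mod int N))"
      using N0 by (subst int_iff) simp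
    then have "h = g [^]\<^bsub>G\<^esub> nat (i mod int N)" unfolding i int_pow_int .
    then show ?thesis by blast
  qed
  ultimately show ?thesis using g(1) by blast
qed

text \<open>The points of the \<open>G\<close>-set for \<open>P0\<close> come from the pairs \<open>(m, s)\<close> where \<open>s\<close> is one of the chosen
  generators of the fixed vectors of \<open>g ^ (p ^ m)\<close> in \<open>M\<close>; surjectivity of \<open>q\<close> itself is the case \<open>m = n\<close>.
  The kernel of \<open>q\<close> is coflasque, so it is the image of \<open>P1\<close>.\<close>

theorem (in cyclic_group_ring) lattice_permutation_resolution:
  assumes lat: "group_ring_lattice R G M"
  shows "\<exists>(\<Omega>\<^sub>0 :: nat set) \<phi>\<^sub>0 (\<Omega>\<^sub>1 :: nat set) \<phi>\<^sub>1 i q.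
           finite \<Omega>\<^sub>0 \<and> group_action G \<Omega>\<^sub>0 \<phi>\<^sub>0 \<and>
           finite \<Omega>\<^sub>1 \<and> group_action G \<Omega>\<^sub>1 \<phi>\<^sub>1 \<and>
           short_exact_lattices R G
             (permutation_module R G \<Omega>\<^sub>1 \<phi>\<^sub>1) i (permutation_module R G \<Omega>\<^sub>0 \<phi>\<^sub>0) q M"
proof -
  have M: "module S M" and fg: "finitely_generated_module S M"
    using lat by (auto simp: group_ring_lattice_def)
  define MR where "MR = restrict_scalars R G M"
  define TM where "TM = g_act M"
  have MRc: "carrier MR = carrier M" by (simp add: MR_def)
  have MRm: "module R MR" unfolding MR_def by (rule restrict_module[OF M])
  have TM: "TM \<in> module_homs R MR MR" unfolding MR_def TM_def by (rule g_act_hom[OF M])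
  interpret ME: p_local_endo R p \<pi> MR TM
    by (intro p_local_endo.intro p_local_module.intro p_local_endo_axioms.intro p_local_pid_axioms MRm TM)
  obtain F where F: "finite F" "F \<subseteq> carrier MR" "carrier MR = module_span R MR F"
    using finitely_generated_restrict[OF M fg] unfolding MR_def by auto
  have "\<exists>F'. finite F' \<and> F' \<subseteq> ME.fixed m \<and> ME.fixed m = module_span R MR F'" for m
    by (rule ME.finitely_generated_submodule[OF principal_domain_axioms F(1,2) ME.fixed_submodule])
      (use F(3) in \<open>auto simp: ME.fixed_def\<close>)
  then have "\<forall>m. \<exists>F'. finite F' \<and> F' \<subseteq> ME.fixed m \<and> ME.fixed m = module_span R MR F'" ..
  from choice[OF this] obtain Fm where Fm: "\<And>m. finite (Fm m)" "\<And>m. Fm m \<subseteq> ME.fixed m"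
    "\<And>m. ME.fixed m = module_span R MR (Fm m)" by auto
  define X where "X = Sigma {..n} Fm"
  have "finite X" unfolding X_def using Fm(1) by auto
  then obtain h where "bij_betw h {0..<card X} X" using ex_bij_betw_nat_finite by blast
  moreover define r0 where "r0 = card X"
  ultimately have h: "h ` {..<r0} = X" by (simp add: bij_betw_def atLeast0LessThan)
  define e0 y0 where "e0 = fst \<circ> h" and "y0 = snd \<circ> h"
  have hX: "e0 j \<le> n" "y0 j \<in> ME.fixed (e0 j)" if "j < r0" for j
  proof -
    have "h j \<in> X" using h that by blast
    then show "e0 j \<le> n" "y0 j \<in> ME.fixed (e0 j)"
      unfolding X_def e0_def y0_def using subsetD[OF Fm(2)] by auto
  qed
  interpret P0: cyclic_G_set R p \<pi> G g n e0 r0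
    by (intro cyclic_G_set.intro cyclic_G_set_axioms.intro cyclic_group_ring_axioms hX(1))
  have y0: "\<forall>j<r0. y0 j \<in> carrier MR" "\<forall>j<r0. (TM ^^ (p ^ e0 j)) (y0 j) = y0 j"
    using hX(2) by (auto simp: ME.fixed_def)
  define q where "q = P0.cycle_map MR TM y0"
  note cm = P0.cycle_map[OF MRm TM y0, folded q_def]
  note qD = module_homD[OF cm(2)]
  have q_hom: "q \<in> module_homs S P0.P M"
    by (rule g_equivariant_homI[OF P0.P_module M cm(2)[unfolded MR_def]])
      (use cm(4) in \<open>simp add: TM_def\<close>)
  have lift: "\<exists>u\<in>carrier P0.P. (P0.T ^^ (p ^ m)) u = u \<and> q u = v"
    if m: "m \<le> n" and v: "v \<in> carrier MR" "(TM ^^ (p ^ m)) v = v" for m v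
  proof -
    have "v \<in> module_span R MR (Fm m)" using v Fm(3) by (auto simp: ME.fixed_def)
    then have "\<exists>u\<in>P0.PM.fixed m. q u = v"
    proof induction
      case zero
      have "q \<zero>\<^bsub>P0.PR\<^esub> = \<zero>\<^bsub>MR\<^esub>"
        using qD(3)[OF R.zero_closed P0.PM.M.zero_closed] qD(1)[OF P0.PM.M.zero_closed]
          P0.PM.smult_l_null[OF P0.PM.M.zero_closed] by (simp del: restrict_scalars_simps)
      then show ?case using P0.PM.submoduleD(2)[OF P0.PM.fixed_submodule] by blast
    next
      case (base s)
      then have "(m, s) \<in> h ` {..<r0}" using m h by (auto simp: X_def)
      then obtain j where "j < r0" "h j = (m, s)" by auto
      then have j: "j < r0" "e0 j = m" "y0 j = s" by (auto simp: e0_def y0_def)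
      let ?w = "prod_encode (j, 0)"
      have w: "?w \<in> P0.points" using j by simp
      have "(P0.T ^^ (p ^ m)) (P0.basis ?w) = P0.basis ?w"
        using P0.Tk_basis[OF w] j by simp
      then have "P0.basis ?w \<in> P0.PM.fixed m" using P0.basis_closed by (simp add: P0.PM.fixed_def)
      moreover have "q (P0.basis ?w) = s" using cm(3)[OF w] j by simp
      ultimately show ?case by blast
    next
      case (add a b)
      then obtain u u' where u: "u \<in> P0.PM.fixed m" "q u = a" "u' \<in> P0.PM.fixed m" "q u' = b" by blast
      then have "u \<in> carrier P0.PR" "u' \<in> carrier P0.PR" by (auto simp: P0.PM.fixed_def)
      from qD(2)[OF this] have eq: "q (u \<oplus>\<^bsub>P0.PR\<^esub> u') = a \<oplus>\<^bsub>MR\<^esub> b" unfolding u(2,4) .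
      show ?case 
        by (rule bexI[of _ "u \<oplus>\<^bsub>P0.PR\<^esub> u'"], rule eq, rule P0.PM.submoduleD(3)[OF P0.PM.fixed_submodule u(1,3)])
    next
      case (smult s a)
      then obtain u where u: "u \<in> P0.PM.fixed m" "q u = a" by blast
      then have "u \<in> carrier P0.PR" by (auto simp: P0.PM.fixed_def)
      from qD(3)[OF smult(1) this] have eq: "q (s \<odot>\<^bsub>P0.PR\<^esub> u) = s \<odot>\<^bsub>MR\<^esub> a" unfolding u(2) .
      show ?case 
        by (rule bexI[of _ "s \<odot>\<^bsub>P0.PR\<^esub> u"], rule eq, rule P0.PM.submoduleD(5)[OF P0.PM.fixed_submodule smult(1) u(1)])
    qed
    then show ?thesis by (auto simp: P0.PM.fixed_def)
  qed
  have q_surj: "q ` carrier P0.P = carrier M"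
  proof
    show "q ` carrier P0.P \<subseteq> carrier M" using qD(1) MRc by auto
    show "carrier M \<subseteq> q ` carrier P0.P"
    proof
      fix v assume v: "v \<in> carrier M"
      have "(TM ^^ (p ^ n)) v = v" unfolding TM_def by (rule g_act_period[OF M v])
      with lift[of n v] v MRc obtain u where "u \<in> carrier P0.P" "q u = v" by auto
      then show "v \<in> q ` carrier P0.P" by blast
    qed
  qed
  define L where "L = {f \<in> carrier P0.P. q f = \<zero>\<^bsub>MR\<^esub>}"
  define N where "N = P0.PR\<lparr>carrier := L\<rparr>"
  obtain F1 where cof: "coflasque_endo R p \<pi> N P0.T n F1"
    using P0.kernel_coflasque[OF MRm TM cm(2,4) lift] unfolding N_def L_def by blast
  interpret N: coflasque_endo R p \<pi> N P0.T n F1 by (rule cof)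
  obtain r1 :: nat and y1 e1 where gens: "\<forall>j<r1. e1 j \<le> n \<and> y1 j \<in> N.fixed (e1 j)"
    and indep: "\<forall>c \<in> {..<r1} \<rightarrow> carrier R.
        (\<Oplus>\<^bsub>N\<^esub>j\<in>{..<r1}. c j \<odot>\<^bsub>N\<^esub> (\<Oplus>\<^bsub>N\<^esub>i\<in>{..<p ^ e1 j}. (P0.T ^^ i) (y1 j))) \<in> N.pM \<longrightarrow>
        (\<forall>j<r1. c j \<notin> Units R)"
    and gen: "\<forall>Q. submodule Q R N \<longrightarrow> N.pM \<subseteq> Q \<longrightarrow> (\<forall>v\<in>Q. P0.T v \<in> Q) \<longrightarrow>
        (\<forall>j<r1. y1 j \<in> Q) \<longrightarrow> Q = carrier N"
    using N.permutation_generators by (elim exE conjE) (rule that)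
  interpret P1: cyclic_G_set R p \<pi> G g n e1 r1
    by (intro cyclic_G_set.intro cyclic_G_set_axioms.intro cyclic_group_ring_axioms) (use gens in blast)
  have y1: "\<forall>j<r1. y1 j \<in> carrier N" "\<forall>j<r1. (P0.T ^^ (p ^ e1 j)) (y1 j) = y1 j"
    using gens by (auto simp: N.fixed_def)
  define i where "i = P1.cycle_map N P0.T y1"
  have bij: "bij_betw i (carrier P1.P) (carrier N)"
    unfolding i_def by (rule P1.cycle_map_bij[OF cof y1]) (use indep gen in blast)+
  note ci = P1.cycle_map[OF N.module_axioms N.T_hom y1, folded i_def]
  note iD = module_homD[OF ci(2)]
  have NL: "carrier N = L" by (simp add: N_def)
  have "i \<in> module_homs R P1.PR P0.PR"
  proof (rule module_homI)
    show "i f \<in> carrier P0.PR" if "f \<in> carrier P1.PR" for f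
      using iD(1)[OF that] NL by (simp add: L_def)
    show "i (f \<oplus>\<^bsub>P1.PR\<^esub> f') = i f \<oplus>\<^bsub>P0.PR\<^esub> i f'" if "f \<in> carrier P1.PR" "f' \<in> carrier P1.PR" for f f'
      using iD(2)[OF that] by (simp add: N_def)
    show "i (s \<odot>\<^bsub>P1.PR\<^esub> f) = s \<odot>\<^bsub>P0.PR\<^esub> i f" if "s \<in> carrier R" "f \<in> carrier P1.PR" for s f
      using iD(3)[OF that] by (simp add: N_def)
  qed
  then have i_hom: "i \<in> module_homs S P1.P P0.P"
    by (rule g_equivariant_homI[OF P1.P_module P0.P_module]) (rule ci(4))
  have ker: "i ` carrier P1.P = a_kernel P0.P M q"
    using bij NL by (simp add: bij_betw_def L_def a_kernel_def' MR_def)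
  have "short_exact_lattices R G P1.P i P0.P q M"
    unfolding short_exact_lattices_def
    using P1.P_lattice P0.P_lattice lat i_hom q_hom bij ker q_surj by (simp add: bij_betw_def)
  then show ?thesis
    using P0.points_action P1.points_action finite_cycle_points by blast
qed

theorem theoremC:
  fixes R :: "('r, 'a) ring_scheme" and G :: "('g, 'b) monoid_scheme"
    and M :: "('g \<Rightarrow> 'r, 'm, 'c) module_scheme" and p :: nat
  assumes "discrete_valuation_domain R" and "ring_char_zero R"
    and "normalization_semidom_class.prime p" and "maximalideal (PIdl\<^bsub>R\<^esub> ([p] \<cdot>\<^bsub>R\<^esub> \<one>\<^bsub>R\<^esub>)) R"
    and "group G" and "finite (carrier G)" and "cyclic_group G" and "\<exists>n. order G = p ^ n"
    and "group_ring_lattice R G M"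
  shows "\<exists>(\<Omega>\<^sub>0 :: nat set) \<phi>\<^sub>0 (\<Omega>\<^sub>1 :: nat set) \<phi>\<^sub>1 i q.
           finite \<Omega>\<^sub>0 \<and> group_action G \<Omega>\<^sub>0 \<phi>\<^sub>0 \<and>
           finite \<Omega>\<^sub>1 \<and> group_action G \<Omega>\<^sub>1 \<phi>\<^sub>1 \<and>
           short_exact_lattices R G
             (permutation_module R G \<Omega>\<^sub>1 \<phi>\<^sub>1) i (permutation_module R G \<Omega>\<^sub>0 \<phi>\<^sub>0) q M"
proof -
  obtain n where n: "order G = p ^ n" using assms(8) by blast
  interpret R: p_local_pid R p "[int p] \<cdot>\<^bsub>R\<^esub> \<one>\<^bsub>R\<^esub>"
    by (rule discrete_valuation_domain_p_local_pid[OF assms(1-4)])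
  interpret G: group G by fact
  interpret G: comm_group G by (rule G.cyclic_imp_abelian_group[OF assms(7)])
  obtain g where g: "g \<in> carrier G" "\<forall>h\<in>carrier G. \<exists>k::nat. h = g [^]\<^bsub>G\<^esub> k"
    "\<forall>a b :: nat. g [^]\<^bsub>G\<^esub> a = g [^]\<^bsub>G\<^esub> b \<longleftrightarrow> a mod p ^ n = b mod p ^ n"
    using cyclic_p_group_generator[OF assms(5-7) n] by blast
  have "cyclic_group_ring R p ([int p] \<cdot>\<^bsub>R\<^esub> \<one>\<^bsub>R\<^esub>) G g n"
    using g by (intro cyclic_group_ring.intro R.p_local_pid_axioms finite_group_ring.intro
        R.is_cring G.comm_group_axioms finite_group_ring_axioms.intro assms(6)
        cyclic_group_ring_axioms.intro) auto
  from cyclic_group_ring.lattice_permutation_resolution[OF this assms(9)] show ?thesis .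
qed

end
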